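(* Let $n\ge2$ and use the notation of the context. Every facet of $\overline{C(I,I^m(\mathcal N))}$ either contains $\overline{C(I,I^{V_o,V_c}(\mathcal N))}$ or intersects $\overline{C(I,I^{V_o,V_c}(\mathcal N))}$ in a facet of the latter cone.
   Context: $R$ is the polynomial ring over $\mathbb{C}$ in the Plücker variables $X_{i_1,\ldots,i_k}$, $1\le k\le n-1$, $1\le i_1<\dots<i_k\le n$ ($X_{i_{\sigma(1)}..i_{\sigma(k)}}=\mathrm{sgn}(\sigma)X_{i_1..i_k}$), and $I$ is the kernel of $X_{i_1,\ldots,i_k}\mapsto\det(z_{r,i_s})_{1\le r,s\le k}$. A column $(\alpha_1..\alpha_k)$ is PBW-semistandard if $\alpha_r\le k$ implies $\alpha_r=r$, and $r_1<r_2$, $\alpha_{r_1},\alpha_{r_2}>k$ imply $\alpha_{r_1}>\alpha_{r_2}$; two columns $(\alpha_1..\alpha_k)$, $(\beta_1..\beta_l)$, $k\ge l$, form a PBW-semistandard tableau if each is PBW-semistandard and for each $r\le l$ some $s\ge r$ has $\alpha_s\ge\beta_r$. $\mathcal N$ is the set of $b_{\alpha_1..\alpha_k}$ over one-column PBW-semistandard tableaux ($1\le k\le n-1$), with $b_\beta\le b_\alpha$ iff columns $\alpha,\beta$ (in this order) form a PBW-semistandard tableau; $X_{b_{\alpha_1..\alpha_k}}:=X_{\alpha_1..\alpha_k}$. $I^m(\mathcal N)$ is generated by $X_aX_b$ for incomparable $a,b\in\mathcal N$. Let $P=\{(r,s):1\le r\le s\le n\}\setminus\{(1,1),(n,n)\}$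 with componentwise order; for an order ideal $J$ of $P$, $b(J)=b_{\alpha_1..\alpha_k}$ with $k$ the largest $l$ with $(l,l)\in J$ ($k=1$ if none), $\alpha_s=t$ for each maximal $(s,t)\in J$, $\alpha_r=r$ otherwise; $J\mapsto b(J)$ is a bijection onto $\mathcal N$ with inverse $\iota$. $V_o=\{(i,i):2\le i\le n-1\}$, $V_c=\{(r,s):r<s\}$, $K(J)=(J\cap V_o)\cup\{$maximal elements of $J$ in $V_c\}$. $I^{V_o,V_c}(\mathcal N)$ is the kernel of $R\to\mathbb{C}[z_p\,(p\in P),t]$, $X_b\mapsto t\prod_{p\in K(\iota(b))}z_p$. For $w\in\mathbb{R}^{\mathcal N}$, $\mathrm{in}_wp$ is the part of $p$ of minimal $w$-weight, $\mathrm{in}_wI$ the span of $\mathrm{in}_wp$, $p\in I$, and $C(I,J)=\{w:\mathrm{in}_wI=J\}$; both cones are nonempty. *)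

theory Defs
  imports
    "HOL-Analysis.Analysis"
    "HOL-Library.Poly_Mapping"
    "HOL-Combinatorics.Permutations"
    "HOL-Combinatorics.List_Permutation"
    "Jordan_Normal_Form.Determinant"
begin

section \<open>Polynomials\<close>

type_synonym 'v mpoly = "('v \<Rightarrow>\<^sub>0 nat) \<Rightarrow>\<^sub>0 complex"

definition PVar :: "'v \<Rightarrow> 'v mpoly" where
  "PVar v = Poly_Mapping.single (Poly_Mapping.single v 1) 1"

definition PConst :: "complex \<Rightarrow> 'v mpoly" where
  "PConst c = Poly_Mapping.single 0 c"

text \<open>The homomorphism of \<open>\<complex>\<close>-algebras that sends the variable \<open>v\<close> to \<open>f v\<close>.\<close>

definition psubst :: "('v \<Rightarrow> 'u mpoly) \<Rightarrow> 'v mpoly \<Rightarrow> 'u mpoly" where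
  "psubst f p =
     (\<Sum>m\<in>Poly_Mapping.keys p.
        PConst (Poly_Mapping.lookup p m) *
        (\<Prod>v\<in>Poly_Mapping.keys m. f v ^ Poly_Mapping.lookup m v))"

section \<open>The Pluecker algebra\<close>

text \<open>Columns are lists. The variables of the ring are the strictly increasing lists, and \<open>entry\<close>
  is the 1-based access to a list.\<close>

definition entry :: "nat list \<Rightarrow> nat \<Rightarrow> nat" where
  "entry \<alpha> r = \<alpha> ! (r - 1)"

definition plucker_vars :: "nat \<Rightarrow> nat list set" where
  "plucker_vars n =
     {is. 1 \<le> length is \<and> length is \<le> n - 1 \<and> set is \<subseteq> {1..n} \<and> sorted_wrt (<) is}"

definition plucker_ring :: "nat \<Rightarrow> nat list mpoly set" where
  "plucker_ring n = {p. \<forall>m\<in>Poly_Mapping.keys p. Poly_Mapping.keys m \<subseteq> plucker_vars n}"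

text \<open>For a list \<open>\<alpha>\<close> with distinct entries, the sign of the permutation carrying the increasing
  rearrangement of \<open>\<alpha>\<close> to \<open>\<alpha>\<close>. It gives a meaning to \<open>X\<^sub>\<alpha>\<close> for lists \<open>\<alpha>\<close> that are not increasing.\<close>

definition list_sign :: "nat list \<Rightarrow> int" where
  "list_sign \<alpha> =
     sign (THE \<sigma>. \<sigma> permutes {..<length \<alpha>} \<and> permute_list \<sigma> (sort \<alpha>) = \<alpha>)"

definition plucker_X :: "nat list \<Rightarrow> nat list mpoly" where
  "plucker_X \<alpha> = of_int (list_sign \<alpha>) * PVar (sort \<alpha>)"

definition plucker_minor :: "nat list \<Rightarrow> (nat \<times> nat) mpoly" where
  "plucker_minor is =
     Determinant.det (Matrix.mat (length is) (length is) (\<lambda>(r, s). PVar (r + 1, is ! s)))"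

definition plucker_ideal :: "nat \<Rightarrow> nat list mpoly set" where
  "plucker_ideal n = {p \<in> plucker_ring n. psubst plucker_minor p = 0}"

section \<open>PBW-semistandard tableaux\<close>

definition pbw_column :: "nat list \<Rightarrow> bool" where
  "pbw_column \<alpha> \<longleftrightarrow>
     (\<forall>r\<in>{1..length \<alpha>}. entry \<alpha> r \<le> length \<alpha> \<longrightarrow> entry \<alpha> r = r) \<and>
     (\<forall>r1\<in>{1..length \<alpha>}. \<forall>r2\<in>{1..length \<alpha>}.
        r1 < r2 \<and> entry \<alpha> r1 > length \<alpha> \<and> entry \<alpha> r2 > length \<alpha> \<longrightarrow>
        entry \<alpha> r1 > entry \<alpha> r2)"

definition pbw_tableau :: "nat list \<Rightarrow> nat list \<Rightarrow> bool" where
  "pbw_tableau \<alpha> \<beta> \<longleftrightarrow>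
     length \<beta> \<le> length \<alpha> \<and> pbw_column \<alpha> \<and> pbw_column \<beta> \<and>
     (\<forall>r\<in>{1..length \<beta>}. \<exists>s\<in>{r..length \<alpha>}. entry \<alpha> s \<ge> entry \<beta> r)"

text \<open>The element \<open>b\<^sub>\<alpha>\<close> of \<open>\<N>\<close> is represented by the column \<open>\<alpha>\<close> itself.\<close>

definition pbw_cols :: "nat \<Rightarrow> nat list set" where
  "pbw_cols n =
     {\<alpha>. 1 \<le> length \<alpha> \<and> length \<alpha> \<le> n - 1 \<and> set \<alpha> \<subseteq> {1..n} \<and> pbw_column \<alpha>}"

definition pbw_le :: "nat list \<Rightarrow> nat list \<Rightarrow> bool" where
  "pbw_le \<beta> \<alpha> \<longleftrightarrow> pbw_tableau \<alpha> \<beta>"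

text \<open>The element of \<open>\<N>\<close> with the same set of entries as a given variable; \<open>plucker_X \<alpha>\<close> and the variable
  agree up to sign for this \<open>\<alpha>\<close>.\<close>

definition col_of :: "nat \<Rightarrow> nat list \<Rightarrow> nat list" where
  "col_of n is = (THE \<alpha>. \<alpha> \<in> pbw_cols n \<and> set \<alpha> = set is)"

definition ideal_gen :: "nat \<Rightarrow> nat list mpoly set \<Rightarrow> nat list mpoly set" where
  "ideal_gen n G =
     {\<Sum>g\<in>T. c g * g | T c. finite T \<and> T \<subseteq> G \<and> (\<forall>g\<in>T. c g \<in> plucker_ring n)}"

definition monomial_ideal :: "nat \<Rightarrow> nat list mpoly set" where
  "monomial_ideal n =
     ideal_gen n {plucker_X a * plucker_X b | a b.
       a \<in> pbw_cols n \<and> b \<in> pbw_cols n \<and> \<not> pbw_le a b \<and> \<not> pbw_le b a}"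

section \<open>The poset and its order ideals\<close>

definition pbw_poset :: "nat \<Rightarrow> (nat \<times> nat) set" where
  "pbw_poset n = {(r, s). 1 \<le> r \<and> r \<le> s \<and> s \<le> n} - {(1, 1), (n, n)}"

definition P_le :: "nat \<times> nat \<Rightarrow> nat \<times> nat \<Rightarrow> bool" where
  "P_le p q \<longleftrightarrow> fst p \<le> fst q \<and> snd p \<le> snd q"

definition order_ideals :: "nat \<Rightarrow> (nat \<times> nat) set set" where
  "order_ideals n = {J. J \<subseteq> pbw_poset n \<and> (\<forall>q\<in>J. \<forall>p\<in>pbw_poset n. P_le p q \<longrightarrow> p \<in> J)}"

definition max_elems :: "(nat \<times> nat) set \<Rightarrow> (nat \<times> nat) set" where
  "max_elems J = {p \<in> J. \<forall>q\<in>J. P_le p q \<longrightarrow> q = p}"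

text \<open>As \<open>(1, 1)\<close> is not in \<open>pbw_poset n\<close>, inserting \<open>1\<close> only serves the case that \<open>J\<close> has no diagonal
  element. An order ideal has at most one maximal element in each row.\<close>

definition col_of_ideal :: "(nat \<times> nat) set \<Rightarrow> nat list" where
  "col_of_ideal J =
     map (\<lambda>r. if \<exists>t. (r, t) \<in> max_elems J then THE t. (r, t) \<in> max_elems J else r)
       [1 ..< Suc (Max (insert 1 {l. (l, l) \<in> J}))]"

definition ideal_of_col :: "nat \<Rightarrow> nat list \<Rightarrow> (nat \<times> nat) set" where
  "ideal_of_col n = inv_into (order_ideals n) col_of_ideal"

definition V_o :: "nat \<Rightarrow> (nat \<times> nat) set" where
  "V_o n = {(i, i) | i. 2 \<le> i \<and> i \<le> n - 1}"

definition V_c :: "nat \<Rightarrow> (nat \<times> nat) set" where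
  "V_c n = {(r, s) \<in> pbw_poset n. r < s}"

definition K_set :: "nat \<Rightarrow> (nat \<times> nat) set \<Rightarrow> (nat \<times> nat) set" where
  "K_set n J = (J \<inter> V_o n) \<union> (max_elems J \<inter> V_c n)"

text \<open>The variable \<open>t\<close> is \<open>None\<close> and \<open>z\<^sub>p\<close> is \<open>Some p\<close>. The image of \<open>plucker_X \<alpha>\<close>, \<open>\<alpha> \<in> \<N>\<close>, is to be
  the monomial of \<open>\<alpha>\<close>; the sign turns this into the image of the variable \<open>sort \<alpha>\<close>.\<close>

definition toric_monomial :: "nat \<Rightarrow> nat list \<Rightarrow> (nat \<times> nat) option mpoly" where
  "toric_monomial n \<alpha> = PVar None * (\<Prod>p\<in>K_set n (ideal_of_col n \<alpha>). PVar (Some p))"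

definition toric_image :: "nat \<Rightarrow> nat list \<Rightarrow> (nat \<times> nat) option mpoly" where
  "toric_image n is = of_int (list_sign (col_of n is)) * toric_monomial n (col_of n is)"

definition toric_ideal :: "nat \<Rightarrow> nat list mpoly set" where
  "toric_ideal n = {p \<in> plucker_ring n. psubst (toric_image n) p = 0}"

section \<open>Initial ideals and cones\<close>

text \<open>A weight is given on \<open>\<N>\<close>, that is, on the variables through \<open>col_of\<close>.\<close>

definition weight :: "nat \<Rightarrow> (nat list \<Rightarrow> real) \<Rightarrow> (nat list \<Rightarrow>\<^sub>0 nat) \<Rightarrow> real" where
  "weight n w m = (\<Sum>v\<in>Poly_Mapping.keys m. real (Poly_Mapping.lookup m v) * w (col_of n v))"

definition initial_part :: "nat \<Rightarrow> (nat list \<Rightarrow> real) \<Rightarrow> nat list mpoly \<Rightarrow> nat list mpoly" where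
  "initial_part n w p =
     (\<Sum>m\<in>{m \<in> Poly_Mapping.keys p. \<forall>m'\<in>Poly_Mapping.keys p. weight n w m \<le> weight n w m'}.
        Poly_Mapping.single m (Poly_Mapping.lookup p m))"

definition initial_ideal ::
    "nat \<Rightarrow> (nat list \<Rightarrow> real) \<Rightarrow> nat list mpoly set \<Rightarrow> nat list mpoly set" where
  "initial_ideal n w I = module.span (\<lambda>c p. PConst c * p) (initial_part n w ` I)"

text \<open>The space \<open>\<real>\<^bsup>\<N>\<^esup>\<close> is \<open>real ^ 'b\<close> for a finite type \<open>'b\<close> whose elements label \<open>\<N>\<close> through a
  bijection \<open>e\<close>, so that the coordinate of \<open>w\<close> at \<open>e i\<close> is the \<open>i\<close>-th component.\<close>

definition cone_C ::
    "nat \<Rightarrow> ('b \<Rightarrow> nat list) \<Rightarrow> nat list mpoly set \<Rightarrow> nat list mpoly set \<Rightarrow> (real ^ 'b::finite) set" where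
  "cone_C n e I J = {w. initial_ideal n (\<lambda>\<alpha>. vec_nth w (inv_into UNIV e \<alpha>)) I = J}"

end

(* The monomial cone is nonempty because it has a facet, and without loss of generality the toric
   cone is nonempty. A point w0 of the former makes the products of chains of variables a basis of
   the Pluecker algebra, so every monomial m has a normal form NF(m) modulo the Pluecker ideal. A
   weight w lies in the closure A of the monomial cone iff no term of NF(m) has smaller weight than
   m, for all m; then in_w I is spanned by the differences m - NF_w(m), where NF_w(m) collects the
   terms of weight w(m), and it is determined by the set of pairs of equal weight. As the chains
   are also independent modulo the toric ideal, the closed toric cone is the intersection of A with
   the space L of all w that are constant on the fibres of the toric monomial map.

   Only quadratic monomials ab (a, b incomparable) matter, so a facet of A is given by one equation
   w(ab) = w(cd) with cd a term of NF(ab). As a general point of the facet has no other equality,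
   reducing xab in two ways shows that an x comparable to c and d is comparable to a unless x = b,
   and to b unless x = a. In the lattice of order ideals this forces a and b to differ from their
   intersection by one element each and to be comparable to all the rest of the interval; with the
   equality of contents it follows that the functional w(cd) - w(ab) restricted to L is either zero
   or one of (n-1)(n-2)/2 linearly independent functionals phi_ij. In the first case the facet
   contains the toric cone, in the second one it cuts out a facet. *)

theory Submission
  imports Defs
begin

text \<open>No Pluecker relation is ever written down. The Pluecker ideal enters only as a subspace
  that is graded by column lengths and contents, is closed under multiplication by monomials, and
  has a monomial initial ideal at \<open>w0\<close>; uniqueness of normal forms replaces the
  straightening law. So the terms of NF(ab) stay unknown. All that can be used about a term cd is
  that it has the multidegree of ab and that, up to the order of a and b, it gives the only tie at a
  general point of a facet.

  The obstacle is that one does not learn which functionals really bound A. This does no harm: on L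
  a relation acts only through the difference of the toric exponents of cd and ab, which is 0 or the
  pattern of some phi_ij. Hence the intersection of A and L is cut out of L by inequalities phi_ij
  \<ge> 0 for some set of pairs, and independence makes each of them a facet whatever this set is. A
  vector dual to the phi_ij is an indicator of a rectangle because phi_ij is a mixed second
  difference.\<close>

section \<open>Polynomials and initial forms\<close>

abbreviation "keys \<equiv> Poly_Mapping.keys"
abbreviation "lookup \<equiv> Poly_Mapping.lookup"
abbreviation mon :: "('v \<Rightarrow>\<^sub>0 nat) \<Rightarrow> 'v mpoly" where "mon m \<equiv> Poly_Mapping.single m 1"

lemma lookup_PConst_mult [simp]: "lookup (PConst c * p) m = c * lookup p m"
  unfolding PConst_def mult_map_scale_conv_mult [symmetric] by (simp add: map.rep_eq when_def)

interpretation mpoly: vector_space "\<lambda>c (p :: 'v mpoly). PConst c * p"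
  by unfold_locales
    (simp_all add: PConst_def single_add distrib_left distrib_right mult.assoc [symmetric] mult_single)

lemma keys_PConst_mult: "keys (PConst c * p) \<subseteq> keys p"
  by (auto simp: in_keys_iff)

lemma mono_expand: "finite A \<Longrightarrow> keys p \<subseteq> A \<Longrightarrow> p = (\<Sum>m\<in>A. PConst (lookup p m) * mon m)"
  by (intro poly_mapping_eqI) (auto simp: lookup_sum lookup_single when_def in_keys_iff sum.delta' if_distrib cong: if_cong)

text \<open>A predicate on monomials serves both uses: components of a given weight and components
  of a given multidegree.\<close>

definition part :: "(('v \<Rightarrow>\<^sub>0 nat) \<Rightarrow> bool) \<Rightarrow> 'v mpoly \<Rightarrow> 'v mpoly" where
  "part P p = Poly_Mapping.mapp (\<lambda>m c. if P m then c else 0) p"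

lemma lookup_part: "lookup (part P p) m = (if P m then lookup p m else 0)"
  by (auto simp: part_def lookup_mapp when_def in_keys_iff)

lemma keys_part: "keys (part P p) = {m \<in> keys p. P m}"
  by (auto simp: in_keys_iff lookup_part split: if_splits)

lemma part_add: "part P (p + q) = part P p + part P q"
  and part_scale: "part P (PConst c * p) = PConst c * part P p"
  and part_zero [simp]: "part P 0 = 0"
  by (auto intro!: poly_mapping_eqI simp: lookup_part lookup_add)

lemma part_sum: "part P (\<Sum>i\<in>A. f i) = (\<Sum>i\<in>A. part P (f i))"
  by (rule poly_mapping_eqI) (simp add: lookup_part lookup_sum)

lemma part_cong: "(\<And>m. m \<in> keys p \<Longrightarrow> P m = Q m) \<Longrightarrow> part P p = part Q p"
  by (rule poly_mapping_eqI) (auto simp: lookup_part in_keys_iff)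

text \<open>The weight is an arbitrary function on monomials, which keeps coordinates out of the
  theory of normal forms; additivity is assumed only where products occur.\<close>

definition init_form :: "(('v \<Rightarrow>\<^sub>0 nat) \<Rightarrow> real) \<Rightarrow> 'v mpoly \<Rightarrow> 'v mpoly" where
  "init_form \<omega> p = part (\<lambda>m. \<forall>m'\<in>keys p. \<omega> m \<le> \<omega> m') p"

lemma initial_part_eq: "initial_part n w = init_form (weight n w)"
proof (intro ext)
  fix p
  show "initial_part n w p = init_form (weight n w) p"
    by (rule poly_mapping_eqI)
      (auto simp: initial_part_def init_form_def lookup_part lookup_sum lookup_single when_def in_keys_iff
        sum.delta' if_distrib cong: if_cong)
qed

lemma init_form_zero [simp]: "init_form \<omega> 0 = 0"
  by (simp add: init_form_def)

lemma ex_min_key: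
  assumes "p \<noteq> 0"
  obtains m where "m \<in> keys p" "\<forall>m'\<in>keys p. (\<omega> m :: real) \<le> \<omega> m'"
proof -
  have "finite (\<omega> ` keys p)" "\<omega> ` keys p \<noteq> {}" using assms by auto
  then have "Min (\<omega> ` keys p) \<in> \<omega> ` keys p" by (rule Min_in)
  then obtain m where "m \<in> keys p" "\<omega> m = Min (\<omega> ` keys p)" by auto
  with that show thesis by simp
qed

lemma init_form_eq_part:
  assumes "m \<in> keys p" "\<forall>m'\<in>keys p. \<omega> m \<le> \<omega> m'"
  shows "init_form \<omega> p = part (\<lambda>m'. \<omega> m' = \<omega> m) p"
  unfolding init_form_def by (rule part_cong) (use assms in \<open>force intro: antisym\<close>)

text \<open>An initial form lives in a single weight: if that weight is \<open>x\<close>, the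
  element of \<open>I\<close> it came from is the witness, otherwise 0 is. In a linear combination
  the lowest parts may cancel, so the witness is only required to have no term below
  \<open>x\<close>; its part of weight \<open>x\<close> may be zero.\<close>

lemma part_span_ini:
  assumes I: "mpoly.subspace I" and q: "q \<in> mpoly.span (init_form \<omega> ` I)"
  obtains p where "p \<in> I" "\<And>m. m \<in> keys p \<Longrightarrow> x \<le> \<omega> m" "part (\<lambda>m. \<omega> m = x) q = part (\<lambda>m. \<omega> m = x) p"
proof -
  define H where "H = {q. \<exists>p\<in>I. (\<forall>m\<in>keys p. x \<le> \<omega> m) \<and> part (\<lambda>m. \<omega> m = x) q = part (\<lambda>m. \<omega> m = x) p}"
  have "q \<in> H" using q
  proof (induction rule: mpoly.span_induct_alt)
    case base
    then show ?case using mpoly.subspace_0 [OF I] by (force simp: H_def)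
  next
    case (step c q r)
    then obtain p where p: "p \<in> I" "q = init_form \<omega> p" by auto
    from step obtain s where s: "s \<in> I" "\<forall>m\<in>keys s. x \<le> \<omega> m"
      "part (\<lambda>m. \<omega> m = x) r = part (\<lambda>m. \<omega> m = x) s" by (auto simp: H_def)
    obtain t where t: "t \<in> I" "\<forall>m\<in>keys t. x \<le> \<omega> m"
      "part (\<lambda>m. \<omega> m = x) q = part (\<lambda>m. \<omega> m = x) t"
    proof (cases "p = 0")
      case True
      with that [of 0] p show ?thesis by simp
    next
      case False
      then obtain m where m: "m \<in> keys p" "\<forall>m'\<in>keys p. \<omega> m \<le> \<omega> m'"
        using ex_min_key [where \<omega> = \<omega>] by metis
      have q: "q = part (\<lambda>m'. \<omega> m' = \<omega> m) p" using p(2) init_form_eq_part [of m p \<omega>] m by simp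
      show ?thesis
      proof (cases "\<omega> m = x")
        case True
        have "part (\<lambda>m. \<omega> m = x) q = part (\<lambda>m. \<omega> m = x) p"
          by (rule poly_mapping_eqI) (simp add: q lookup_part True)
        then show ?thesis using that [of p] p m True by blast
      next
        case False
        have "part (\<lambda>m. \<omega> m = x) q = part (\<lambda>m. \<omega> m = x) 0"
          by (rule poly_mapping_eqI) (use False in \<open>simp add: q lookup_part\<close>)
        then show ?thesis using that [of 0] mpoly.subspace_0 [OF I] by auto
      qed
    qed
    have "PConst c * t + s \<in> I" using I s t by (simp add: mpoly.subspace_add mpoly.subspace_scale)
    moreover have "\<forall>m\<in>keys (PConst c * t + s). x \<le> \<omega> m"
      using keys_add [of "PConst c * t" s] keys_PConst_mult [of c t] s t by blast
    ultimately show ?case using s t by (auto simp: H_def part_add part_scale)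
  qed
  then show thesis using that by (auto simp: H_def)
qed

text \<open>The initial ideal is weight-homogeneous: a nonzero part of weight \<open>x\<close> is
  the initial form of the witness from \<open>part_span_ini\<close>.\<close>

lemma part_in_span_ini:
  assumes I: "mpoly.subspace I" and q: "q \<in> mpoly.span (init_form \<omega> ` I)"
  shows "part (\<lambda>m. \<omega> m = x) q \<in> mpoly.span (init_form \<omega> ` I)"
proof -
  obtain p where p: "p \<in> I" "\<And>m. m \<in> keys p \<Longrightarrow> x \<le> \<omega> m" "part (\<lambda>m. \<omega> m = x) q = part (\<lambda>m. \<omega> m = x) p"
    using part_span_ini [OF I q] by metis
  show ?thesis
  proof (cases "part (\<lambda>m. \<omega> m = x) p = 0")
    case True
    then show ?thesis by (simp add: p mpoly.span_zero)
  next
    case False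
    then obtain m where "m \<in> keys (part (\<lambda>m. \<omega> m = x) p)" by (metis all_not_in_conv keys_eq_empty)
    then have "m \<in> keys p" "\<omega> m = x" by (auto simp: keys_part)
    then have "init_form \<omega> p = part (\<lambda>m. \<omega> m = x) p" using init_form_eq_part [of m p \<omega>] p by auto
    then show ?thesis using p mpoly.span_base by (metis imageI)
  qed
qed

section \<open>Normal forms and initial ideals\<close>

text \<open>\<open>S\<close> consists of the standard monomials, those outside the monomial initial
  ideal at \<omega>0. Real weights are not well-founded, so termination of rewriting comes from the
  finite fibres of the multidegree \<open>D\<close>.\<close>

locale monomial_degeneration =
  fixes M S :: "('v \<Rightarrow>\<^sub>0 nat) set" and I :: "'v mpoly set"
    and D :: "('v \<Rightarrow>\<^sub>0 nat) \<Rightarrow> 'd" and \<omega>0 :: "('v \<Rightarrow>\<^sub>0 nat) \<Rightarrow> real"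
  assumes S_sub: "S \<subseteq> M"
    and subspace_I: "mpoly.subspace I"
    and keys_I: "p \<in> I \<Longrightarrow> keys p \<subseteq> M"
    and finite_D: "finite {m \<in> M. D m = d}"
    and graded_I: "p \<in> I \<Longrightarrow> part (\<lambda>m. D m = d) p \<in> I"
    and init_I: "mpoly.span (init_form \<omega>0 ` I) = {p. keys p \<subseteq> M - S}"
begin

lemmas I_zero = mpoly.subspace_0 [OF subspace_I]
  and I_add = mpoly.subspace_add [OF subspace_I]
  and I_diff = mpoly.subspace_diff [OF subspace_I]
  and I_scale = mpoly.subspace_scale [OF subspace_I]
  and I_sum = mpoly.subspace_sum [OF subspace_I]

text \<open>A term of least weight of a nonzero \<open>p\<close> survives in its initial form and is
  therefore nonstandard.\<close>

lemma standard_I_zero: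
  assumes "p \<in> I" "keys p \<subseteq> S"
  shows "p = 0"
proof (rule ccontr)
  assume "p \<noteq> 0"
  then obtain m where m: "m \<in> keys p" "\<forall>m'\<in>keys p. \<omega>0 m \<le> \<omega>0 m'" using ex_min_key [where \<omega> = \<omega>0] by metis
  then have "m \<in> keys (init_form \<omega>0 p)" by (auto simp: init_form_def keys_part)
  moreover have "init_form \<omega>0 p \<in> mpoly.span (init_form \<omega>0 ` I)" using assms by (intro mpoly.span_base) auto
  ultimately have "m \<in> M - S" using init_I by auto
  with m assms show False by auto
qed

text \<open>With \<open>x\<close> the weight of \<open>m\<close>, \<open>part_span_ini\<close>
  yields an element of \<open>I\<close> whose lowest part is exactly \<open>m\<close>; cutting it to
  the multidegree of \<open>m\<close> keeps it in \<open>I\<close>.\<close>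

lemma rewrite_step:
  assumes m: "m \<in> M - S"
  obtains p where "p \<in> I" "lookup p m = 1"
    "\<And>m'. m' \<in> keys p \<Longrightarrow> m' \<noteq> m \<Longrightarrow> m' \<in> M \<and> D m' = D m \<and> \<omega>0 m < \<omega>0 m'"
proof -
  have "mon m \<in> mpoly.span (init_form \<omega>0 ` I)" using m by (auto simp: init_I)
  then obtain p where p: "p \<in> I" "\<And>m'. m' \<in> keys p \<Longrightarrow> \<omega>0 m \<le> \<omega>0 m'"
    "part (\<lambda>m'. \<omega>0 m' = \<omega>0 m) (mon m) = part (\<lambda>m'. \<omega>0 m' = \<omega>0 m) p"
    using part_span_ini [OF subspace_I, where x = "\<omega>0 m"] by metis
  have eq: "lookup p m' = lookup (mon m) m'" if "\<omega>0 m' = \<omega>0 m" for m'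
    using arg_cong [OF p(3), of "\<lambda>q. lookup q m'"] that by (simp add: lookup_part)
  show thesis
  proof (rule that)
    show "part (\<lambda>m'. D m' = D m) p \<in> I" by (rule graded_I [OF p(1)])
    show "lookup (part (\<lambda>m'. D m' = D m) p) m = 1" by (simp add: lookup_part eq)
    fix m' assume m': "m' \<in> keys (part (\<lambda>m'. D m' = D m) p)" "m' \<noteq> m"
    then have k: "m' \<in> keys p" and "D m' = D m" by (auto simp: keys_part)
    moreover have "\<omega>0 m' \<noteq> \<omega>0 m"
    proof
      assume "\<omega>0 m' = \<omega>0 m"
      from eq [OF this] m'(2) k show False by (simp add: lookup_single in_keys_iff)
    qed
    ultimately show "m' \<in> M \<and> D m' = D m \<and> \<omega>0 m < \<omega>0 m'"
      using p(2) [OF k] keys_I [OF p(1)] by auto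
  qed
qed

text \<open>Induction from heavy to light; the measure counts the strictly heavier monomials of the
  same multidegree.\<close>

lemma weight_induct [consumes 1, case_names step]:
  assumes "m \<in> M"
    and step: "\<And>m. m \<in> M \<Longrightarrow> (\<And>m'. m' \<in> M \<Longrightarrow> D m' = D m \<Longrightarrow> \<omega>0 m < \<omega>0 m' \<Longrightarrow> P m') \<Longrightarrow> P m"
  shows "P m"
  using assms(1)
proof (induction "card {m' \<in> M. D m' = D m \<and> \<omega>0 m < \<omega>0 m'}" arbitrary: m rule: less_induct)
  case less
  show ?case
  proof (rule step [OF less.prems])
    fix m' assume m': "m' \<in> M" "D m' = D m" "\<omega>0 m < \<omega>0 m'"
    have "{m'' \<in> M. D m'' = D m' \<and> \<omega>0 m' < \<omega>0 m''} \<subset> {m'' \<in> M. D m'' = D m \<and> \<omega>0 m < \<omega>0 m''}"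
      using m' by auto
    moreover have "finite {m'' \<in> M. D m'' = D m \<and> \<omega>0 m < \<omega>0 m''}"
      by (rule finite_subset [OF _ finite_D [of "D m"]]) auto
    ultimately show "P m'" using m' by (intro less.hyps psubset_card_mono)
  qed
qed

lemma ex_normal_form:
  assumes "m \<in> M"
  shows "\<exists>q. keys q \<subseteq> S \<and> mon m - q \<in> I \<and> (\<forall>m'\<in>keys q. D m' = D m) \<and>
    (if m \<in> S then q = mon m else \<forall>m'\<in>keys q. \<omega>0 m < \<omega>0 m')"
  using assms
proof (induction rule: weight_induct)
  case (step m)
  show ?case
  proof (cases "m \<in> S")
    case True
    then show ?thesis using I_zero by (intro exI [of _ "mon m"]) auto
  next
    case False
    with step.hyps obtain p where p: "p \<in> I" "lookup p m = 1"
      "\<And>m'. m' \<in> keys p \<Longrightarrow> m' \<noteq> m \<Longrightarrow> m' \<in> M \<and> D m' = D m \<and> \<omega>0 m < \<omega>0 m'"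
      using rewrite_step by (metis DiffI)
    define r where "r = mon m - p"
    have r: "m' \<in> M \<and> D m' = D m \<and> \<omega>0 m < \<omega>0 m'" if "m' \<in> keys r" for m'
    proof -
      have "m' \<noteq> m" using that p(2) by (auto simp: r_def in_keys_iff lookup_minus)
      with that have "m' \<in> keys p" by (auto simp: r_def in_keys_iff lookup_minus lookup_single)
      with p(3) \<open>m' \<noteq> m\<close> show ?thesis by blast
    qed
    \<comment> \<open>A standard \<open>m'\<close> is its own normal form, so only the weak
      inequality is passed on here; strictness comes from the step from \<open>m\<close> to
      \<open>m'\<close>.\<close>
    have "\<forall>m'\<in>keys r. \<exists>q. keys q \<subseteq> S \<and> mon m' - q \<in> I \<and> (\<forall>m''\<in>keys q. D m'' = D m) \<and>
        (\<forall>m''\<in>keys q. \<omega>0 m' \<le> \<omega>0 m'')"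
    proof
      fix m' assume "m' \<in> keys r"
      with r have "m' \<in> M" "D m' = D m" "\<omega>0 m < \<omega>0 m'" by auto
      from step.IH [OF this] obtain q where q: "keys q \<subseteq> S" "mon m' - q \<in> I" "\<forall>m''\<in>keys q. D m'' = D m'"
        "if m' \<in> S then q = mon m' else \<forall>m''\<in>keys q. \<omega>0 m' < \<omega>0 m''" by blast
      moreover have "\<forall>m''\<in>keys q. \<omega>0 m' \<le> \<omega>0 m''" using q(4) by (auto split: if_splits)
      ultimately show "\<exists>q. keys q \<subseteq> S \<and> mon m' - q \<in> I \<and> (\<forall>m''\<in>keys q. D m'' = D m) \<and>
        (\<forall>m''\<in>keys q. \<omega>0 m' \<le> \<omega>0 m'')" using \<open>D m' = D m\<close> by metis
    qed
    then obtain f where f: "\<And>m'. m' \<in> keys r \<Longrightarrow> keys (f m') \<subseteq> S \<and> mon m' - f m' \<in> I \<and>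
        (\<forall>m''\<in>keys (f m'). D m'' = D m) \<and> (\<forall>m''\<in>keys (f m'). \<omega>0 m' \<le> \<omega>0 m'')"
      by metis
    define q where "q = (\<Sum>m'\<in>keys r. PConst (lookup r m') * f m')"
    have kq: "\<exists>m'\<in>keys r. m'' \<in> keys (f m')" if "m'' \<in> keys q" for m''
      using that keys_sum [of "\<lambda>m'. PConst (lookup r m') * f m'" "keys r"] keys_PConst_mult unfolding q_def by blast
    have "r - q = (\<Sum>m'\<in>keys r. PConst (lookup r m') * (mon m' - f m'))"
      using mono_expand [of "keys r" r] by (simp add: q_def right_diff_distrib sum_subtractf)
    also have "\<dots> \<in> I" by (intro I_sum I_scale) (use f in blast)
    finally have "p + (r - q) \<in> I" using p(1) I_add by blast
    then have "mon m - q \<in> I" by (simp add: r_def)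
    moreover have "keys q \<subseteq> S" using kq f by blast
    moreover have "\<forall>m''\<in>keys q. D m'' = D m" using kq f by blast
    moreover have "\<forall>m''\<in>keys q. \<omega>0 m < \<omega>0 m''"
    proof
      fix m'' assume "m'' \<in> keys q"
      with kq obtain m' where "m' \<in> keys r" "m'' \<in> keys (f m')" by blast
      with r f show "\<omega>0 m < \<omega>0 m''" using less_le_trans by blast
    qed
    ultimately show ?thesis using False by auto
  qed
qed

definition NF :: "('v \<Rightarrow>\<^sub>0 nat) \<Rightarrow> 'v mpoly" where
  "NF m = (SOME q. keys q \<subseteq> S \<and> mon m - q \<in> I \<and> (\<forall>m'\<in>keys q. D m' = D m) \<and>
    (if m \<in> S then q = mon m else \<forall>m'\<in>keys q. \<omega>0 m < \<omega>0 m'))"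

lemma
  assumes "m \<in> M"
  shows keys_NF: "keys (NF m) \<subseteq> S"
    and NF_I: "mon m - NF m \<in> I"
    and NF_D: "m' \<in> keys (NF m) \<Longrightarrow> D m' = D m"
    and NF_standard: "m \<in> S \<Longrightarrow> NF m = mon m"
    and NF_weight: "m \<notin> S \<Longrightarrow> m' \<in> keys (NF m) \<Longrightarrow> \<omega>0 m < \<omega>0 m'"
  using someI_ex [OF ex_normal_form [OF assms], folded NF_def] by (auto split: if_splits)

text \<open>Two candidates differ by an element of \<open>I\<close> with standard terms only. This
  plays the part of confluence.\<close>

lemma NF_unique:
  assumes "m \<in> M" "keys q \<subseteq> S" "mon m - q \<in> I"
  shows "NF m = q"
proof -
  have "(mon m - q) - (mon m - NF m) \<in> I" using assms NF_I I_diff by blast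
  then have "NF m - q \<in> I" by simp
  moreover have "keys (NF m - q) \<subseteq> S" using keys_diff [of "NF m" q] keys_NF assms by blast
  ultimately have "NF m - q = 0" by (rule standard_I_zero)
  then show ?thesis by simp
qed

text \<open>The remaining combination of normal forms lies in \<open>I\<close> and has only standard
  terms, so it vanishes. Thus the differences \<open>mon m - NF m\<close> span
  \<open>I\<close>.\<close>

lemma NF_combination:
  assumes "p \<in> I"
  shows "p = (\<Sum>m\<in>keys p. PConst (lookup p m) * (mon m - NF m))"
proof -
  define q where "q = (\<Sum>m\<in>keys p. PConst (lookup p m) * NF m)"
  have M: "m \<in> M" if "m \<in> keys p" for m using keys_I [OF assms] that by auto
  have p: "p - q = (\<Sum>m\<in>keys p. PConst (lookup p m) * (mon m - NF m))"
    using mono_expand [of "keys p" p] by (simp add: q_def right_diff_distrib sum_subtractf)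
  also have "\<dots> \<in> I" by (intro I_sum I_scale NF_I M)
  finally have "p - (p - q) \<in> I" using assms I_diff by blast
  then have "q \<in> I" by simp
  moreover have "keys q \<subseteq> S"
    using keys_sum [of "\<lambda>m. PConst (lookup p m) * NF m" "keys p"] keys_PConst_mult keys_NF M
    unfolding q_def by blast
  ultimately have "q = 0" by (rule standard_I_zero)
  with p show ?thesis by simp
qed

text \<open>These inequalities will describe the closed cone \<open>A\<close>;
  \<open>monotone_weightI\<close> cuts them down to the quadratic ones.\<close>

definition monotone_weight :: "(('v \<Rightarrow>\<^sub>0 nat) \<Rightarrow> real) \<Rightarrow> bool" where
  "monotone_weight \<omega> \<longleftrightarrow> (\<forall>m\<in>M. \<forall>m'\<in>keys (NF m). \<omega> m \<le> \<omega> m')"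

text \<open>If a term of \<open>NF m\<close> were lighter than \<open>m\<close>, the initial form of
  \<open>mon m - NF m\<close> would lose \<open>m\<close> and be a nonzero combination of standard
  monomials.\<close>

lemma monotone_weight_if_standard_free:
  assumes "\<And>q. q \<in> mpoly.span (init_form \<omega> ` I) \<Longrightarrow> keys q \<subseteq> S \<Longrightarrow> q = 0"
  shows "monotone_weight \<omega>"
  unfolding monotone_weight_def
proof (intro ballI, rule ccontr)
  fix m m' assume m: "m \<in> M" "m' \<in> keys (NF m)" "\<not> \<omega> m \<le> \<omega> m'"
  define p where "p = mon m - NF m"
  have "m \<noteq> m'" using m(3) by auto
  then have m': "m' \<in> keys p" using m(2) by (auto simp: p_def in_keys_iff lookup_minus lookup_single)
  then have "p \<noteq> 0" by auto
  then obtain m0 where m0: "m0 \<in> keys p" "\<forall>m'\<in>keys p. \<omega> m0 \<le> \<omega> m'" using ex_min_key [where \<omega> = \<omega>] by metis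
  have "init_form \<omega> p \<in> mpoly.span (init_form \<omega> ` I)" using NF_I [OF m(1)] by (auto simp: p_def intro: mpoly.span_base)
  moreover have "keys (init_form \<omega> p) \<subseteq> S"
  proof
    fix m'' assume "m'' \<in> keys (init_form \<omega> p)"
    then have "m'' \<in> keys p" "\<omega> m'' \<le> \<omega> m'" using m' by (auto simp: init_form_def keys_part)
    then have "m'' \<noteq> m" using m(3) by auto
    with \<open>m'' \<in> keys p\<close> have "m'' \<in> keys (NF m)" by (auto simp: p_def in_keys_iff lookup_minus lookup_single)
    with keys_NF [OF m(1)] show "m'' \<in> S" by auto
  qed
  ultimately have "init_form \<omega> p = 0" by (rule assms)
  moreover have "m0 \<in> keys (init_form \<omega> p)" using m0 by (auto simp: init_form_def keys_part)
  ultimately show False by simp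
qed

lemma part_NF:
  assumes "monotone_weight \<omega>" "m \<in> M"
  shows "part (\<lambda>m'. \<omega> m' = \<omega> m) (mon m - NF m) \<in> mpoly.span (init_form \<omega> ` I)"
proof (cases "m \<in> S")
  case True
  then show ?thesis using assms(2) by (simp add: NF_standard mpoly.span_zero)
next
  case False
  define p where "p = mon m - NF m"
  have "m \<notin> keys (NF m)" using False keys_NF [OF assms(2)] by auto
  then have "m \<in> keys p" by (simp add: p_def in_keys_iff lookup_minus)
  moreover have "\<forall>m'\<in>keys p. \<omega> m \<le> \<omega> m'"
  proof
    fix m' assume "m' \<in> keys p"
    then have "m' \<in> keys (NF m) \<or> m' = m" by (auto simp: p_def in_keys_iff lookup_minus lookup_single)
    with assms show "\<omega> m \<le> \<omega> m'" by (auto simp: monotone_weight_def)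
  qed
  ultimately have "init_form \<omega> p = part (\<lambda>m'. \<omega> m' = \<omega> m) p" by (rule init_form_eq_part)
  then show ?thesis using NF_I [OF assms(2)] by (metis p_def image_eqI mpoly.span_base)
qed

text \<open>For a monotone weight the initial ideal is spanned by the parts of
  \<open>mon m - NF m\<close> that have the weight of \<open>m\<close>, and these depend only on
  which terms tie with \<open>m\<close>.\<close>

lemma span_ini_subset:
  assumes mono: "monotone_weight \<omega>" "monotone_weight \<omega>'"
    and eq: "\<And>m m'. m \<in> M \<Longrightarrow> m' \<in> keys (NF m) \<Longrightarrow> \<omega> m' = \<omega> m \<longleftrightarrow> \<omega>' m' = \<omega>' m"
  shows "mpoly.span (init_form \<omega> ` I) \<subseteq> mpoly.span (init_form \<omega>' ` I)"
proof (rule mpoly.span_minimal [OF _ mpoly.subspace_span], safe)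
  fix p assume p: "p \<in> I"
  show "init_form \<omega> p \<in> mpoly.span (init_form \<omega>' ` I)"
  proof (cases "p = 0")
    case True
    then show ?thesis by (simp add: mpoly.span_zero)
  next
    case False
    then obtain m0 where m0: "m0 \<in> keys p" "\<forall>m'\<in>keys p. \<omega> m0 \<le> \<omega> m'" using ex_min_key [where \<omega> = \<omega>] by metis
    have "init_form \<omega> p = part (\<lambda>m'. \<omega> m' = \<omega> m0) p" using m0 by (rule init_form_eq_part)
    also have "\<dots> = (\<Sum>m\<in>keys p. PConst (lookup p m) * part (\<lambda>m'. \<omega> m' = \<omega> m0) (mon m - NF m))"
      by (subst NF_combination [OF p]) (simp add: part_sum part_scale)
    also have "\<dots> \<in> mpoly.span (init_form \<omega>' ` I)"
    proof (intro mpoly.span_sum mpoly.span_scale)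
      fix m assume m: "m \<in> keys p"
      with keys_I [OF p] have M: "m \<in> M" by auto
      have k: "m' \<in> keys (NF m) \<or> m' = m" if "m' \<in> keys (mon m - NF m)" for m'
        using that by (auto simp: in_keys_iff lookup_minus lookup_single)
      show "part (\<lambda>m'. \<omega> m' = \<omega> m0) (mon m - NF m) \<in> mpoly.span (init_form \<omega>' ` I)"
      proof (cases "\<omega> m = \<omega> m0")
        case True
        have "part (\<lambda>m'. \<omega> m' = \<omega> m0) (mon m - NF m) = part (\<lambda>m'. \<omega>' m' = \<omega>' m) (mon m - NF m)"
          by (rule part_cong) (use k eq [OF M] True in auto)
        then show ?thesis using part_NF [OF mono(2) M] by simp
      next
        case False
        \<comment> \<open>Here \<open>m\<close> is above the minimum, and monotonicity puts all of
          \<open>NF m\<close> above it too, so this summand contributes nothing.\<close>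
        with m0 m have "\<omega> m0 < \<omega> m" by force
        moreover have "\<omega> m \<le> \<omega> m'" if "m' \<in> keys (mon m - NF m)" for m'
          using k [OF that] mono(1) M by (auto simp: monotone_weight_def)
        ultimately have "part (\<lambda>m'. \<omega> m' = \<omega> m0) (mon m - NF m) = 0"
          by (intro poly_mapping_eqI) (force simp: lookup_part in_keys_iff)
        then show ?thesis by (simp add: mpoly.span_zero)
      qed
    qed
    finally show ?thesis .
  qed
qed

lemma span_ini_eq:
  assumes "monotone_weight \<omega>" "monotone_weight \<omega>'"
    and "\<And>m m'. m \<in> M \<Longrightarrow> m' \<in> keys (NF m) \<Longrightarrow> \<omega> m' = \<omega> m \<longleftrightarrow> \<omega>' m' = \<omega>' m"
  shows "mpoly.span (init_form \<omega> ` I) = mpoly.span (init_form \<omega>' ` I)"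
  using span_ini_subset [of \<omega> \<omega>'] span_ini_subset [of \<omega>' \<omega>] assms by auto

end

section \<open>Quadratic relations and S-pairs\<close>

text \<open>One additive extension from variables to monomials covers real weights as well as
  natural degrees.\<close>

definition mlin :: "('v \<Rightarrow> 'a) \<Rightarrow> ('v \<Rightarrow>\<^sub>0 nat) \<Rightarrow> 'a::comm_semiring_1" where
  "mlin c m = (\<Sum>v\<in>keys m. of_nat (lookup m v) * c v)"

lemma mlin_superset: "finite A \<Longrightarrow> keys m \<subseteq> A \<Longrightarrow> mlin c m = (\<Sum>v\<in>A. of_nat (lookup m v) * c v)"
  unfolding mlin_def by (rule sum.mono_neutral_left) (auto simp: in_keys_iff)

lemma mlin_add: "mlin c (m + m') = mlin c m + mlin c m'"
proof -
  have "keys (m + m') \<subseteq> keys m \<union> keys m'" by (rule keys_add)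
  then show ?thesis
    by (subst (1 2 3) mlin_superset [of "keys m \<union> keys m'"]) (auto simp: lookup_add algebra_simps sum.distrib)
qed

lemma mlin_zero [simp]: "mlin c 0 = 0"
  by (simp add: mlin_def)

lemma mlin_single [simp]: "mlin c (Poly_Mapping.single v k) = of_nat k * c v"
  by (subst mlin_superset [of "{v}"]) auto

definition vpair :: "'v \<Rightarrow> 'v \<Rightarrow> ('v \<Rightarrow>\<^sub>0 nat)" where
  "vpair a b = Poly_Mapping.single a 1 + Poly_Mapping.single b 1"

lemma vpair_commute: "vpair a b = vpair b a"
  by (simp add: vpair_def add.commute)

lemma lookup_vpair: "lookup (vpair a b) v = (if a = v then 1 else 0) + (if b = v then 1 else 0)"
  by (simp add: vpair_def lookup_add lookup_single when_def)

lemma keys_vpair [simp]: "keys (vpair a b) = {a, b}"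
  by (auto simp: in_keys_iff lookup_vpair split: if_splits)

lemma mlin_vpair [simp]: "mlin c (vpair a b) = c a + c b"
  by (simp add: vpair_def mlin_add)

lemma keys_add_nat: "keys (m + m' :: 'v \<Rightarrow>\<^sub>0 nat) = keys m \<union> keys m'"
  by (auto simp: in_keys_iff lookup_add)

text \<open>Standard monomials are products of chains, so a single incomparable pair witnesses that
  a monomial is nonstandard; this is the source of the reduction to quadratic relations.
  \<open>D_add\<close> only asks equality of multidegrees to be a congruence, which leaves the type
  of degrees free.\<close>

locale chain_degeneration = monomial_degeneration M S I D \<omega>0
  for M S :: "('v \<Rightarrow>\<^sub>0 nat) set" and I D \<omega>0 +
  fixes V :: "'v set" and cmp :: "'v \<Rightarrow> 'v \<Rightarrow> bool"
  assumes M_eq: "M = {m. keys m \<subseteq> V}"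
    and S_eq: "S = {m \<in> M. \<forall>u\<in>keys m. \<forall>v\<in>keys m. cmp u v}"
    and cmp_refl: "v \<in> V \<Longrightarrow> cmp v v"
    and mult_I: "x \<in> M \<Longrightarrow> p \<in> I \<Longrightarrow> mon x * p \<in> I"
    and D_add: "D m = D m' \<Longrightarrow> D (x + m) = D (x + m')"
    and \<omega>0_add: "\<omega>0 (m + m') = \<omega>0 m + \<omega>0 m'"
begin

lemma M_add: "m \<in> M \<Longrightarrow> m' \<in> M \<Longrightarrow> m + m' \<in> M"
  by (simp add: M_eq keys_add_nat)

lemma nonstandard_split:
  assumes "m \<in> M - S"
  obtains x a b where "x \<in> M" "a \<in> V" "b \<in> V" "\<not> cmp a b" "m = x + vpair a b"
proof -
  from assms obtain a b where ab: "a \<in> keys m" "b \<in> keys m" "\<not> cmp a b" and V: "keys m \<subseteq> V"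
    by (auto simp: S_eq M_eq)
  then have "a \<noteq> b" using cmp_refl by auto
  define x where "x = m - vpair a b"
  have "m = x + vpair a b"
    using ab \<open>a \<noteq> b\<close> by (intro poly_mapping_eqI) (auto simp: x_def lookup_add lookup_minus lookup_vpair in_keys_iff)
  moreover have "x \<in> M" using V by (auto simp: M_eq x_def in_keys_iff lookup_minus)
  ultimately show thesis using that ab V by blast
qed

text \<open>Reducing \<open>m\<close> first and its products with \<open>x\<close> afterwards must
  end in the same standard polynomial, by uniqueness.\<close>

lemma NF_add:
  assumes "x \<in> M" "m \<in> M"
  shows "NF (x + m) = (\<Sum>m'\<in>keys (NF m). PConst (lookup (NF m) m') * NF (x + m'))"
proof (rule NF_unique)
  define c where "c = lookup (NF m)"
  define K where "K = keys (NF m)"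
  have K: "m' \<in> M" if "m' \<in> K" for m' using that keys_NF [OF assms(2)] S_sub by (auto simp: K_def)
  have KM: "x + m' \<in> M" if "m' \<in> K" for m' using K [OF that] assms(1) by (rule M_add [rotated])
  show "x + m \<in> M" using assms by (rule M_add)
  show "keys (\<Sum>m'\<in>keys (NF m). PConst (lookup (NF m) m') * NF (x + m')) \<subseteq> S"
    unfolding K_def [symmetric] c_def [symmetric]
    using keys_sum [of "\<lambda>m'. PConst (c m') * NF (x + m')" K] keys_PConst_mult keys_NF KM by blast
  have NFm: "NF m = (\<Sum>m'\<in>K. PConst (c m') * mon m')"
    unfolding K_def c_def by (rule mono_expand) auto
  have "mon x * NF m = (\<Sum>m'\<in>K. PConst (c m') * mon (x + m'))"
    by (subst NFm) (simp add: sum_distrib_left mult_single mult.left_commute)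
  then have "mon (x + m) - (\<Sum>m'\<in>K. PConst (c m') * NF (x + m')) =
      mon x * (mon m - NF m) + (\<Sum>m'\<in>K. PConst (c m') * (mon (x + m') - NF (x + m')))"
    by (simp add: right_diff_distrib sum_subtractf mult_single)
  also have "\<dots> \<in> I"
    by (intro I_add I_sum I_scale mult_I NF_I KM assms)
  finally show "mon (x + m) - (\<Sum>m'\<in>keys (NF m). PConst (lookup (NF m) m') * NF (x + m')) \<in> I"
    by (simp add: K_def c_def)
qed

lemma lookup_NF_add:
  assumes "x \<in> M" "m \<in> M"
  shows "lookup (NF (x + m)) \<mu> = (\<Sum>m'\<in>keys (NF m). lookup (NF m) m' * lookup (NF (x + m')) \<mu>)"
  by (simp add: NF_add [OF assms] lookup_sum)

lemma keys_NF_add: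
  assumes "x \<in> M" "m \<in> M" "\<mu> \<in> keys (NF (x + m))"
  obtains m' where "m' \<in> keys (NF m)" "\<mu> \<in> keys (NF (x + m'))"
proof -
  have "(\<Sum>m'\<in>keys (NF m). lookup (NF m) m' * lookup (NF (x + m')) \<mu>) \<noteq> 0"
    using assms by (simp add: in_keys_iff lookup_NF_add)
  then obtain m' where "m' \<in> keys (NF m)" "lookup (NF m) m' * lookup (NF (x + m')) \<mu> \<noteq> 0"
    by (metis (no_types, lifting) sum.neutral)
  with that show thesis by (simp add: in_keys_iff)
qed

text \<open>The first step on \<open>x * a * b\<close> replaces \<open>a * b\<close> by its normal
  form, which does not lower \<omega> by hypothesis; the monomials obtained are heavier for
  \<omega>0, where the induction hypothesis takes over.\<close>

lemma monotone_weightI: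
  fixes \<omega> :: "('v \<Rightarrow>\<^sub>0 nat) \<Rightarrow> real"
  assumes add: "\<And>m m'. \<omega> (m + m') = \<omega> m + \<omega> m'"
    and quad: "\<And>a b m'. a \<in> V \<Longrightarrow> b \<in> V \<Longrightarrow> \<not> cmp a b \<Longrightarrow> m' \<in> keys (NF (vpair a b)) \<Longrightarrow> \<omega> (vpair a b) \<le> \<omega> m'"
  shows "monotone_weight \<omega>"
  unfolding monotone_weight_def
proof
  fix m assume "m \<in> M"
  then show "\<forall>m'\<in>keys (NF m). \<omega> m \<le> \<omega> m'"
  proof (induction rule: weight_induct)
    case (step m)
    show ?case
    proof (cases "m \<in> S")
      case True
      then show ?thesis using step by (simp add: NF_standard)
    next
      case False
      with step.hyps obtain x a b where m: "x \<in> M" "a \<in> V" "b \<in> V" "\<not> cmp a b" "m = x + vpair a b"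
        using nonstandard_split by (metis DiffI)
      have ab: "vpair a b \<in> M" "vpair a b \<notin> S" using m by (auto simp: M_eq S_eq)
      show ?thesis
      proof
        fix m'' assume "m'' \<in> keys (NF m)"
        then obtain m' where m': "m' \<in> keys (NF (vpair a b))" "m'' \<in> keys (NF (x + m'))"
          using keys_NF_add [OF m(1) ab(1)] m(5) by metis
        have "m' \<in> M" using m'(1) keys_NF [OF ab(1)] S_sub by auto
        then have "x + m' \<in> M" using m(1) M_add by blast
        moreover have "D (x + m') = D m" using NF_D [OF ab(1) m'(1)] D_add m(5) by metis
        moreover have "\<omega>0 m < \<omega>0 (x + m')" using NF_weight [OF ab(1) ab(2) m'(1)] m(5) by (simp add: \<omega>0_add)
        ultimately have "\<forall>m''\<in>keys (NF (x + m')). \<omega> (x + m') \<le> \<omega> m''" by (rule step.IH)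
        then have "\<omega> (x + m') \<le> \<omega> m''" using m' by blast
        moreover have "\<omega> m \<le> \<omega> (x + m')" using quad [OF m(2-4) m'(1)] m(5) by (simp add: add)
        ultimately show "\<omega> m \<le> \<omega> m''" by simp
      qed
    qed
  qed
qed

lemma lookup_NF_add_zero:
  fixes \<omega> :: "('v \<Rightarrow>\<^sub>0 nat) \<Rightarrow> real"
  assumes mono: "monotone_weight \<omega>" and add: "\<And>m m'. \<omega> (m + m') = \<omega> m + \<omega> m'"
    and "x \<in> M" "m' \<in> M" and "\<omega> \<mu> < \<omega> (x + m')"
  shows "lookup (NF (x + m')) \<mu> = 0"
  using mono M_add [OF assms(3,4)] assms(5) unfolding monotone_weight_def by (metis in_keys_iff leD)

text \<open>If exactly one term of one quadratic relation ties with its leading monomial, then the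
  S-pair of that relation with a monomial relation has to reduce to zero.\<close>

lemma s_pair_obstruction:
  fixes \<omega> :: "('v \<Rightarrow>\<^sub>0 nat) \<Rightarrow> real"
  assumes mono: "monotone_weight \<omega>" and add: "\<And>m m'. \<omega> (m + m') = \<omega> m + \<omega> m'"
    and ab: "a \<in> V" "b \<in> V" "\<not> cmp a b" and m': "m' \<in> keys (NF (vpair a b))" and tie: "\<omega> m' = \<omega> (vpair a b)"
    and strict: "\<And>a' b' m''. a' \<in> V \<Longrightarrow> b' \<in> V \<Longrightarrow> \<not> cmp a' b' \<Longrightarrow> m'' \<in> keys (NF (vpair a' b')) \<Longrightarrow>
      (vpair a' b', m'') \<noteq> (vpair a b, m') \<Longrightarrow> \<omega> (vpair a' b') < \<omega> m''"
    and x: "x \<in> V" "\<not> cmp x a" "x \<noteq> b"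
  shows "Poly_Mapping.single x 1 + m' \<notin> S"
proof
  let ?x = "Poly_Mapping.single x (1::nat)" and ?b = "Poly_Mapping.single b (1::nat)"
  assume std: "?x + m' \<in> S"
  have M: "?x \<in> M" "?b \<in> M" "vpair a b \<in> M" "vpair x a \<in> M" using ab x by (auto simp: M_eq)
  have eq: "?x + vpair a b = ?b + vpair x a" by (simp add: vpair_def ac_simps)
  have NFM: "m'' \<in> M" if "m \<in> M" "m'' \<in> keys (NF m)" for m m'' using keys_NF [OF that(1)] that(2) S_sub by auto
  \<comment> \<open>First reduction of \<open>x * a * b\<close>, through \<open>a * b\<close>: all
    terms but the tied \<open>m'\<close> are strictly heavier and stay so, hence the standard
    monomial \<open>x * m'\<close> receives exactly the nonzero coefficient of
    \<open>m'\<close>.\<close>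
  have "lookup (NF (?x + vpair a b)) (?x + m') =
      (\<Sum>m''\<in>keys (NF (vpair a b)). lookup (NF (vpair a b)) m'' * lookup (NF (?x + m'')) (?x + m'))"
    by (rule lookup_NF_add [OF M(1,3)])
  also have "\<dots> = (\<Sum>m''\<in>{m'}. lookup (NF (vpair a b)) m'' * lookup (NF (?x + m'')) (?x + m'))"
  proof (rule sum.mono_neutral_right)
    show "\<forall>m''\<in>keys (NF (vpair a b)) - {m'}. lookup (NF (vpair a b)) m'' * lookup (NF (?x + m'')) (?x + m') = 0"
    proof
      fix m'' assume m'': "m'' \<in> keys (NF (vpair a b)) - {m'}"
      then have "\<omega> (vpair a b) < \<omega> m''" using strict [of a b m''] ab by auto
      then have "\<omega> (?x + m') < \<omega> (?x + m'')" by (simp add: add tie)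
      then show "lookup (NF (vpair a b)) m'' * lookup (NF (?x + m'')) (?x + m') = 0"
        using lookup_NF_add_zero [OF mono add M(1) NFM [OF M(3)]] m'' by simp
    qed
  qed (use m' in auto)
  also have "\<dots> = lookup (NF (vpair a b)) m'"
    using std M_add [OF M(1) NFM [OF M(3) m']] by (simp add: NF_standard)
  finally have "lookup (NF (?x + vpair a b)) (?x + m') \<noteq> 0" using m' by (simp add: in_keys_iff)
  moreover have "lookup (NF (?x + vpair a b)) (?x + m') =
      (\<Sum>m''\<in>keys (NF (vpair x a)). lookup (NF (vpair x a)) m'' * lookup (NF (?b + m'')) (?x + m'))"
    unfolding eq by (rule lookup_NF_add [OF M(2,4)])
  \<comment> \<open>Second reduction, through \<open>x * a\<close>: since
    \<open>x \<noteq> b\<close> this is another pair, so all its terms are strictly heavier and none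
    can lead to \<open>x * m'\<close>.\<close>
  moreover have "\<dots> = 0"
  proof (intro sum.neutral ballI)
    fix m'' assume m'': "m'' \<in> keys (NF (vpair x a))"
    have "vpair x a \<noteq> vpair a b"
    proof
      assume "vpair x a = vpair a b"
      then have "{x, a} = {a, b}" by (metis keys_vpair)
      with x cmp_refl show False by (auto simp: doubleton_eq_iff)
    qed
    then have "\<omega> (vpair x a) < \<omega> m''" using strict [of x a m''] ab x m'' by auto
    then have "\<omega> (?b + vpair x a) < \<omega> (?b + m'')" by (simp add: add)
    moreover have "\<omega> (?x + m') = \<omega> (?b + vpair x a)" 
      using tie add [of ?x m'] add [of ?x "vpair a b"] by (simp only: eq)
    ultimately show "lookup (NF (vpair x a)) m'' * lookup (NF (?b + m'')) (?x + m') = 0"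
      using lookup_NF_add_zero [OF mono add M(2) NFM [OF M(4) m'']] by simp
  qed
  ultimately show False by simp
qed

end

section \<open>Order ideals\<close>

lemma P_le_refl [simp]: "P_le p p"
  by (simp add: P_le_def)

lemma P_le_trans: "P_le p q \<Longrightarrow> P_le q r \<Longrightarrow> P_le p r"
  by (auto simp: P_le_def)

lemma P_le_Pair [simp]: "P_le (a, b) (c, d) \<longleftrightarrow> a \<le> c \<and> b \<le> d"
  by (simp add: P_le_def)

lemma order_idealI:
  "J \<subseteq> pbw_poset n \<Longrightarrow> (\<And>p q. q \<in> J \<Longrightarrow> p \<in> pbw_poset n \<Longrightarrow> P_le p q \<Longrightarrow> p \<in> J) \<Longrightarrow> J \<in> order_ideals n"
  by (auto simp: order_ideals_def)

lemma order_idealD: "J \<in> order_ideals n \<Longrightarrow> q \<in> J \<Longrightarrow> p \<in> pbw_poset n \<Longrightarrow> P_le p q \<Longrightarrow> p \<in> J"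
  by (auto simp: order_ideals_def)

lemma order_ideal_subset: "J \<in> order_ideals n \<Longrightarrow> p \<in> J \<Longrightarrow> p \<in> pbw_poset n"
  by (auto simp: order_ideals_def)

lemma in_pbw_poset: "(r, s) \<in> pbw_poset n \<longleftrightarrow> 1 \<le> r \<and> r \<le> s \<and> s \<le> n \<and> s \<noteq> 1 \<and> r \<noteq> n"
  by (auto simp: pbw_poset_def)

lemma finite_pbw_poset: "finite (pbw_poset n)"
  by (rule finite_subset [of _ "{1..n} \<times> {1..n}"]) (auto simp: pbw_poset_def)

text \<open>Ideals are closed downwards, so maximality of an off-diagonal cell can be tested on its
  two upper neighbours. On the diagonal \<open>K_set\<close> ignores maximality, because all
  diagonal cells belong to \<open>V_o\<close>.\<close>

lemma K_set_iff:
  assumes J: "J \<in> order_ideals n"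
  shows "(r, t) \<in> K_set n J \<longleftrightarrow> (r, t) \<in> J \<and> (r = t \<or> (r, t + 1) \<notin> J \<and> (r + 1, t) \<notin> J)"
proof -
  have "(r, t) \<in> max_elems J \<longleftrightarrow> (r, t) \<in> J \<and> (r, t + 1) \<notin> J \<and> (r + 1, t) \<notin> J" if "r < t"
  proof
    assume "(r, t) \<in> max_elems J"
    then show "(r, t) \<in> J \<and> (r, t + 1) \<notin> J \<and> (r + 1, t) \<notin> J"
      by (force simp: max_elems_def P_le_def)
  next
    assume L: "(r, t) \<in> J \<and> (r, t + 1) \<notin> J \<and> (r + 1, t) \<notin> J"
    have False if q: "(r', t') \<in> J" "r \<le> r'" "t \<le> t'" "(r', t') \<noteq> (r, t)" for r' t'
    proof -
      have P: "(r', t') \<in> pbw_poset n" "(r, t) \<in> pbw_poset n" using J q L order_ideal_subset by blast+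
      show False
      proof (cases "t' = t")
        case True
        then have "(r + 1, t) \<in> pbw_poset n" "P_le (r + 1, t) (r', t')"
          using q P \<open>r < t\<close> by (auto simp: in_pbw_poset)
        with J q L show False using order_idealD by blast
      next
        case False
        then have "(r, t + 1) \<in> pbw_poset n" "P_le (r, t + 1) (r', t')"
          using q P \<open>r < t\<close> by (auto simp: in_pbw_poset)
        with J q L show False using order_idealD by blast
      qed
    qed
    then have "\<forall>q\<in>J. P_le (r, t) q \<longrightarrow> q = (r, t)" by (metis P_le_def fst_conv snd_conv surj_pair)
    then show "(r, t) \<in> max_elems J" using L by (simp add: max_elems_def)
  qed
  moreover have "r \<le> t \<and> (r = t \<longrightarrow> 2 \<le> r \<and> r \<le> n - 1)" if "(r, t) \<in> J"
    using order_ideal_subset [OF J that] by (auto simp: in_pbw_poset)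
  ultimately show ?thesis
    using order_ideal_subset [OF J, of "(r, t)"]
    by (cases "r = t"; cases "(r, t) \<in> J") (auto simp: K_set_def V_o_def V_c_def max_elems_def)
qed

section \<open>Intervals in the lattice of order ideals\<close>

definition between_ideals where
  "between_ideals n lo hi = {x \<in> order_ideals n. lo \<subseteq> x \<and> x \<subseteq> hi}"

text \<open>The test ideal is \<open>a \<inter> b\<close> plus a minimal cell \<open>q\<close> of
  \<open>b - a\<close>. It contains \<open>q\<close>, so it is not below \<open>a\<close>; it lies
  in \<open>b\<close>, so it is not above \<open>a\<close>; the hypothesis leaves only
  \<open>b\<close>.\<close>

lemma interval_single:
  assumes a: "a \<in> between_ideals n lo hi" and b: "b \<in> between_ideals n lo hi" and inc: "\<not> a \<subseteq> b" "\<not> b \<subseteq> a"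
    and H: "\<forall>x\<in>between_ideals n lo hi. x \<subseteq> a \<or> a \<subseteq> x \<or> x = b"
  shows "\<exists>q. q \<notin> a \<and> insert q (a \<inter> b) = b"
proof -
  have OI: "a \<in> order_ideals n" "b \<in> order_ideals n" using a b by (simp_all add: between_ideals_def)
  from inc(2) obtain q0 where q0: "q0 \<in> b - a" by blast
  have "\<exists>q. q \<in> b - a \<and> (\<forall>z. z \<in> b - a \<longrightarrow> fst q + snd q \<le> fst z + snd z)"
    by (rule ex_has_least_nat [of "\<lambda>z. z \<in> b - a", OF q0])
  then obtain q where q: "q \<in> b - a" and min: "\<forall>z. z \<in> b - a \<longrightarrow> fst q + snd q \<le> fst z + snd z" by blast
  have "insert q (a \<inter> b) \<in> order_ideals n"
  proof (rule order_idealI)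
    show "insert q (a \<inter> b) \<subseteq> pbw_poset n"
      using q order_ideal_subset [OF OI(2)] by blast
    fix z z' assume z: "z' \<in> insert q (a \<inter> b)" "z \<in> pbw_poset n" "P_le z z'"
    have "z' \<in> b" using z(1) q by blast
    then have zb: "z \<in> b" by (rule order_idealD [OF OI(2) _ z(2,3)])
    show "z \<in> insert q (a \<inter> b)"
    proof (cases "z \<in> a")
      case True
      with zb show ?thesis by blast
    next
      case False
      then have "z' \<notin> a" using order_idealD [OF OI(1) _ z(2,3)] by metis
      with z(1) have "z' = q" by blast
      moreover have "fst q + snd q \<le> fst z + snd z" using min zb False by blast
      ultimately have "z = q" using z(3) by (simp add: P_le_def prod_eq_iff)
      then show ?thesis by blast
    qed
  qed
  moreover have "lo \<subseteq> insert q (a \<inter> b)" "insert q (a \<inter> b) \<subseteq> hi"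
    using a b q by (auto simp: between_ideals_def)
  ultimately have "insert q (a \<inter> b) \<in> between_ideals n lo hi" by (simp add: between_ideals_def)
  from bspec [OF H this] have "insert q (a \<inter> b) = b" using q inc by blast
  then show ?thesis using q by blast
qed

text \<open>The test ideal consists of the cells of \<open>a\<close> that are not above
  \<open>y\<close>. If \<open>y\<close> were not below \<open>p\<close>, it would contain
  \<open>p\<close> and miss both \<open>q\<close> and \<open>y\<close>, against all three
  alternatives in \<open>H\<close>.\<close>

lemma interval_below:
  assumes a: "a \<in> between_ideals n lo hi" and lo: "lo \<in> order_ideals n" and p: "p \<in> a" "p \<notin> b" and q: "q \<in> b" "q \<notin> a"
    and y: "y \<in> a - lo"
    and H: "\<forall>x\<in>between_ideals n lo hi. x \<subseteq> b \<or> b \<subseteq> x \<or> x = a"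
  shows "P_le y p"
proof (rule ccontr)
  assume n: "\<not> P_le y p"
  have OI: "a \<in> order_ideals n" and sub: "lo \<subseteq> a" "a \<subseteq> hi" using a by (simp_all add: between_ideals_def)
  define x where "x = {z \<in> a. \<not> P_le y z}"
  have "x \<in> order_ideals n"
  proof (rule order_idealI)
    show "x \<subseteq> pbw_poset n" using order_ideal_subset [OF OI] unfolding x_def by blast
    fix z z' assume z: "z' \<in> x" "z \<in> pbw_poset n" "P_le z z'"
    from z(1) have z': "z' \<in> a" "\<not> P_le y z'" by (simp_all add: x_def)
    have "z \<in> a" using OI z'(1) z(2,3) by (rule order_idealD)
    moreover have "\<not> P_le y z" using P_le_trans [OF _ z(3)] z'(2) by metis
    ultimately show "z \<in> x" by (simp add: x_def)
  qed
  moreover have "lo \<subseteq> x"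
  proof
    fix z assume z: "z \<in> lo"
    have "y \<in> pbw_poset n" using y order_ideal_subset [OF OI] by blast
    then have "\<not> P_le y z" using order_idealD [OF lo z] y by blast
    with z sub show "z \<in> x" by (auto simp: x_def)
  qed
  moreover have "x \<subseteq> hi" using sub by (auto simp: x_def)
  ultimately have "x \<in> between_ideals n lo hi" by (simp add: between_ideals_def)
  from bspec [OF H this] have "x \<subseteq> b \<or> b \<subseteq> x \<or> x = a" .
  moreover have "p \<in> x" "q \<notin> x" "y \<notin> x" using p q n by (simp_all add: x_def)
  ultimately show False using p q y by blast
qed

text \<open>The dual test ideal is \<open>b\<close> together with the cells of \<open>hi\<close>
  below \<open>y\<close>. If \<open>p\<close> were not below \<open>y\<close>, it would miss
  \<open>p\<close> and contain both \<open>q\<close> and \<open>y\<close>.\<close>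

lemma interval_above:
  assumes b: "b \<in> between_ideals n lo hi" and hi: "hi \<in> order_ideals n" and p: "p \<in> a" "p \<notin> b" and q: "q \<in> b" "q \<notin> a"
    and y: "y \<in> hi - b"
    and H: "\<forall>x\<in>between_ideals n lo hi. x \<subseteq> a \<or> a \<subseteq> x \<or> x = b"
  shows "P_le p y"
proof (rule ccontr)
  assume n: "\<not> P_le p y"
  have OI: "b \<in> order_ideals n" and sub: "lo \<subseteq> b" "b \<subseteq> hi" using b by (simp_all add: between_ideals_def)
  define x where "x = b \<union> {z \<in> hi. P_le z y}"
  have "x \<in> order_ideals n"
  proof (rule order_idealI)
    show "x \<subseteq> pbw_poset n" using order_ideal_subset [OF hi] sub unfolding x_def by blast
    fix z z' assume z: "z' \<in> x" "z \<in> pbw_poset n" "P_le z z'"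
    from z(1) consider "z' \<in> b" | "z' \<in> hi" "P_le z' y" by (auto simp: x_def)
    then show "z \<in> x"
    proof cases
      case 1
      have "z \<in> b" using OI 1 z(2,3) by (rule order_idealD)
      then show ?thesis by (simp add: x_def)
    next
      case 2
      have "z \<in> hi" using hi 2(1) z(2,3) by (rule order_idealD)
      moreover have "P_le z y" using z(3) 2(2) by (rule P_le_trans)
      ultimately show ?thesis by (simp add: x_def)
    qed
  qed
  moreover have "lo \<subseteq> x" "x \<subseteq> hi" using sub by (auto simp: x_def)
  ultimately have "x \<in> between_ideals n lo hi" by (simp add: between_ideals_def)
  from bspec [OF H this] have "x \<subseteq> a \<or> a \<subseteq> x \<or> x = b" .
  moreover have "p \<notin> x" "q \<in> x" "y \<in> x" using p q n y by (simp_all add: x_def)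
  ultimately show False using p q y by blast
qed

lemma interval_structure:
  assumes lo: "lo \<in> order_ideals n" and hi: "hi \<in> order_ideals n"
    and a: "a \<in> between_ideals n lo hi" and b: "b \<in> between_ideals n lo hi" and inc: "\<not> a \<subseteq> b" "\<not> b \<subseteq> a"
    and Ha: "\<forall>x\<in>between_ideals n lo hi. x \<subseteq> a \<or> a \<subseteq> x \<or> x = b"
    and Hb: "\<forall>x\<in>between_ideals n lo hi. x \<subseteq> b \<or> b \<subseteq> x \<or> x = a"
  obtains p q where "p \<notin> b" "q \<notin> a" "insert p (a \<inter> b) = a" "insert q (a \<inter> b) = b"
    "\<And>y. y \<in> a \<inter> b - lo \<Longrightarrow> P_le y p \<and> P_le y q"
    "\<And>y. y \<in> hi - (a \<union> b) \<Longrightarrow> P_le p y \<and> P_le q y"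
proof -
  obtain q where q: "q \<notin> a" "insert q (a \<inter> b) = b" using interval_single [OF a b inc Ha] by metis
  obtain p where p: "p \<notin> b" "insert p (a \<inter> b) = a" using interval_single [OF b a inc(2,1) Hb] by (metis Int_commute)
  have pa: "p \<in> a" and qb: "q \<in> b" using p(2) q(2) by (metis insertI1)+
  show thesis
  proof (rule that [OF p(1) q(1) p(2) q(2)])
    fix y assume y: "y \<in> a \<inter> b - lo"
    have "P_le y p" by (rule interval_below [OF a lo pa p(1) qb q(1) _ Hb]) (use y in blast)
    moreover have "P_le y q" by (rule interval_below [OF b lo qb q(1) pa p(1) _ Ha]) (use y in blast)
    ultimately show "P_le y p \<and> P_le y q" ..
  next
    fix y assume y: "y \<in> hi - (a \<union> b)"
    have "P_le p y" by (rule interval_above [OF b hi pa p(1) qb q(1) _ Ha]) (use y in blast)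
    moreover have "P_le q y" by (rule interval_above [OF a hi qb q(1) pa p(1) _ Hb]) (use y in blast)
    ultimately show "P_le p y \<and> P_le q y" ..
  qed
qed

section \<open>Differences of toric exponents\<close>

definition kdiff :: "nat \<Rightarrow> (nat \<times> nat) set \<Rightarrow> (nat \<times> nat) set \<Rightarrow> (nat \<times> nat) set \<Rightarrow> (nat \<times> nat) set \<Rightarrow> nat \<times> nat \<Rightarrow> int" where
  "kdiff n a b c d x = of_bool (x \<in> K_set n c) + of_bool (x \<in> K_set n d) - of_bool (x \<in> K_set n a) - of_bool (x \<in> K_set n b)"

text \<open>A mixed second difference at \<open>(i, j)\<close>. The cell \<open>(Suc i, j)\<close> drops out when it is diagonal,
  because diagonal cells are in \<open>K_set n J\<close> whether or not they are maximal in \<open>J\<close>.\<close>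

definition elem_pattern :: "nat \<Rightarrow> nat \<Rightarrow> nat \<times> nat \<Rightarrow> int" where
  "elem_pattern i j x = of_bool (x = (i, j)) + of_bool (x = (Suc i, Suc j)) - of_bool (x = (i, Suc j))
     - of_bool (x = (Suc i, j) \<and> Suc i < j)"

text \<open>This is what equality of multidegrees says about a difference of exponents: the diagonal
  compares the numbers of columns with at least \<open>r\<close> rows, and the row and column sums
  at \<open>s\<close> compare the numbers of entries equal to \<open>s\<close>, see
  \<open>content_K\<close>.\<close>

definition content_balanced :: "nat \<Rightarrow> (nat \<times> nat \<Rightarrow> int) \<Rightarrow> bool" where
  "content_balanced n f \<longleftrightarrow> (\<forall>r. f (r, r) = 0) \<and> (\<forall>s\<in>{1..n}. (\<Sum>r\<in>{1..<s}. f (r, s)) = (\<Sum>t\<in>{s<..n}. f (s, t)))"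

lemma kdiff_swap: "kdiff n b a c d = kdiff n a b c d"
  by (auto simp: kdiff_def)

text \<open>If \<open>c\<close> and \<open>d\<close> are intersection and union, the exponents can
  differ only at the meet of adjacent corners, and content excludes this. Otherwise the corners are
  forced to be \<open>(i, Suc j)\<close> and \<open>(Suc i, j)\<close>, where \<open>c\<close> can
  lack only \<open>(i, j)\<close> and \<open>d\<close> can gain only \<open>(Suc i, Suc j)\<close>.
  A loss alone changes no exponent, a gain alone produces the pattern, and content excludes both
  together.\<close>

lemma kdiff_interval:
  assumes OI: "a \<in> order_ideals n" "b \<in> order_ideals n" "c \<in> order_ideals n" "d \<in> order_ideals n"
    and pq: "(p1, p2) \<notin> b" "(q1, q2) \<notin> a" "insert (p1, p2) (a \<inter> b) = a" "insert (q1, q2) (a \<inter> b) = b"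
    and sub: "c \<subseteq> a \<inter> b" "a \<union> b \<subseteq> d"
    and low: "\<And>y. y \<in> a \<inter> b - c \<Longrightarrow> P_le y (p1, p2) \<and> P_le y (q1, q2)"
    and up: "\<And>y. y \<in> d - (a \<union> b) \<Longrightarrow> P_le (p1, p2) y \<and> P_le (q1, q2) y"
    and less: "p1 < q1"
    and bal: "content_balanced n (kdiff n a b c d)"
  shows "(\<forall>x. kdiff n a b c d x = 0) \<or> (\<exists>i j. 1 \<le> i \<and> i < j \<and> j < n \<and> (\<forall>x. kdiff n a b c d x = elem_pattern i j x))"
proof -
  have pa: "(p1, p2) \<in> a" and qb: "(q1, q2) \<in> b" using pq by (metis insertI1)+
  have Pp: "(p1, p2) \<in> pbw_poset n" and Pq: "(q1, q2) \<in> pbw_poset n"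
    using pa qb OI order_ideal_subset by blast+
  have less2: "q2 < p2"
  proof (rule ccontr)
    assume "\<not> q2 < p2"
    then have "P_le (p1, p2) (q1, q2)" using less by simp
    then have "(p1, p2) \<in> b" by (rule order_idealD [OF OI(2) qb Pp])
    with pq(1) show False by simp
  qed
  note K = OI [THEN K_set_iff]
  have bal1: "kdiff n a b c d (r, r) = 0" for r using bal by (simp add: content_balanced_def)
  have bal2: "(\<Sum>r\<in>{1..<s}. kdiff n a b c d (r, s)) = (\<Sum>t\<in>{s<..n}. kdiff n a b c d (s, t))" if "1 \<le> s" "s \<le> n" for s
    using bal that by (simp add: content_balanced_def)
  define I where "I = a \<inter> b"
  have am: "x \<in> a \<longleftrightarrow> x = (p1, p2) \<or> x \<in> I" and bm: "x \<in> b \<longleftrightarrow> x = (q1, q2) \<or> x \<in> I" for x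
    using pq(3,4) unfolding I_def by blast+
  have pI: "(p1, p2) \<notin> I" and qI: "(q1, q2) \<notin> I" using pq by (auto simp: I_def)
  have II: "I \<in> order_ideals n"
    using OI order_idealD [OF OI(1)] order_idealD [OF OI(2)] unfolding I_def
    by (intro order_idealI) (auto simp: order_ideals_def)
  \<comment> \<open>Diagonal cells of an ideal always belong to its \<open>K_set\<close>, so one
    that \<open>c\<close> drops, or in \<open>diag_d\<close> one that \<open>d\<close> gains, would
    leave a nonzero diagonal exponent.\<close>
  have diag_c: "r \<noteq> t" if "(r, t) \<in> I - c" for r t
  proof
    assume "r = t"
    then have "(r, r) \<in> a" "(r, r) \<in> b" "(r, r) \<in> d" "(r, r) \<notin> c" using that sub by (auto simp: I_def)
    then have "kdiff n a b c d (r, r) = -1" by (simp add: kdiff_def K)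
    with bal1 show False by simp
  qed
  have diag_d: "r \<noteq> t" if "(r, t) \<in> d - (a \<union> b)" for r t
  proof
    assume "r = t"
    then have "(r, r) \<notin> a" "(r, r) \<notin> b" "(r, r) \<in> d" "(r, r) \<notin> c" using that sub by auto
    then have "kdiff n a b c d (r, r) = 1" by (simp add: kdiff_def K)
    with bal1 show False by simp
  qed
  show ?thesis
  proof (cases "I = c \<and> d = a \<union> b")
    case True
    then have cm: "x \<in> c \<longleftrightarrow> x \<in> I" and dm: "x \<in> d \<longleftrightarrow> x = (p1, p2) \<or> x = (q1, q2) \<or> x \<in> I" for x
      using am bm by blast+
    define adj where "adj \<longleftrightarrow> q1 = Suc p1 \<and> p2 = Suc q2"
    \<comment> \<open>A second difference: adding the two corners interacts only at a cell that has
      both of them as upper neighbours. Such a cell is maximal in the intersection and in none of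
      the other three ideals.\<close>
    have kd: "kdiff n a b c d (r, t) = (if adj \<and> r = p1 \<and> t = q2 then 1 else 0)" for r t
    proof (cases "r = t")
      case True
      then show ?thesis using bal1 Pq unfolding in_pbw_poset adj_def by auto
    next
      case False
      have "(p1, q2) \<in> I" if adj
      proof -
        have "(p1, q2) \<in> pbw_poset n" using that Pp Pq by (auto simp: in_pbw_poset adj_def)
        moreover have "P_le (p1, q2) (p1, p2)" using less2 by simp
        ultimately have "(p1, q2) \<in> a" using order_idealD [OF OI(1) pa] by blast
        then show ?thesis using am less2 by simp
      qed
      then show ?thesis using False pI qI less less2
        by (auto simp: kdiff_def K am bm cm dm adj_def)
    qed
    have "\<not> adj"
    proof
      assume adj
      have "1 \<le> q2" "q2 \<le> n" "p1 < q2" "1 \<le> p1" using Pp Pq \<open>adj\<close> by (auto simp: in_pbw_poset adj_def)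
      then have "(\<Sum>r\<in>{1..<q2}. kdiff n a b c d (r, q2)) = 1" "(\<Sum>t\<in>{q2<..n}. kdiff n a b c d (q2, t)) = 0"
        using \<open>adj\<close> by (auto simp: kd sum.delta)
      with bal2 [of q2] \<open>1 \<le> q2\<close> \<open>q2 \<le> n\<close> show False by simp
    qed
    then show ?thesis using kd by auto
  next
    case False
    have adj: "q1 = Suc p1 \<and> p2 = Suc q2"
    proof (cases "I = c")
      case False
      then obtain y1 y2 where y: "(y1, y2) \<in> I - c" using sub unfolding I_def by auto
      then have le: "y1 \<le> p1" "y2 \<le> q2" using low [of "(y1, y2)"] by (auto simp: I_def)
      have nc: "(r, t) \<notin> c" if "y1 \<le> r" "y2 \<le> t" for r t
        using y that order_ideal_subset [OF II, of "(y1, y2)"] order_idealD [OF OI(3), of "(r, t)" "(y1, y2)"] by auto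
      have Py: "(y1, y2) \<in> pbw_poset n" using y II order_ideal_subset by blast
      \<comment> \<open>If a row lay strictly between the corners, \<open>(Suc p1, q2)\<close> would
        be a cell of \<open>I - c\<close> that is not below the first corner. The other gap
        arguments use the symmetric cells.\<close>
      have "q1 \<le> Suc p1"
      proof (rule ccontr)
        assume *: "\<not> q1 \<le> Suc p1"
        then have "(Suc p1, q2) \<in> pbw_poset n" using Pp Pq by (auto simp: in_pbw_poset)
        then have "(Suc p1, q2) \<in> b" using order_idealD [OF OI(2) qb] * by simp
        then have "(Suc p1, q2) \<in> I - c" using bm nc le * by simp
        then show False using low [of "(Suc p1, q2)"] by (simp add: I_def)
      qed
      moreover have "p2 \<le> Suc q2"
      proof (rule ccontr)
        assume *: "\<not> p2 \<le> Suc q2"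
        then have "(p1, Suc q2) \<in> pbw_poset n" using Pp Pq less by (auto simp: in_pbw_poset)
        then have "(p1, Suc q2) \<in> a" using order_idealD [OF OI(1) pa] * by simp
        then have "(p1, Suc q2) \<in> I - c" using am nc le * by simp
        then show False using low [of "(p1, Suc q2)"] by (simp add: I_def)
      qed
      ultimately show ?thesis using less less2 by simp
    next
      case True
      with False sub obtain y1 y2 where y: "(y1, y2) \<in> d - (a \<union> b)" by auto
      then have le: "q1 \<le> y1" "p2 \<le> y2" using up [of "(y1, y2)"] by auto
      have Py: "(y1, y2) \<in> pbw_poset n" using y OI order_ideal_subset by blast
      have ind: "(r, t) \<in> d" if "(r, t) \<in> pbw_poset n" "r \<le> y1" "t \<le> y2" for r t
        using order_idealD [OF OI(4) _ that(1), of "(y1, y2)"] y that by simp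
      have "q1 \<le> Suc p1"
      proof (rule ccontr)
        assume *: "\<not> q1 \<le> Suc p1"
        have P: "(Suc p1, p2) \<in> pbw_poset n" using Pp Pq * less2 by (auto simp: in_pbw_poset)
        have "(Suc p1, p2) \<notin> I"
          using order_idealD [OF II _ Pp, of "(Suc p1, p2)"] pI by auto
        then have "(Suc p1, p2) \<notin> a \<union> b" using am bm * less2 by simp
        then show False using up [of "(Suc p1, p2)"] ind [OF P] le * by simp
      qed
      moreover have "p2 \<le> Suc q2"
      proof (rule ccontr)
        assume *: "\<not> p2 \<le> Suc q2"
        have P: "(q1, Suc q2) \<in> pbw_poset n" using Pp Pq * less2 by (auto simp: in_pbw_poset)
        have "(q1, Suc q2) \<notin> I"
          using order_idealD [OF II _ Pq, of "(q1, Suc q2)"] qI by auto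
        then have "(q1, Suc q2) \<notin> a \<union> b" using am bm * less by simp
        then show False using up [of "(q1, Suc q2)"] ind [OF P] le * by simp
      qed
      ultimately show ?thesis using less less2 by simp
    qed
    define i j where "i = p1" and "j = q2"
    have p: "p1 = i" "p2 = Suc j" and q: "q1 = Suc i" "q2 = j" using adj by (auto simp: i_def j_def)
    have ij: "1 \<le> i" "Suc i \<le> j" "Suc j \<le> n" using Pp Pq by (auto simp: in_pbw_poset p q)
    have o: "(i, j) \<in> I"
    proof -
      have "(i, j) \<in> pbw_poset n" using ij by (auto simp: in_pbw_poset)
      then have "(i, j) \<in> a" using order_idealD [OF OI(1) pa] by (simp add: p)
      then show ?thesis using am by (simp add: p)
    qed
    have not_I: "(r, t) \<notin> I" if "i \<le> r \<and> Suc j \<le> t \<or> Suc i \<le> r \<and> j \<le> t" for r t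
      using order_idealD [OF II _ Pp, of "(r, t)"] order_idealD [OF II _ Pq, of "(r, t)"] pI qI that
      by (auto simp: p q)
    \<comment> \<open>These cells lie below the first corner but not below the second, so
      \<open>c\<close> cannot lack them. Together with \<open>left_I\<close> and downward closure of
      \<open>c\<close> this confines \<open>I - c\<close> to \<open>(i, j)\<close>.\<close>
    have up_I: "(r, Suc j) \<in> I \<inter> c" if "Suc r \<le> i" "1 \<le> r" for r
    proof -
      have "(r, Suc j) \<in> pbw_poset n" using ij that by (auto simp: in_pbw_poset)
      then have "(r, Suc j) \<in> a" using order_idealD [OF OI(1) pa] that by (simp add: p)
      then have "(r, Suc j) \<in> I" using am that by (simp add: p)
      moreover have "(r, Suc j) \<in> c" using low [of "(r, Suc j)"] \<open>(r, Suc j) \<in> I\<close> by (auto simp: q I_def)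
      ultimately show ?thesis by simp
    qed
    have left_I: "(Suc i, t) \<in> I \<inter> c" if "Suc t \<le> j" "Suc i \<le> t" for t
    proof -
      have "(Suc i, t) \<in> pbw_poset n" using ij that by (auto simp: in_pbw_poset)
      then have "(Suc i, t) \<in> b" using order_idealD [OF OI(2) qb] that by (simp add: q)
      then have "(Suc i, t) \<in> I" using bm that by (simp add: q)
      moreover have "(Suc i, t) \<in> c" using low [of "(Suc i, t)"] \<open>(Suc i, t) \<in> I\<close> by (auto simp: p I_def)
      ultimately show ?thesis by simp
    qed
    have Ic: "y = (i, j)" if y: "y \<in> I - c" for y
    proof -
      obtain r t where rt: "y = (r, t)" by force
      have P: "(r, t) \<in> pbw_poset n" using y II order_ideal_subset rt by blast
      have "r \<noteq> t" using diag_c y rt by blast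
      moreover have "r \<le> i" "t \<le> j" using low [of y] y by (auto simp: rt p q I_def)
      moreover have "\<not> r < i"
        using order_idealD [OF OI(3) _ P, of "(r, Suc j)"] up_I [of r] y \<open>t \<le> j\<close> P
        by (auto simp: rt in_pbw_poset)
      \<comment> \<open>Since \<open>(i, t)\<close> is off the diagonal,
        \<open>Suc i \<le> t\<close> holds and \<open>(Suc i, t)\<close> is a cell, as
        \<open>left_I\<close> requires.\<close>
      moreover have "\<not> t < j"
        using order_idealD [OF OI(3) _ P, of "(Suc i, t)"] left_I [of t] y \<open>r \<le> i\<close> \<open>\<not> r < i\<close> \<open>r \<noteq> t\<close> P
        by (auto simp: rt in_pbw_poset)
      ultimately show ?thesis by (simp add: rt)
    qed
    have dU: "y = (Suc i, Suc j)" if y: "y \<in> d - (a \<union> b)" for y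
    proof -
      obtain r t where rt: "y = (r, t)" by force
      have P: "(r, t) \<in> pbw_poset n" using y OI order_ideal_subset rt by blast
      have ind: "(r', t') \<in> d" if "(r', t') \<in> pbw_poset n" "r' \<le> r" "t' \<le> t" for r' t'
        using order_idealD [OF OI(4) _ that(1), of "(r, t)"] y rt that by simp
      have "r \<noteq> t" using diag_d y rt by blast
      moreover have le: "Suc i \<le> r" "Suc j \<le> t" using up [of y] y by (auto simp: rt p q)
      moreover have "\<not> Suc j < t"
      proof
        assume *: "Suc j < t"
        have "(i, Suc (Suc j)) \<in> pbw_poset n" using P ij * by (auto simp: in_pbw_poset)
        from ind [OF this] have "(i, Suc (Suc j)) \<in> d - (a \<union> b)" using le * not_I am bm by (simp add: p q)
        from up [OF this] show False by (simp add: q)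
      qed
      moreover have "\<not> Suc i < r"
      proof
        assume *: "Suc i < r"
        have "(Suc (Suc i), j) \<in> pbw_poset n" using P ij * le \<open>r \<noteq> t\<close> \<open>\<not> Suc j < t\<close> by (auto simp: in_pbw_poset)
        from ind [OF this] have "(Suc (Suc i), j) \<in> d - (a \<union> b)" using le * not_I am bm by (simp add: p q)
        from up [OF this] show False by (simp add: p)
      qed
      ultimately show ?thesis by (simp add: rt)
    qed
    define A B where "A \<longleftrightarrow> (i, j) \<notin> c" and "B \<longleftrightarrow> (Suc i, Suc j) \<in> d"
    have cm: "x \<in> c \<longleftrightarrow> x \<in> I \<and> (x = (i, j) \<longrightarrow> \<not> A)" for x
      using Ic [of x] o sub unfolding A_def I_def [symmetric] by blast
    have dm: "x \<in> d \<longleftrightarrow> x = (p1, p2) \<or> x = (q1, q2) \<or> x \<in> I \<or> B \<and> x = (Suc i, Suc j)" for x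
      using dU [of x] sub am [of x] bm [of x] by (auto simp: B_def)
    have AB: "A \<or> B"
    proof (rule ccontr)
      assume "\<not> (A \<or> B)"
      then have "I = c" "d = a \<union> b" using cm dm am bm by blast+
      with False show False by simp
    qed
    have kd: "kdiff n a b c d (r, t) =
      of_bool B * (of_bool (r = i \<and> t = j \<and> \<not> A) + of_bool (r = Suc i \<and> t = Suc j) - of_bool (r = i \<and> t = Suc j)
        - of_bool (r = Suc i \<and> t = j \<and> Suc i < j))" for r t
    proof (cases "r = t")
      case True
      then show ?thesis using bal1 ij by auto
    next
      case False
      have "r \<le> t" if "(r, t) \<in> pbw_poset n" using that by (simp add: in_pbw_poset)
      with False consider "(r, t) \<notin> pbw_poset n" | "(r, t) \<in> pbw_poset n" "r < t" by fastforce
      then show ?thesis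
      proof cases
        case 1
        then have "\<And>J. J \<in> order_ideals n \<Longrightarrow> (r, t) \<notin> J" using order_ideal_subset by blast
        then show ?thesis using OI 1 ij by (auto simp: kdiff_def K in_pbw_poset)
      next
        case 2
        have r: "1 \<le> r" using 2 by (simp add: in_pbw_poset)
        note mem = am bm cm dm p q
        \<comment> \<open>Membership in \<open>K_set\<close> looks at a cell and its two upper
          neighbours, so only the square of four cells and the four cells just below it matter. Of
          the latter, two keep an upper neighbour in all four ideals, and at the other two the
          changes cancel in pairs.\<close>
        consider (o) "r = i" "t = j" | (p) "r = i" "t = Suc j" | (q) "r = Suc i" "t = j" | (o') "r = Suc i" "t = Suc j"
          | (o_up) "Suc r = i" "t = j" | (o_left) "r = i" "Suc t = j" | (p_up) "Suc r = i" "t = Suc j"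
          | (q_left) "r = Suc i" "Suc t = j"
          | (other) "\<forall>x\<in>{(r, t), (r, Suc t), (Suc r, t)}. x \<notin> {(i, j), (i, Suc j), (Suc i, j), (Suc i, Suc j)}"
          by auto
        then show ?thesis
        proof cases
          case o
          then show ?thesis using 2(2) \<open>(i, j) \<in> I\<close> AB by (auto simp: kdiff_def K mem not_I)
        next
          case p
          then show ?thesis using 2(2) by (auto simp: kdiff_def K mem not_I)
        next
          case q
          then show ?thesis using 2(2) by (auto simp: kdiff_def K mem not_I)
        next
          case o'
          then show ?thesis using 2(2) by (auto simp: kdiff_def K mem not_I)
        next
          case o_up
          then have "(r, Suc t) \<in> I" "(r, Suc t) \<in> c" using up_I [of r] r by simp_all
          then have "(r, Suc t) \<in> a" "(r, Suc t) \<in> b" "(r, Suc t) \<in> d" using sub by (auto simp: I_def)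
          then show ?thesis using o_up 2(2) \<open>(r, Suc t) \<in> c\<close> by (simp add: kdiff_def K)
        next
          case o_left
          then have "(Suc r, t) \<in> I" "(Suc r, t) \<in> c" using left_I [of t] 2(2) by simp_all
          then have "(Suc r, t) \<in> a" "(Suc r, t) \<in> b" "(Suc r, t) \<in> d" using sub by (auto simp: I_def)
          then show ?thesis using o_left 2(2) \<open>(Suc r, t) \<in> c\<close> by (simp add: kdiff_def K)
        next
          case p_up
          then show ?thesis using 2(2) by (auto simp: kdiff_def K mem)
        next
          case q_left
          then show ?thesis using 2(2) by (auto simp: kdiff_def K mem)
        next
          case other
          have eq: "(x \<in> a \<longleftrightarrow> x \<in> I) \<and> (x \<in> b \<longleftrightarrow> x \<in> I) \<and> (x \<in> c \<longleftrightarrow> x \<in> I) \<and> (x \<in> d \<longleftrightarrow> x \<in> I)"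
            if "x \<notin> {(i, j), (i, Suc j), (Suc i, j), (Suc i, Suc j)}" for x
            using that by (simp add: mem)
          have "kdiff n a b c d (r, t) = 0"
            using eq [of "(r, t)"] eq [of "(r, Suc t)"] eq [of "(Suc r, t)"] other by (simp add: kdiff_def K)
          moreover have "(r, t) \<notin> {(i, j), (i, Suc j), (Suc i, j), (Suc i, Suc j)}" using other by blast
          ultimately show ?thesis by auto
        qed
      qed
    qed
    show ?thesis
    proof (cases B)
      case False
      then show ?thesis using kd by auto
    next
      case B: True
      have "\<not> A"
      proof
        assume A
        \<comment> \<open>Row \<open>i\<close> would have sum -1 while column \<open>i\<close> has
          sum 0.\<close>
        have "(\<Sum>r\<in>{1..<i}. kdiff n a b c d (r, i)) = 0"
          using ij by (intro sum.neutral) (auto simp: kd)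
        moreover have "(\<Sum>t\<in>{i<..n}. kdiff n a b c d (i, t)) = (\<Sum>t\<in>{i<..n}. if t = Suc j then -1 else 0)"
          using \<open>A\<close> B ij by (intro sum.cong) (auto simp: kd)
        moreover have "\<dots> = -1" using ij by (simp add: sum.delta)
        ultimately show False using bal2 [of i] ij by simp
      qed
      then have "kdiff n a b c d x = elem_pattern i j x" for x
        using B kd [of "fst x" "snd x"] by (cases x) (simp add: elem_pattern_def)
      moreover have "1 \<le> i \<and> i < j \<and> j < n" using ij by auto
      ultimately show ?thesis by blast
    qed
  qed
qed

text \<open>The condition \<open>fst p < fst q\<close> is a normalisation: incomparable cells lie in
  different rows, and \<open>kdiff_swap\<close> makes exchanging \<open>a\<close> and
  \<open>b\<close> harmless.\<close>

definition corner_pair where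
  "corner_pair n lo hi a b p q \<longleftrightarrow> a \<in> order_ideals n \<and> b \<in> order_ideals n \<and> p \<notin> b \<and> q \<notin> a \<and>
     insert p (a \<inter> b) = a \<and> insert q (a \<inter> b) = b \<and> lo \<subseteq> a \<inter> b \<and> a \<union> b \<subseteq> hi \<and>
     (\<forall>y\<in>a \<inter> b - lo. P_le y p \<and> P_le y q) \<and> (\<forall>y\<in>hi - (a \<union> b). P_le p y \<and> P_le q y) \<and> fst p < fst q"

lemma corner_pair_exists:
  assumes lo: "lo \<in> order_ideals n" and hi: "hi \<in> order_ideals n"
    and a: "a \<in> between_ideals n lo hi" and b: "b \<in> between_ideals n lo hi" and inc: "\<not> a \<subseteq> b" "\<not> b \<subseteq> a"
    and Ha: "\<forall>x\<in>between_ideals n lo hi. x \<subseteq> a \<or> a \<subseteq> x \<or> x = b"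
    and Hb: "\<forall>x\<in>between_ideals n lo hi. x \<subseteq> b \<or> b \<subseteq> x \<or> x = a"
  shows "\<exists>p q. corner_pair n lo hi a b p q \<or> corner_pair n lo hi b a p q"
proof -
  have OI: "a \<in> order_ideals n" "b \<in> order_ideals n" and ab: "lo \<subseteq> a \<inter> b" "a \<union> b \<subseteq> hi"
    using a b by (auto simp: between_ideals_def)
  obtain p q where pq: "p \<notin> b" "q \<notin> a" "insert p (a \<inter> b) = a" "insert q (a \<inter> b) = b"
    and low: "\<And>y. y \<in> a \<inter> b - lo \<Longrightarrow> P_le y p \<and> P_le y q"
    and up: "\<And>y. y \<in> hi - (a \<union> b) \<Longrightarrow> P_le p y \<and> P_le q y"
    using interval_structure [OF lo hi a b inc Ha Hb] by metis
  have pa: "p \<in> a" and qb: "q \<in> b" using pq by (metis insertI1)+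
  have P: "p \<in> pbw_poset n" "q \<in> pbw_poset n" using OI pa qb order_ideal_subset by blast+
  have "\<not> P_le p q" using order_idealD [OF OI(2) qb P(1)] pq by blast
  moreover have "\<not> P_le q p" using order_idealD [OF OI(1) pa P(2)] pq by blast
  ultimately have "fst p < fst q \<or> fst q < fst p" by (auto simp: P_le_def)
  then have "corner_pair n lo hi a b p q \<or> corner_pair n lo hi b a q p"
    unfolding corner_pair_def Int_commute [of b a] Un_commute [of b a] using OI pq ab low up by simp
  then show ?thesis by blast
qed

lemma corner_pair_snd:
  assumes "corner_pair n lo hi a b p q"
  shows "snd q < snd p" "p \<in> pbw_poset n" "q \<in> pbw_poset n" "p \<in> a" "q \<in> b" "p \<noteq> q"
proof -
  have OI: "a \<in> order_ideals n" "b \<in> order_ideals n" and pq: "p \<notin> b" "insert p (a \<inter> b) = a" "insert q (a \<inter> b) = b"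
    and less: "fst p < fst q"
    using assms by (auto simp: corner_pair_def)
  show pa: "p \<in> a" and qb: "q \<in> b" using pq by (metis insertI1)+
  then show P: "p \<in> pbw_poset n" "q \<in> pbw_poset n" using OI order_ideal_subset by blast+
  have "\<not> P_le p q" using order_idealD [OF OI(2) qb P(1)] pq by blast
  then show "snd q < snd p" using less by (auto simp: P_le_def)
  show "p \<noteq> q" using less by auto
qed

lemma corner_pair_kdiff:
  assumes "corner_pair n c d a b p q" "c \<in> order_ideals n" "d \<in> order_ideals n"
    and bal: "content_balanced n (kdiff n a b c d)"
  shows "(\<forall>x. kdiff n a b c d x = 0) \<or> (\<exists>i j. 1 \<le> i \<and> i < j \<and> j < n \<and> (\<forall>x. kdiff n a b c d x = elem_pattern i j x))"
proof -
  obtain p1 p2 q1 q2 where e: "p = (p1, p2)" "q = (q1, q2)" by force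
  show ?thesis
    by (rule kdiff_interval [of a n b c d p1 p2 q1 q2])
      (use assms in \<open>simp_all add: corner_pair_def e\<close>)
qed

text \<open>All of \<open>a \<inter> b\<close> lies below \<open>p\<close>, so the left neighbour of
  \<open>q\<close>, in a row beyond that of \<open>p\<close>, cannot be a cell. Hence
  \<open>q\<close> is diagonal; it lies in \<open>b\<close>, \<open>c\<close> and \<open>d\<close>
  but not in \<open>a\<close>, against the count of lengths.\<close>

lemma no_corner_pair_below:
  assumes cp: "corner_pair n {} c a b p q" and OI: "c \<in> order_ideals n" "d \<in> order_ideals n" and cd: "c \<subseteq> d"
    and bal: "content_balanced n (kdiff n a b c d)"
  shows False
proof -
  obtain q1 q2 where e: "q = (q1, q2)" by force
  have cp': "a \<in> order_ideals n" "b \<in> order_ideals n" "q \<notin> a" "insert q (a \<inter> b) = b"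
      "a \<union> b \<subseteq> c" "\<And>y. y \<in> a \<inter> b \<Longrightarrow> P_le y p" "fst p < fst q"
    using cp by (simp_all add: corner_pair_def)
  have Pp: "p \<in> pbw_poset n" and Pq: "(q1, q2) \<in> pbw_poset n" and qb: "(q1, q2) \<in> b"
    using corner_pair_snd [OF cp] by (simp_all add: e)
  have "q1 \<noteq> q2"
  proof
    assume *: "q1 = q2"
    have "kdiff n a b c d (q1, q1) = 1"
      using cp' qb * cd K_set_iff [OF OI(1)] K_set_iff [OF OI(2)] K_set_iff [OF cp'(1)] K_set_iff [OF cp'(2)]
      by (auto simp: kdiff_def e)
    with bal show False by (simp add: content_balanced_def)
  qed
  moreover have "2 \<le> q1" using cp'(7) Pp by (cases p) (auto simp: e in_pbw_poset)
  ultimately have P: "(q1, q2 - 1) \<in> pbw_poset n" using Pq by (auto simp: in_pbw_poset)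
  then have "(q1, q2 - 1) \<in> b" using order_idealD [OF cp'(2) qb] by simp
  moreover have "(q1, q2 - 1) \<noteq> q" using Pq by (auto simp: e in_pbw_poset)
  ultimately have "(q1, q2 - 1) \<in> a \<inter> b" using cp'(4) by blast
  from cp'(6) [OF this] cp'(7) show False by (simp add: e P_le_def)
qed

text \<open>Outside \<open>a \<union> b\<close> every cell is above \<open>p\<close>, so
  \<open>(Suc q1, q2)\<close>, in a column before that of \<open>p\<close>, cannot be a cell. Hence
  \<open>q\<close> is diagonal and lies in \<open>b\<close> alone, against the count of
  lengths.\<close>

lemma no_corner_pair_above:
  assumes cp: "corner_pair n d (pbw_poset n) a b p q" and OI: "c \<in> order_ideals n" "d \<in> order_ideals n" and cd: "c \<subseteq> d"
    and bal: "content_balanced n (kdiff n a b c d)"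
  shows False
proof -
  obtain q1 q2 where e: "q = (q1, q2)" by force
  have cp': "a \<in> order_ideals n" "b \<in> order_ideals n" "q \<notin> a" "insert q (a \<inter> b) = b"
      "d \<subseteq> a \<inter> b" "\<And>y. y \<in> pbw_poset n - (a \<union> b) \<Longrightarrow> P_le p y"
    using cp by (simp_all add: corner_pair_def)
  have Pp: "p \<in> pbw_poset n" and Pq: "(q1, q2) \<in> pbw_poset n" and qb: "(q1, q2) \<in> b" and less: "q2 < snd p"
    using corner_pair_snd [OF cp] by (simp_all add: e)
  have "q1 \<noteq> q2"
  proof
    assume *: "q1 = q2"
    have "(q1, q1) \<notin> a" "(q1, q1) \<notin> c" "(q1, q1) \<notin> d" "(q1, q1) \<in> b" using cp' * qb cd by (auto simp: e)
    then have "kdiff n a b c d (q1, q1) = -1"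
      using K_set_iff [OF OI(1)] K_set_iff [OF OI(2)] K_set_iff [OF cp'(1)] K_set_iff [OF cp'(2)]
      by (simp add: kdiff_def)
    with bal show False by (simp add: content_balanced_def)
  qed
  moreover have "q2 < n" using less Pp by (cases p) (auto simp: in_pbw_poset)
  ultimately have P: "(Suc q1, q2) \<in> pbw_poset n" using Pq by (auto simp: in_pbw_poset)
  have "(Suc q1, q2) \<notin> a" using order_idealD [OF cp'(1) _ Pq, of "(Suc q1, q2)"] cp'(3) by (auto simp: e)
  moreover have "(Suc q1, q2) \<noteq> q" by (simp add: e)
  moreover from calculation have "(Suc q1, q2) \<notin> b" using cp'(4) by blast
  ultimately have "P_le p (Suc q1, q2)" using P cp'(6) by blast
  with less show False by (simp add: P_le_def)
qed

text \<open>\<open>H\<close> is what the S-pair obstruction yields. It is applied on one of three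
  intervals, from \<open>c\<close> to \<open>d\<close>, from the empty ideal to \<open>c\<close>, or
  from \<open>d\<close> to the whole poset; every ideal in them is comparable to \<open>c\<close>
  and to \<open>d\<close>.\<close>

lemma kdiff_classification:
  assumes OI: "a \<in> order_ideals n" "b \<in> order_ideals n" "c \<in> order_ideals n" "d \<in> order_ideals n"
    and inc: "\<not> a \<subseteq> b" "\<not> b \<subseteq> a" and cd: "c \<subseteq> d" and ne: "c \<noteq> a" "c \<noteq> b" "d \<noteq> a" "d \<noteq> b"
    and H: "\<And>x. x \<in> order_ideals n \<Longrightarrow> (x \<subseteq> c \<or> c \<subseteq> x) \<and> (x \<subseteq> d \<or> d \<subseteq> x) \<Longrightarrow>
      (x \<subseteq> a \<or> a \<subseteq> x \<or> x = b) \<and> (x \<subseteq> b \<or> b \<subseteq> x \<or> x = a)"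
    and bal: "content_balanced n (kdiff n a b c d)"
  shows "(\<forall>x. kdiff n a b c d x = 0) \<or> (\<exists>i j. 1 \<le> i \<and> i < j \<and> j < n \<and> (\<forall>x. kdiff n a b c d x = elem_pattern i j x))"
proof -
  have corner: "\<exists>p q. corner_pair n lo hi a b p q \<or> corner_pair n lo hi b a p q"
    if "lo \<in> order_ideals n" "hi \<in> order_ideals n" "lo \<subseteq> a \<inter> b" "a \<union> b \<subseteq> hi"
      and *: "\<And>x. lo \<subseteq> x \<Longrightarrow> x \<subseteq> hi \<Longrightarrow> (x \<subseteq> c \<or> c \<subseteq> x) \<and> (x \<subseteq> d \<or> d \<subseteq> x)" for lo hi
  proof (rule corner_pair_exists [OF that(1,2) _ _ inc])
    show "a \<in> between_ideals n lo hi" "b \<in> between_ideals n lo hi" using that OI by (auto simp: between_ideals_def)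
    show "\<forall>x\<in>between_ideals n lo hi. x \<subseteq> a \<or> a \<subseteq> x \<or> x = b" "\<forall>x\<in>between_ideals n lo hi. x \<subseteq> b \<or> b \<subseteq> x \<or> x = a"
      using H * unfolding between_ideals_def by simp_all
  qed
  have bal': "content_balanced n (kdiff n b a c d)" using bal by (simp add: kdiff_swap)
  \<comment> \<open>\<open>c\<close> and \<open>d\<close> are themselves comparable to
    \<open>c\<close> and \<open>d\<close>, so \<open>H\<close> places them around, above or below
    the pair \<open>a\<close>, \<open>b\<close>.\<close>
  have "d \<subseteq> a \<or> a \<subseteq> d" "d \<subseteq> b \<or> b \<subseteq> d" using H [OF OI(4)] cd ne by auto
  moreover have "c \<subseteq> a \<or> a \<subseteq> c" "c \<subseteq> b \<or> b \<subseteq> c" using H [OF OI(3)] cd ne by auto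
  ultimately consider "c \<subseteq> a \<inter> b" "a \<union> b \<subseteq> d" | "a \<union> b \<subseteq> c" | "d \<subseteq> a \<inter> b"
    using inc by blast
  then show ?thesis
  proof cases
    case 1
    then obtain p q where "corner_pair n c d a b p q \<or> corner_pair n c d b a p q"
      using corner [OF OI(3,4)] by metis
    then show ?thesis
      using corner_pair_kdiff [OF _ OI(3,4) bal] corner_pair_kdiff [OF _ OI(3,4) bal'] unfolding kdiff_swap [of n b a] by metis
  next
    case 2
    have "{} \<in> order_ideals n" by (simp add: order_ideals_def)
    then obtain p q where "corner_pair n {} c a b p q \<or> corner_pair n {} c b a p q"
      using corner [OF _ OI(3) _ 2] cd by (metis empty_subsetI subset_trans)
    then show ?thesis
      using no_corner_pair_below [OF _ OI(3,4) cd bal] no_corner_pair_below [OF _ OI(3,4) cd bal'] by metis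
  next
    case 3
    have "pbw_poset n \<in> order_ideals n" by (simp add: order_ideals_def)
    moreover have "a \<union> b \<subseteq> pbw_poset n" using OI by (auto simp: order_ideals_def)
    ultimately obtain p q where "corner_pair n d (pbw_poset n) a b p q \<or> corner_pair n d (pbw_poset n) b a p q"
      using corner [OF OI(4) _ 3] cd by (metis subset_trans)
    then show ?thesis
      using no_corner_pair_above [OF _ OI(3,4) cd bal] no_corner_pair_above [OF _ OI(3,4) cd bal'] by metis
  qed
qed

section \<open>Columns and order ideals\<close>

text \<open>The ideal generated by the cells \<open>(s, entry \<alpha> s)\<close>, an explicit form
  of \<open>ideal_of_col\<close>. A generator \<open>(1, 1)\<close> disappears silently because it
  is not in the poset.\<close>

definition Jcol :: "nat \<Rightarrow> nat list \<Rightarrow> (nat \<times> nat) set" where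
  "Jcol n \<alpha> = {(r, t) \<in> pbw_poset n. \<exists>s\<in>{r..length \<alpha>}. t \<le> entry \<alpha> s}"

lemma set_conv_entry: "set \<alpha> = entry \<alpha> ` {1..length \<alpha>}"
proof (intro equalityI subsetI)
  fix x assume "x \<in> set \<alpha>"
  then obtain i where "i < length \<alpha>" "x = \<alpha> ! i" by (auto simp: in_set_conv_nth)
  then show "x \<in> entry \<alpha> ` {1..length \<alpha>}" by (intro image_eqI [of _ _ "Suc i"]) (auto simp: entry_def)
qed (auto simp: entry_def)

lemma pbw_colsD:
  assumes "\<alpha> \<in> pbw_cols n"
  shows "1 \<le> length \<alpha>" "length \<alpha> < n" "set \<alpha> \<subseteq> {1..n}"
    and "r \<in> {1..length \<alpha>} \<Longrightarrow> entry \<alpha> r \<in> {1..n}"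
    and "r \<in> {1..length \<alpha>} \<Longrightarrow> entry \<alpha> r = r \<or> length \<alpha> < entry \<alpha> r"
    and "r \<in> {1..length \<alpha>} \<Longrightarrow> r' \<in> {1..length \<alpha>} \<Longrightarrow> r < r' \<Longrightarrow> length \<alpha> < entry \<alpha> r' \<Longrightarrow>
      entry \<alpha> r = r \<or> entry \<alpha> r' < entry \<alpha> r"
    and "r \<in> {1..length \<alpha>} \<Longrightarrow> r \<le> entry \<alpha> r"
proof -
  show *: "1 \<le> length \<alpha>" "length \<alpha> < n" and s: "set \<alpha> \<subseteq> {1..n}" using assms by (auto simp: pbw_cols_def)
  show "r \<in> {1..length \<alpha>} \<Longrightarrow> entry \<alpha> r \<in> {1..n}" using s set_conv_entry by blast
  have c: "pbw_column \<alpha>" using assms by (simp add: pbw_cols_def)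
  show e: "entry \<alpha> r = r \<or> length \<alpha> < entry \<alpha> r" if "r \<in> {1..length \<alpha>}" for r
    using c that unfolding pbw_column_def by (metis not_le)
  show "entry \<alpha> r = r \<or> entry \<alpha> r' < entry \<alpha> r"
    if "r \<in> {1..length \<alpha>}" "r' \<in> {1..length \<alpha>}" "r < r'" "length \<alpha> < entry \<alpha> r'"
    using c that e [OF that(1)] unfolding pbw_column_def by metis
  show "r \<le> entry \<alpha> r" if "r \<in> {1..length \<alpha>}" using e [OF that] that by auto
qed

lemma Jcol_ideal: "Jcol n \<alpha> \<in> order_ideals n"
proof (rule order_idealI)
  fix p q assume *: "q \<in> Jcol n \<alpha>" "p \<in> pbw_poset n" "P_le p q"
  obtain r t r' t' where e: "p = (r, t)" "q = (r', t')" by force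
  with * obtain s where "s \<in> {r'..length \<alpha>}" "t' \<le> entry \<alpha> s" by (auto simp: Jcol_def)
  then show "p \<in> Jcol n \<alpha>" using * by (auto simp: Jcol_def e intro!: bexI [of _ s])
qed (auto simp: Jcol_def)

context
  fixes n \<alpha> assumes \<alpha>: "\<alpha> \<in> pbw_cols n"
begin

lemma entry_in_poset:
  assumes "r \<in> {1..length \<alpha>}" "(r, entry \<alpha> r) \<noteq> (1, 1)"
  shows "(r, entry \<alpha> r) \<in> Jcol n \<alpha>"
  using pbw_colsD(1,2) [OF \<alpha>] pbw_colsD(4,5,7) [OF \<alpha> assms(1)] assms
  by (auto simp: Jcol_def in_pbw_poset)

lemma max_Jcol:
  assumes "(r, t) \<in> max_elems (Jcol n \<alpha>)"
  shows "r \<in> {1..length \<alpha>}" "t = entry \<alpha> r"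
proof -
  have rt: "(r, t) \<in> Jcol n \<alpha>" and max: "\<And>q. q \<in> Jcol n \<alpha> \<Longrightarrow> P_le (r, t) q \<Longrightarrow> q = (r, t)"
    using assms by (auto simp: max_elems_def)
  then obtain s where s: "s \<in> {r..length \<alpha>}" "t \<le> entry \<alpha> s" and P: "(r, t) \<in> pbw_poset n" by (auto simp: Jcol_def)
  have "s \<in> {1..length \<alpha>}" "(s, entry \<alpha> s) \<noteq> (1, 1)" using s P by (auto simp: in_pbw_poset)
  then have "(s, entry \<alpha> s) = (r, t)" using s by (intro max entry_in_poset) auto
  then show "r \<in> {1..length \<alpha>}" "t = entry \<alpha> r" using \<open>s \<in> {1..length \<alpha>}\<close> by auto
qed

text \<open>Entries that are not fixed exceed the length and decrease from row to row, so no later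
  row dominates such a cell.\<close>

lemma entry_max_Jcol:
  assumes r: "r \<in> {1..length \<alpha>}" and ne: "entry \<alpha> r \<noteq> r"
  shows "(r, entry \<alpha> r) \<in> max_elems (Jcol n \<alpha>)"
proof -
  have gt: "length \<alpha> < entry \<alpha> r" using pbw_colsD(5) [OF \<alpha> r] ne by simp
  then have "(r, entry \<alpha> r) \<in> Jcol n \<alpha>" using r by (intro entry_in_poset) auto
  moreover have "(r', t') = (r, entry \<alpha> r)" if "(r', t') \<in> Jcol n \<alpha>" "r \<le> r'" "entry \<alpha> r \<le> t'" for r' t'
  proof -
    from that obtain s where s: "r' \<le> s" "s \<le> length \<alpha>" "t' \<le> entry \<alpha> s" by (auto simp: Jcol_def)
    have "\<not> r < s" using pbw_colsD(6) [OF \<alpha> r, of s] s that ne gt r by auto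
    with s that have "s = r" "r' = r" by auto
    with s that show ?thesis by simp
  qed
  ultimately show ?thesis by (auto simp: max_elems_def P_le_def)
qed

text \<open>The length is read off the diagonal; \<open>l = 1\<close> is lost with the cell
  \<open>(1, 1)\<close>, whence the special role of 1 in \<open>length_iff_K\<close>.\<close>

lemma diag_Jcol: "(l, l) \<in> Jcol n \<alpha> \<longleftrightarrow> 2 \<le> l \<and> l \<le> length \<alpha>"
proof
  assume "2 \<le> l \<and> l \<le> length \<alpha>"
  then show "(l, l) \<in> Jcol n \<alpha>"
    using pbw_colsD(2) [OF \<alpha>] pbw_colsD(7) [OF \<alpha>, of "l"] by (auto simp: Jcol_def in_pbw_poset)
qed (auto simp: Jcol_def in_pbw_poset)

lemma col_of_ideal_Jcol: "col_of_ideal (Jcol n \<alpha>) = \<alpha>"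
proof -
  have "insert 1 {l. (l, l) \<in> Jcol n \<alpha>} = {1..length \<alpha>}" using pbw_colsD(1) [OF \<alpha>] by (auto simp: diag_Jcol)
  then have len: "Max (insert 1 {l. (l, l) \<in> Jcol n \<alpha>}) = length \<alpha>"
    using pbw_colsD(1) [OF \<alpha>] by (intro Max_eqI) auto
  have *: "(if \<exists>t. (r, t) \<in> max_elems (Jcol n \<alpha>) then THE t. (r, t) \<in> max_elems (Jcol n \<alpha>) else r) = entry \<alpha> r"
    if r: "r \<in> {1..length \<alpha>}" for r
  proof (cases "\<exists>t. (r, t) \<in> max_elems (Jcol n \<alpha>)")
    case True
    then obtain t where t: "(r, t) \<in> max_elems (Jcol n \<alpha>)" ..
    then have "(THE t. (r, t) \<in> max_elems (Jcol n \<alpha>)) = t"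
      by (rule the_equality) (metis t max_Jcol(2))
    with True max_Jcol(2) [OF t] show ?thesis by simp
  next
    case False
    then have "entry \<alpha> r = r" using entry_max_Jcol [OF r] by blast
    with False show ?thesis by simp
  qed
  have "col_of_ideal (Jcol n \<alpha>) = map (entry \<alpha>) [1..<Suc (length \<alpha>)]"
    unfolding col_of_ideal_def len by (intro map_cong refl *) (simp del: upt_Suc)
  also have "\<dots> = \<alpha>" by (intro nth_equalityI) (simp_all add: entry_def del: upt_Suc)
  finally show ?thesis .
qed

lemma in_set_iff_K:
  assumes "1 \<le> s"
  shows "s \<in> set \<alpha> \<longleftrightarrow> (\<exists>r. r < s \<and> (r, s) \<in> max_elems (Jcol n \<alpha>)) \<or>
    s \<le> length \<alpha> \<and> (\<forall>t>s. (s, t) \<notin> max_elems (Jcol n \<alpha>))"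
proof
  assume "s \<in> set \<alpha>"
  then obtain r where r: "r \<in> {1..length \<alpha>}" "entry \<alpha> r = s" unfolding set_conv_entry by blast
  show "(\<exists>r. r < s \<and> (r, s) \<in> max_elems (Jcol n \<alpha>)) \<or> s \<le> length \<alpha> \<and> (\<forall>t>s. (s, t) \<notin> max_elems (Jcol n \<alpha>))"
  proof (cases "r = s")
    case True
    have "(s, t) \<notin> max_elems (Jcol n \<alpha>)" if "t > s" for t
    proof
      assume "(s, t) \<in> max_elems (Jcol n \<alpha>)"
      from max_Jcol(2) [OF this] that r True show False by simp
    qed
    moreover have "s \<le> length \<alpha>" using r True by simp
    ultimately show ?thesis by blast
  next
    case False
    with r have "(r, s) \<in> max_elems (Jcol n \<alpha>)" using entry_max_Jcol [OF r(1)] by auto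
    moreover have "r < s" using pbw_colsD(7) [OF \<alpha> r(1)] r False by simp
    ultimately show ?thesis by blast
  qed
next
  assume "(\<exists>r. r < s \<and> (r, s) \<in> max_elems (Jcol n \<alpha>)) \<or> s \<le> length \<alpha> \<and> (\<forall>t>s. (s, t) \<notin> max_elems (Jcol n \<alpha>))"
  then show "s \<in> set \<alpha>"
  proof (elim disjE exE conjE)
    fix r assume "(r, s) \<in> max_elems (Jcol n \<alpha>)"
    from max_Jcol [OF this] show ?thesis unfolding set_conv_entry by auto
  next
    assume s: "s \<le> length \<alpha>" "\<forall>t>s. (s, t) \<notin> max_elems (Jcol n \<alpha>)"
    then have r: "s \<in> {1..length \<alpha>}" using assms by simp
    have "entry \<alpha> s = s"
    proof (rule ccontr)
      assume ne: "entry \<alpha> s \<noteq> s"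
      then have "s < entry \<alpha> s" using pbw_colsD(7) [OF \<alpha> r] by simp
      with s(2) entry_max_Jcol [OF r ne] show False by blast
    qed
    then show ?thesis using imageI [OF r, of "entry \<alpha>"] unfolding set_conv_entry by simp
  qed
qed

end

lemma max_elemsD: "p \<in> max_elems J \<Longrightarrow> q \<in> J \<Longrightarrow> P_le p q \<Longrightarrow> q = p"
  by (simp add: max_elems_def)

lemma ideal_max_above:
  assumes J: "J \<in> order_ideals n" and p: "p \<in> J"
  obtains q where "q \<in> max_elems J" "P_le p q"
proof -
  have fin: "finite J" using J finite_pbw_poset by (auto simp: order_ideals_def intro: finite_subset)
  let ?A = "{q \<in> J. P_le p q}"
  have "finite ?A" using fin by simp
  moreover have "?A \<noteq> {}" using p P_le_refl by blast
  ultimately have "Max ((\<lambda>z. fst z + snd z) ` ?A) \<in> (\<lambda>z. fst z + snd z) ` ?A" by (intro Max_in) auto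
  then obtain q where q: "q \<in> ?A" and "fst q + snd q = Max ((\<lambda>z. fst z + snd z) ` ?A)" by auto
  then have max: "fst z + snd z \<le> fst q + snd q" if "z \<in> ?A" for z using that \<open>finite ?A\<close> by simp
  have "q \<in> max_elems J"
    unfolding max_elems_def
  proof safe
    show "q \<in> J" using q by simp
    fix a b assume *: "(a, b) \<in> J" "P_le q (a, b)"
    then have "fst (a, b) + snd (a, b) \<le> fst q + snd q" using P_le_trans [OF _ *(2), of p] q by (intro max) simp
    with * show "(a, b) = q" by (cases q) auto
  qed
  with q that show thesis by simp
qed

text \<open>With \<open>k\<close> the last diagonal index, a maximal cell is diagonal or ends beyond
  column \<open>k\<close>, so its row gets a fixed or a large entry. Maximal cells are incomparable,
  which makes the large entries decrease.\<close>

lemma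
  assumes n: "n \<ge> 2" and J: "J \<in> order_ideals n"
  shows col_of_ideal_in: "col_of_ideal J \<in> pbw_cols n"
    and Jcol_col_of_ideal: "Jcol n (col_of_ideal J) = J"
proof -
  define k where "k = Max (insert 1 {l. (l, l) \<in> J})"
  have sub: "{l. (l, l) \<in> J} \<subseteq> {2..n - 1}"
    using J by (force simp: order_ideals_def in_pbw_poset)
  then have fin: "finite (insert 1 {l. (l, l) \<in> J})" using finite_subset by auto
  have k: "k \<in> insert 1 {l. (l, l) \<in> J}" unfolding k_def by (rule Max_in [OF fin]) simp
  then have "k = 1 \<or> k \<in> {2..n - 1}" using sub by blast
  then have k1: "1 \<le> k" "k < n" using n by auto
  have k_max: "l \<le> k" if "(l, l) \<in> J" for l using fin that by (simp add: k_def)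
  have kk: "(k, k) \<in> J" if "k \<noteq> 1" using k that by auto
  have diag_le: "(r, t) \<in> J" if "(r, t) \<in> pbw_poset n" "r \<le> k" "t \<le> k" for r t
  proof -
    have "k \<noteq> 1" using that by (auto simp: in_pbw_poset)
    with kk order_idealD [OF J _ that(1)] that show ?thesis by simp
  qed
  have maxD: "(r, t) \<in> J" "1 \<le> r" "r \<le> k" "r = t \<or> k < t" "t \<le> n" if "(r, t) \<in> max_elems J" for r t
  proof -
    show J': "(r, t) \<in> J" using that by (simp add: max_elems_def)
    have P: "(r, t) \<in> pbw_poset n" using J J' order_ideal_subset by blast
    then show "1 \<le> r" "t \<le> n" by (auto simp: in_pbw_poset)
    show "r \<le> k"
    proof (cases "r = 1")
      case False
      then have "(r, r) \<in> pbw_poset n" "P_le (r, r) (r, t)" using P by (auto simp: in_pbw_poset)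
      then have "(r, r) \<in> J" using order_idealD [OF J J'] by blast
      then show ?thesis by (rule k_max)
    qed (use k1 in simp)
    show "r = t \<or> k < t"
    proof (cases "t \<le> k")
      case True
      have "k \<noteq> 1" using True P by (auto simp: in_pbw_poset)
      then have "(k, k) = (r, t)" using kk that True \<open>r \<le> k\<close> by (auto simp: max_elems_def)
      then show ?thesis by auto
    qed simp
  qed
  have unique: "t = t'" if "(r, t) \<in> max_elems J" "(r, t') \<in> max_elems J" for r t t'
  proof (cases "t \<le> t'")
    case True
    then show ?thesis using that bspec [of J "\<lambda>q. P_le (r, t) q \<longrightarrow> q = (r, t)" "(r, t')"] by (simp add: max_elems_def)
  next
    case False
    then show ?thesis using that bspec [of J "\<lambda>q. P_le (r, t') q \<longrightarrow> q = (r, t')" "(r, t)"] by (simp add: max_elems_def)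
  qed
  define \<alpha> where "\<alpha> = col_of_ideal J"
  have len: "length \<alpha> = k" by (simp add: \<alpha>_def col_of_ideal_def k_def)
  have entry_map: "entry (map g [1..<Suc k]) r = g r" if "r \<in> {1..k}" for g r
  proof -
    have "r - 1 < length [1..<Suc k]" "[1..<Suc k] ! (r - 1) = r" using that by (auto simp: nth_append)
    then show ?thesis by (simp only: entry_def nth_map)
  qed
  have entry: "entry \<alpha> r = (if \<exists>t. (r, t) \<in> max_elems J then THE t. (r, t) \<in> max_elems J else r)" if "r \<in> {1..k}" for r
    unfolding \<alpha>_def col_of_ideal_def k_def [symmetric] by (rule entry_map [OF that])
  have e1: "entry \<alpha> r = t" if m: "(r, t) \<in> max_elems J" for r t
  proof -
    have r: "r \<in> {1..k}" using maxD(2,3) [OF m] by simp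
    have "(THE t. (r, t) \<in> max_elems J) = t" using m by (rule the_equality) (rule unique [OF _ m])
    moreover have "\<exists>t. (r, t) \<in> max_elems J" using m by (rule exI)
    ultimately show ?thesis by (simp only: entry [OF r] if_True)
  qed
  have e2: "(r, entry \<alpha> r) \<in> max_elems J \<or> entry \<alpha> r = r" if r: "r \<in> {1..k}" for r
  proof (cases "\<exists>t. (r, t) \<in> max_elems J")
    case True
    then obtain t where "(r, t) \<in> max_elems J" ..
    with e1 [OF this] show ?thesis by simp
  next
    case False
    with entry [OF r] show ?thesis by simp
  qed
  have "set \<alpha> \<subseteq> {1..n}"
  proof
    fix s assume "s \<in> set \<alpha>"
    then obtain r where r: "r \<in> {1..k}" "s = entry \<alpha> r" unfolding set_conv_entry len by blast
    from e2 [OF r(1)] show "s \<in> {1..n}"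
    proof
      assume m: "(r, entry \<alpha> r) \<in> max_elems J"
      have "r \<le> entry \<alpha> r" using maxD(3,4) [OF m] by linarith
      with maxD(2,5) [OF m] r show ?thesis by simp
    qed (use r k1 in simp)
  qed
  moreover have "pbw_column \<alpha>"
    unfolding pbw_column_def len
  proof (intro conjI ballI impI)
    fix r assume r: "r \<in> {1..k}" "entry \<alpha> r \<le> k"
    from e2 [OF r(1)] show "entry \<alpha> r = r"
    proof
      assume "(r, entry \<alpha> r) \<in> max_elems J"
      from maxD(4) [OF this] r(2) show ?thesis by linarith
    qed
  next
    fix r1 r2 assume r: "r1 \<in> {1..k}" "r2 \<in> {1..k}" "r1 < r2 \<and> k < entry \<alpha> r1 \<and> k < entry \<alpha> r2"
    then have m: "(r1, entry \<alpha> r1) \<in> max_elems J" "(r2, entry \<alpha> r2) \<in> max_elems J"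
      using e2 [OF r(1)] e2 [OF r(2)] r by auto
    show "entry \<alpha> r2 < entry \<alpha> r1"
    proof (rule ccontr)
      assume "\<not> entry \<alpha> r2 < entry \<alpha> r1"
      then have "P_le (r1, entry \<alpha> r1) (r2, entry \<alpha> r2)" using r by simp
      then have "(r2, entry \<alpha> r2) = (r1, entry \<alpha> r1)" 
        by (rule max_elemsD [OF m(1) maxD(1) [OF m(2)]])
      with r show False by simp
    qed
  qed
  ultimately show "col_of_ideal J \<in> pbw_cols n"
    using k1 len by (simp add: pbw_cols_def \<alpha>_def)
  show "Jcol n (col_of_ideal J) = J"
  proof (rule Set.set_eqI)
    fix x :: "nat \<times> nat"
    obtain r t where x: "x = (r, t)" by force
    have "(r, t) \<in> Jcol n \<alpha> \<longleftrightarrow> (r, t) \<in> J"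
    proof
      assume "(r, t) \<in> Jcol n \<alpha>"
      then obtain s where s: "s \<in> {r..k}" "t \<le> entry \<alpha> s" and P: "(r, t) \<in> pbw_poset n" by (auto simp: Jcol_def len)
      have "s \<in> {1..k}" using s P by (auto simp: in_pbw_poset)
      from e2 [OF this] show "(r, t) \<in> J"
      proof
        assume "(s, entry \<alpha> s) \<in> max_elems J"
        from maxD(1) [OF this] show ?thesis by (rule order_idealD [OF J _ P]) (use s in simp)
      next
        assume "entry \<alpha> s = s"
        with s have "r \<le> k" "t \<le> k" by auto
        then show ?thesis by (rule diag_le [OF P])
      qed
    next
      assume rt: "(r, t) \<in> J"
      then obtain q where q: "q \<in> max_elems J" "P_le (r, t) q" using ideal_max_above [OF J] by metis
      obtain r' t' where q': "q = (r', t')" by force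
      have m: "(r', t') \<in> max_elems J" using q(1) q' by simp
      have "entry \<alpha> r' = t'" "r' \<le> k" using e1 [OF m] maxD(3) [OF m] .
      moreover have "r \<le> r'" "t \<le> t'" using q(2) by (simp_all add: q')
      ultimately have "\<exists>s\<in>{r..k}. t \<le> entry \<alpha> s" by (intro bexI [of _ r']) simp_all
      with order_ideal_subset [OF J rt] show "(r, t) \<in> Jcol n \<alpha>" by (simp add: Jcol_def len)
    qed
    then show "x \<in> Jcol n (col_of_ideal J) \<longleftrightarrow> x \<in> J" by (simp add: x \<alpha>_def)
  qed
qed

lemma ideal_of_col_eq:
  assumes "n \<ge> 2" "\<alpha> \<in> pbw_cols n"
  shows "ideal_of_col n \<alpha> = Jcol n \<alpha>"
proof -
  have "inj_on col_of_ideal (order_ideals n)"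
    by (rule inj_on_inverseI [where g = "Jcol n"]) (rule Jcol_col_of_ideal [OF assms(1)])
  from inv_into_f_f [OF this Jcol_ideal, of \<alpha>] show ?thesis
    by (simp add: ideal_of_col_def col_of_ideal_Jcol [OF assms(2)])
qed

lemma pbw_le_iff:
  assumes a: "\<alpha> \<in> pbw_cols n" and b: "\<beta> \<in> pbw_cols n"
  shows "pbw_le \<beta> \<alpha> \<longleftrightarrow> Jcol n \<beta> \<subseteq> Jcol n \<alpha>"
proof
  assume "pbw_le \<beta> \<alpha>"
  then have *: "\<And>r. r \<in> {1..length \<beta>} \<Longrightarrow> \<exists>s\<in>{r..length \<alpha>}. entry \<beta> r \<le> entry \<alpha> s"
    by (simp add: pbw_le_def pbw_tableau_def)
  show "Jcol n \<beta> \<subseteq> Jcol n \<alpha>"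
  proof safe
    fix r t assume "(r, t) \<in> Jcol n \<beta>"
    then obtain s where s: "s \<in> {r..length \<beta>}" "t \<le> entry \<beta> s" and P: "(r, t) \<in> pbw_poset n" by (auto simp: Jcol_def)
    then have "s \<in> {1..length \<beta>}" by (auto simp: in_pbw_poset)
    from * [OF this] obtain s' where "s' \<in> {s..length \<alpha>}" "entry \<beta> s \<le> entry \<alpha> s'" by blast
    then show "(r, t) \<in> Jcol n \<alpha>" using s P by (auto simp: Jcol_def intro!: bexI [of _ s'])
  qed
next
  assume sub: "Jcol n \<beta> \<subseteq> Jcol n \<alpha>"
  have "length \<beta> \<le> length \<alpha>"
  proof (cases "length \<beta> = 1")
    case False
    then have "(length \<beta>, length \<beta>) \<in> Jcol n \<beta>" using diag_Jcol [OF b] pbw_colsD(1) [OF b] by simp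
    with sub have "(length \<beta>, length \<beta>) \<in> Jcol n \<alpha>" by blast
    with diag_Jcol [OF a] show ?thesis by simp
  qed (use pbw_colsD(1) [OF a] in simp)
  moreover have "\<exists>s\<in>{r..length \<alpha>}. entry \<beta> r \<le> entry \<alpha> s" if r: "r \<in> {1..length \<beta>}" for r
  proof (cases "(r, entry \<beta> r) = (1, 1)")
    \<comment> \<open>The cell \<open>(1, 1)\<close> is missing from the poset, so entry 1 in row 1
      is compared directly.\<close>
    case True
    then show ?thesis using pbw_colsD(1) [OF a] pbw_colsD(7) [OF a, of 1] by (auto intro!: bexI [of _ 1])
  next
    case False
    then have "(r, entry \<beta> r) \<in> Jcol n \<alpha>" using entry_in_poset [OF b r] sub by blast
    then show ?thesis by (auto simp: Jcol_def)
  qed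
  ultimately show "pbw_le \<beta> \<alpha>" using a b by (simp add: pbw_le_def pbw_tableau_def pbw_cols_def)
qed

section \<open>Columns with a prescribed set of entries\<close>

lemma ex_decreasing_onto:
  fixes A B :: "nat set"
  assumes "finite A" "finite B" "card A = card B"
  shows "\<exists>f. f ` A = B \<and> (\<forall>x\<in>A. \<forall>y\<in>A. x < y \<longrightarrow> f y < f x)"
proof -
  define m where "m = card A"
  obtain h where h: "bij_betw h {..<m} A" "strict_mono_on {..<m} h"
    using ex_bij_betw_strict_mono_card [OF assms(1)] m_def by metis
  obtain g where g: "bij_betw g {..<m} B" "strict_mono_on {..<m} g"
    using ex_bij_betw_strict_mono_card [OF assms(2)] m_def assms(3) by metis
  define k where "k = inv_into {..<m} h"
  have k: "bij_betw k A {..<m}" using h(1) unfolding k_def by (rule bij_betw_inv_into)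
  have kless: "k x < m" if "x \<in> A" for x using bij_betwE [OF k] that by blast
  have hk: "h (k x) = x" if "x \<in> A" for x
    using that h(1) unfolding k_def bij_betw_def by (simp add: f_inv_into_f)
  have "(\<lambda>i. m - 1 - i) ` {..<m} = {..<m}"
  proof (intro equalityI subsetI)
    fix i assume "i \<in> {..<m}"
    then show "i \<in> (\<lambda>i. m - 1 - i) ` {..<m}" by (intro image_eqI [of _ _ "m - 1 - i"]) auto
  qed auto
  then have "(\<lambda>x. g (m - 1 - k x)) ` A = B"
    using k g(1) image_image [of g "\<lambda>i. m - 1 - i" "{..<m}"] image_image [of "\<lambda>i. g (m - 1 - i)" k A]
    unfolding bij_betw_def by simp
  moreover have "g (m - 1 - k y) < g (m - 1 - k x)" if xy: "x \<in> A" "y \<in> A" "x < y" for x y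
  proof -
    have "k x < k y"
    proof (rule ccontr)
      assume "\<not> k x < k y"
      then have "k y < k x \<or> k y = k x" by auto
      then have "h (k y) \<le> h (k x)"
        using strict_mono_onD [OF h(2), of "k y" "k x"] kless [OF xy(1)] kless [OF xy(2)] by auto
      with hk xy show False by simp
    qed
    then show ?thesis using kless [OF xy(1)] kless [OF xy(2)] by (intro strict_mono_onD [OF g(2)]) auto
  qed
  ultimately show ?thesis by blast
qed

lemma decreasing_onto_unique:
  fixes f g :: "nat \<Rightarrow> nat"
  assumes "finite A" and im: "f ` A = g ` A"
    and f: "\<And>x y. x \<in> A \<Longrightarrow> y \<in> A \<Longrightarrow> x < y \<Longrightarrow> f y < f x"
    and g: "\<And>x y. x \<in> A \<Longrightarrow> y \<in> A \<Longrightarrow> x < y \<Longrightarrow> g y < g x"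
    and x: "x \<in> A"
  shows "f x = g x"
proof -
  define xs where "xs = sorted_list_of_set A"
  have xs: "set xs = A" "sorted_wrt (<) xs" using assms(1) by (simp_all add: xs_def)
  have srt: "sorted_wrt (<) (rev (map h xs))" if "\<And>x y. x \<in> A \<Longrightarrow> y \<in> A \<Longrightarrow> x < y \<Longrightarrow> h y < h x" for h :: "nat \<Rightarrow> nat"
  proof -
    have "sorted_wrt (\<lambda>x y. h y < h x) xs" by (rule sorted_wrt_mono_rel [OF _ xs(2)]) (use that xs in auto)
    then show ?thesis by (simp add: sorted_wrt_rev sorted_wrt_map)
  qed
  have "rev (map f xs) = rev (map g xs)"
    using srt [OF f] srt [OF g] im xs(1) by (intro sorted_distinct_set_unique) (auto simp: strict_sorted_iff)
  then show ?thesis using x xs(1) by simp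
qed

lemma distinct_pbw_col:
  assumes "\<alpha> \<in> pbw_cols n"
  shows "distinct \<alpha>"
proof -
  have ne: "entry \<alpha> r \<noteq> entry \<alpha> r'" if r: "r \<in> {1..length \<alpha>}" "r' \<in> {1..length \<alpha>}" "r < r'" for r r'
    using pbw_colsD(5) [OF assms r(1)] pbw_colsD(5) [OF assms r(2)] pbw_colsD(6) [OF assms r] r by auto
  have "inj_on (entry \<alpha>) {1..length \<alpha>}"
  proof (rule inj_onI)
    fix r r' assume "r \<in> {1..length \<alpha>}" "r' \<in> {1..length \<alpha>}" "entry \<alpha> r = entry \<alpha> r'"
    then show "r = r'" using ne [of r r'] ne [of r' r] by (metis nat_neq_iff)
  qed
  then have "card (set \<alpha>) = length \<alpha>" unfolding set_conv_entry by (simp add: card_image)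
  then show ?thesis by (rule card_distinct)
qed

lemma entry_fixed_iff:
  assumes \<alpha>: "\<alpha> \<in> pbw_cols n" and r: "r \<in> {1..length \<alpha>}"
  shows "entry \<alpha> r = r \<longleftrightarrow> r \<in> set \<alpha>"
proof
  assume "entry \<alpha> r = r"
  then show "r \<in> set \<alpha>" using imageI [OF r, of "entry \<alpha>"] by (simp add: set_conv_entry)
next
  assume "r \<in> set \<alpha>"
  then obtain s where s: "s \<in> {1..length \<alpha>}" "r = entry \<alpha> s" unfolding set_conv_entry by blast
  then show "entry \<alpha> r = r" using pbw_colsD(5) [OF \<alpha> s(1)] r by auto
qed

text \<open>Rows whose number is an entry are fixed, and the other rows carry the entries beyond the
  length in decreasing order, which leaves no choice.\<close>

lemma pbw_col_unique:
  assumes \<alpha>: "\<alpha> \<in> pbw_cols n" and \<beta>: "\<beta> \<in> pbw_cols n" and eq: "set \<alpha> = set \<beta>"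
  shows "\<alpha> = \<beta>"
proof -
  have len: "length \<beta> = length \<alpha>"
    using distinct_card [OF distinct_pbw_col [OF \<alpha>]] distinct_card [OF distinct_pbw_col [OF \<beta>]] eq by simp
  define A where "A = {1..length \<alpha>} - set \<alpha>"
  have img: "entry \<gamma> ` A = set \<gamma> - {1..length \<gamma>}"
    if \<gamma>: "\<gamma> \<in> pbw_cols n" "A = {1..length \<gamma>} - set \<gamma>" for \<gamma>
  proof (intro equalityI subsetI)
    fix x assume "x \<in> entry \<gamma> ` A"
    then obtain r where r: "r \<in> {1..length \<gamma>}" "r \<notin> set \<gamma>" "x = entry \<gamma> r" using \<gamma> by blast
    then have "length \<gamma> < x" using pbw_colsD(5) [OF \<gamma>(1) r(1)] entry_fixed_iff [OF \<gamma>(1) r(1)] by auto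
    moreover have "x \<in> set \<gamma>" using r by (simp add: set_conv_entry)
    ultimately show "x \<in> set \<gamma> - {1..length \<gamma>}" by simp
  next
    fix x assume x: "x \<in> set \<gamma> - {1..length \<gamma>}"
    then obtain r where r: "r \<in> {1..length \<gamma>}" "x = entry \<gamma> r" unfolding set_conv_entry by blast
    then have "r \<notin> set \<gamma>" using x entry_fixed_iff [OF \<gamma>(1) r(1)] by auto
    then show "x \<in> entry \<gamma> ` A" using r \<gamma>(2) by blast
  qed
  have dec: "entry \<gamma> y < entry \<gamma> x"
    if \<gamma>: "\<gamma> \<in> pbw_cols n" "A = {1..length \<gamma>} - set \<gamma>" and xy: "x \<in> A" "y \<in> A" "x < y" for \<gamma> x y
  proof -
    have r: "x \<in> {1..length \<gamma>}" "y \<in> {1..length \<gamma>}" "x \<notin> set \<gamma>" "y \<notin> set \<gamma>" using xy \<gamma>(2) by auto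
    then have "entry \<gamma> x \<noteq> x" "length \<gamma> < entry \<gamma> y"
      using pbw_colsD(5) [OF \<gamma>(1) r(2)] entry_fixed_iff [OF \<gamma>(1) r(1)] entry_fixed_iff [OF \<gamma>(1) r(2)] by auto
    with pbw_colsD(6) [OF \<gamma>(1) r(1,2) xy(3)] show ?thesis by simp
  qed
  have A\<beta>: "A = {1..length \<beta>} - set \<beta>" using len eq by (simp add: A_def)
  have "entry \<alpha> r = entry \<beta> r" if r: "r \<in> {1..length \<alpha>}" for r
  proof (cases "r \<in> set \<alpha>")
    case True
    then show ?thesis using entry_fixed_iff [OF \<alpha> r] entry_fixed_iff [OF \<beta>, of r] r len eq by simp
  next
    case False
    have fin: "finite A" and rA: "r \<in> A" using r False by (simp_all add: A_def)
    have im: "entry \<alpha> ` A = entry \<beta> ` A" unfolding img [OF \<alpha> A_def] img [OF \<beta> A\<beta>] len eq ..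
    show ?thesis
      by (rule decreasing_onto_unique [OF fin im _ _ rA]) (rule dec [OF \<alpha> A_def] dec [OF \<beta> A\<beta>], assumption+)+
  qed
  then have "\<alpha> ! i = \<beta> ! i" if "i < length \<alpha>" for i
  proof -
    have "Suc i \<in> {1..length \<alpha>}" using that by simp
    from \<open>\<And>r. r \<in> {1..length \<alpha>} \<Longrightarrow> entry \<alpha> r = entry \<beta> r\<close> [OF this] show ?thesis by (simp add: entry_def)
  qed
  then show ?thesis using len by (intro nth_equalityI) simp_all
qed

text \<open>The rows without a fixed entry and the entries beyond \<open>k\<close> are equally many,
  as both complement the intersection of \<open>A\<close> with \<open>{1..k}\<close> in a set of
  size \<open>k\<close>; they are matched in reverse order.\<close>

lemma pbw_col_exists:
  assumes A: "A \<subseteq> {1..n}" and card: "1 \<le> card A" "card A \<le> n - 1"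
  shows "\<exists>\<alpha>\<in>pbw_cols n. set \<alpha> = A"
proof -
  define k where "k = card A"
  have fin: "finite A" using A finite_subset by auto
  have "card ({1..k} - A) = card (A - {1..k})"
  proof -
    have "card ({1..k} - A) = card {1..k} - card ({1..k} \<inter> A)" by (rule card_Diff_subset_Int) simp
    moreover have "card (A - {1..k}) = card A - card (A \<inter> {1..k})" by (rule card_Diff_subset_Int) (use fin in simp)
    ultimately show ?thesis by (simp add: k_def Int_commute)
  qed
  then obtain f where f: "f ` ({1..k} - A) = A - {1..k}"
      "\<forall>x\<in>{1..k} - A. \<forall>y\<in>{1..k} - A. x < y \<longrightarrow> f y < f x"
    using ex_decreasing_onto [of "{1..k} - A" "A - {1..k}"] fin by auto
  define g where "g r = (if r \<in> A then r else f r)" for r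
  define \<alpha> where "\<alpha> = map g [1..<Suc k]"
  have len: "length \<alpha> = k" by (simp add: \<alpha>_def)
  have e: "entry \<alpha> r = g r" if "r \<in> {1..k}" for r
  proof -
    have "r - 1 < length [1..<Suc k]" "[1..<Suc k] ! (r - 1) = r" using that by (auto simp: nth_append)
    then show ?thesis by (simp only: entry_def nth_map \<alpha>_def)
  qed
  have big: "k < f r" "f r \<in> A" if "r \<in> {1..k}" "r \<notin> A" for r
  proof -
    have "f r \<in> A - {1..k}" using f(1) that by blast
    then show "k < f r" "f r \<in> A" using A by force+
  qed
  have "set \<alpha> = g ` {1..k}" by (simp add: \<alpha>_def atLeastLessThanSuc_atLeastAtMost del: upt_Suc)
  also have "\<dots> = A"
  proof (intro equalityI subsetI)
    fix x assume "x \<in> A"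
    show "x \<in> g ` {1..k}"
    proof (cases "x \<in> {1..k}")
      case True
      then show ?thesis using \<open>x \<in> A\<close> by (intro image_eqI [of _ _ x]) (simp_all add: g_def)
    next
      case False
      then have "x \<in> f ` ({1..k} - A)" using f(1) \<open>x \<in> A\<close> by blast
      then obtain r where "r \<in> {1..k}" "r \<notin> A" "x = f r" by blast
      then show ?thesis by (intro image_eqI [of _ _ r]) (simp_all add: g_def)
    qed
  qed (use big in \<open>auto simp: g_def\<close>)
  finally have set: "set \<alpha> = A" .
  have "pbw_column \<alpha>"
    unfolding pbw_column_def len
  proof (intro conjI ballI impI)
    fix r assume "r \<in> {1..k}" "entry \<alpha> r \<le> k"
    then show "entry \<alpha> r = r" using big [of r] e [of r] by (cases "r \<in> A") (auto simp: g_def)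
  next
    fix r1 r2 assume r: "r1 \<in> {1..k}" "r2 \<in> {1..k}" "r1 < r2 \<and> k < entry \<alpha> r1 \<and> k < entry \<alpha> r2"
    then have "r1 \<notin> A" "r2 \<notin> A" using e by (auto simp: g_def)
    then show "entry \<alpha> r2 < entry \<alpha> r1" using r f(2) e by (auto simp: g_def)
  qed
  then have "\<alpha> \<in> pbw_cols n" using set A card len by (simp add: pbw_cols_def k_def)
  with set show ?thesis by blast
qed

lemma plucker_vars_distinct: "v \<in> plucker_vars n \<Longrightarrow> distinct v \<and> sorted v"
  by (simp add: plucker_vars_def strict_sorted_iff)

lemma
  assumes "v \<in> plucker_vars n"
  shows col_of_in: "col_of n v \<in> pbw_cols n"
    and set_col_of: "set (col_of n v) = set v"
proof -
  have "card (set v) = length v" using plucker_vars_distinct [OF assms] by (simp add: distinct_card)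
  then have "\<exists>\<alpha>\<in>pbw_cols n. set \<alpha> = set v"
    using assms by (intro pbw_col_exists) (auto simp: plucker_vars_def)
  then have "\<exists>!\<alpha>. \<alpha> \<in> pbw_cols n \<and> set \<alpha> = set v" using pbw_col_unique by metis
  from theI' [OF this] show "col_of n v \<in> pbw_cols n" "set (col_of n v) = set v"
    unfolding col_of_def by auto
qed

lemma length_col_of: "v \<in> plucker_vars n \<Longrightarrow> length (col_of n v) = length v"
  using distinct_card [OF distinct_pbw_col [OF col_of_in]] set_col_of plucker_vars_distinct distinct_card by metis

lemma
  assumes "\<alpha> \<in> pbw_cols n"
  shows sort_in_plucker_vars: "sort \<alpha> \<in> plucker_vars n"
    and col_of_sort: "col_of n (sort \<alpha>) = \<alpha>"
proof -
  show v: "sort \<alpha> \<in> plucker_vars n"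
    using assms distinct_pbw_col [OF assms] by (simp add: plucker_vars_def pbw_cols_def strict_sorted_iff)
  show "col_of n (sort \<alpha>) = \<alpha>"
    by (rule pbw_col_unique [OF col_of_in [OF v] assms]) (simp add: set_col_of [OF v])
qed

lemma plucker_vars_eqI: "u \<in> plucker_vars n \<Longrightarrow> v \<in> plucker_vars n \<Longrightarrow> set u = set v \<Longrightarrow> u = v"
  using plucker_vars_distinct sorted_distinct_set_unique by metis

lemma col_of_inj: "inj_on (col_of n) (plucker_vars n)"
  by (rule inj_onI) (metis set_col_of plucker_vars_eqI)

lemma finite_plucker_vars: "finite (plucker_vars n)"
proof (rule finite_imageD)
  show "finite (set ` plucker_vars n)"
    by (rule finite_subset [of _ "Pow {1..n}"]) (auto simp: plucker_vars_def)
  show "inj_on set (plucker_vars n)" by (rule inj_onI) (rule plucker_vars_eqI)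
qed

definition Jv :: "nat \<Rightarrow> nat list \<Rightarrow> (nat \<times> nat) set" where
  "Jv n v = ideal_of_col n (col_of n v)"

context
  fixes n :: nat assumes n: "n \<ge> 2"
begin

lemma Jv_eq: "v \<in> plucker_vars n \<Longrightarrow> Jv n v = Jcol n (col_of n v)"
  unfolding Jv_def by (rule ideal_of_col_eq [OF n col_of_in])

lemma Jv_ideal: "v \<in> plucker_vars n \<Longrightarrow> Jv n v \<in> order_ideals n"
  by (simp add: Jv_eq Jcol_ideal)

lemma Jv_inj: "u \<in> plucker_vars n \<Longrightarrow> v \<in> plucker_vars n \<Longrightarrow> Jv n u = Jv n v \<Longrightarrow> u = v"
  using col_of_ideal_Jcol [OF col_of_in] col_of_inj unfolding inj_on_def by (metis Jv_eq)

lemma Jv_surj: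
  assumes "x \<in> order_ideals n"
  obtains v where "v \<in> plucker_vars n" "Jv n v = x"
proof
  have c: "col_of_ideal x \<in> pbw_cols n" by (rule col_of_ideal_in [OF n assms])
  show v: "sort (col_of_ideal x) \<in> plucker_vars n" by (rule sort_in_plucker_vars [OF c])
  show "Jv n (sort (col_of_ideal x)) = x"
    by (simp add: Jv_eq [OF v] col_of_sort [OF c] Jcol_col_of_ideal [OF n assms])
qed

lemma pbw_le_col_of_iff:
  "u \<in> plucker_vars n \<Longrightarrow> v \<in> plucker_vars n \<Longrightarrow> pbw_le (col_of n u) (col_of n v) \<longleftrightarrow> Jv n u \<subseteq> Jv n v"
  by (simp add: pbw_le_iff [OF col_of_in col_of_in] Jv_eq)

lemma length_iff_K:
  assumes "v \<in> plucker_vars n" "1 \<le> r"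
  shows "r \<le> length v \<longleftrightarrow> r = 1 \<or> (r, r) \<in> K_set n (Jv n v)"
  using diag_Jcol [OF col_of_in [OF assms(1)], of r] K_set_iff [OF Jv_ideal [OF assms(1)], of r r] assms
    pbw_colsD(1) [OF col_of_in [OF assms(1)]]
  by (auto simp: Jv_eq length_col_of)

lemma sum_of_bool_unique:
  assumes "finite A" "\<And>x y. x \<in> A \<Longrightarrow> y \<in> A \<Longrightarrow> P x \<Longrightarrow> P y \<Longrightarrow> x = y"
  shows "(\<Sum>x\<in>A. of_bool (P x) :: int) = of_bool (\<exists>x\<in>A. P x)"
proof (cases "\<exists>x\<in>A. P x")
  case True
  then obtain x where x: "x \<in> A" "P x" by blast
  have "(\<Sum>y\<in>A. of_bool (P y) :: int) = (\<Sum>y\<in>A. if y = x then 1 else 0)"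
    by (rule sum.cong [OF refl]) (use assms(2) x in \<open>auto simp: of_bool_def\<close>)
  with True x assms(1) show ?thesis by simp
qed simp

text \<open>Off-diagonal maximal cells describe replacements: starting from the entries
  \<open>1, ..., length v\<close>, a maximal cell \<open>(s, t)\<close> removes \<open>s\<close> and
  adds \<open>t\<close>. Each of the two sums has at most one nonzero summand.\<close>

lemma content_K:
  assumes v: "v \<in> plucker_vars n" and s: "1 \<le> s"
  shows "of_bool (s \<in> set v) = (of_bool (s \<le> length v) + (\<Sum>r\<in>{1..<s}. of_bool ((r, s) \<in> K_set n (Jv n v)))
    - (\<Sum>t\<in>{s<..n}. of_bool ((s, t) \<in> K_set n (Jv n v))) :: int)"
proof -
  note c = col_of_in [OF v]
  let ?J = "Jcol n (col_of n v)"
  have K: "(r, t) \<in> K_set n (Jv n v) \<longleftrightarrow> (r, t) \<in> max_elems ?J" if "r < t" for r t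
    using that order_ideal_subset [OF Jcol_ideal, of "(r, t)" n "col_of n v"]
    by (auto simp: Jv_eq [OF v] K_set_def V_o_def V_c_def max_elems_def)
  have max_uniq: "r = r'" if "(r, t) \<in> max_elems ?J" "(r', t) \<in> max_elems ?J" for r r' t
  proof (cases "r \<le> r'")
    case True
    have "(r', t) \<in> ?J" using that(2) by (simp add: max_elems_def)
    from max_elemsD [OF that(1) this] True show ?thesis by simp
  next
    case False
    have "(r, t) \<in> ?J" using that(1) by (simp add: max_elems_def)
    from max_elemsD [OF that(2) this] False show ?thesis by simp
  qed
  have "(\<Sum>r\<in>{1..<s}. of_bool ((r, s) \<in> K_set n (Jv n v)) :: int) = (\<Sum>r\<in>{1..<s}. of_bool ((r, s) \<in> max_elems ?J))"
    by (intro sum.cong refl) (simp add: K)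
  also have "\<dots> = of_bool (\<exists>r\<in>{1..<s}. (r, s) \<in> max_elems ?J)"
    by (intro sum_of_bool_unique finite_atLeastLessThan) (rule max_uniq)
  finally have A: "(\<Sum>r\<in>{1..<s}. of_bool ((r, s) \<in> K_set n (Jv n v)) :: int) = of_bool (\<exists>r\<in>{1..<s}. (r, s) \<in> max_elems ?J)" .
  have "(\<Sum>t\<in>{s<..n}. of_bool ((s, t) \<in> K_set n (Jv n v)) :: int) = (\<Sum>t\<in>{s<..n}. of_bool ((s, t) \<in> max_elems ?J))"
    by (intro sum.cong refl) (simp add: K)
  also have "\<dots> = of_bool (\<exists>t\<in>{s<..n}. (s, t) \<in> max_elems ?J)"
    by (intro sum_of_bool_unique) (simp, metis max_Jcol(2) [OF c])
  finally have B: "(\<Sum>t\<in>{s<..n}. of_bool ((s, t) \<in> K_set n (Jv n v)) :: int) = of_bool (\<exists>t\<in>{s<..n}. (s, t) \<in> max_elems ?J)" .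
  let ?A = "\<exists>r\<in>{1..<s}. (r, s) \<in> max_elems ?J" and ?B = "\<exists>t\<in>{s<..n}. (s, t) \<in> max_elems ?J"
  have P: "1 \<le> r" "t \<le> n" if "(r, t) \<in> max_elems ?J" for r t
  proof -
    have "(r, t) \<in> ?J" using that by (simp add: max_elems_def)
    from order_ideal_subset [OF Jcol_ideal this] show "1 \<le> r" "t \<le> n" by (simp_all add: in_pbw_poset)
  qed
  have "(\<exists>r. r < s \<and> (r, s) \<in> max_elems ?J) \<longleftrightarrow> ?A" using P by fastforce
  moreover have "(\<forall>t>s. (s, t) \<notin> max_elems ?J) \<longleftrightarrow> \<not> ?B" using P by fastforce
  ultimately have mem: "s \<in> set v \<longleftrightarrow> ?A \<or> s \<le> length v \<and> \<not> ?B"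
    using in_set_iff_K [OF c s] by (simp add: set_col_of [OF v] length_col_of [OF v])
  have len: "s \<le> length v" if ?B
  proof -
    from that obtain t where "(s, t) \<in> max_elems ?J" by blast
    from max_Jcol(1) [OF c this] show ?thesis by (simp add: length_col_of [OF v])
  qed
  have "\<not> s \<le> length v" if ?A
  proof -
    from that obtain r where r: "r < s" "(r, s) \<in> max_elems ?J" by auto
    from max_Jcol [OF c r(2)] pbw_colsD(5) [OF c, of r] r(1) show ?thesis by (auto simp: length_col_of [OF v])
  qed
  with mem len show ?thesis unfolding A B by (cases ?A; cases ?B; cases "s \<le> length v") simp_all
qed

end

section \<open>The Pluecker, monomial and toric ideals\<close>

definition eval_mon :: "('v \<Rightarrow> 'u mpoly) \<Rightarrow> ('v \<Rightarrow>\<^sub>0 nat) \<Rightarrow> 'u mpoly" where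
  "eval_mon f m = (\<Prod>v\<in>keys m. f v ^ lookup m v)"

lemma eval_mon_superset: "finite A \<Longrightarrow> keys m \<subseteq> A \<Longrightarrow> eval_mon f m = (\<Prod>v\<in>A. f v ^ lookup m v)"
  unfolding eval_mon_def by (rule prod.mono_neutral_left) (auto simp: in_keys_iff)

lemma eval_mon_add: "eval_mon f (m + m') = eval_mon f m * eval_mon f m'"
  by (subst (1 2 3) eval_mon_superset [of "keys m \<union> keys m'"])
    (auto simp: keys_add_nat lookup_add power_add prod.distrib)

lemma PConst_mult: "PConst (a * b) = PConst a * PConst b"
  by (simp add: PConst_def mult_single)

lemma psubst_superset:
  assumes "finite A" "keys p \<subseteq> A"
  shows "psubst f p = (\<Sum>m\<in>A. PConst (lookup p m) * eval_mon f m)"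
proof -
  have "(\<Sum>m\<in>keys p. PConst (lookup p m) * eval_mon f m) = (\<Sum>m\<in>A. PConst (lookup p m) * eval_mon f m)"
    by (rule sum.mono_neutral_left) (use assms in \<open>auto simp: in_keys_iff PConst_def\<close>)
  then show ?thesis by (simp add: psubst_def eval_mon_def)
qed

lemma psubst_eq: "psubst f p = (\<Sum>m\<in>keys p. PConst (lookup p m) * eval_mon f m)"
  by (rule psubst_superset) auto

lemma lookup_psubst: "lookup (psubst f p) \<mu> = (\<Sum>m\<in>keys p. lookup p m * lookup (eval_mon f m) \<mu>)"
  by (simp add: psubst_eq lookup_sum)

lemma psubst_add: "psubst f (p + q) = psubst f p + psubst f q"
proof -
  have "keys (p + q) \<subseteq> keys p \<union> keys q" by (rule keys_add)
  then show ?thesis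
    by (subst (1 2 3) psubst_superset [of "keys p \<union> keys q"])
      (auto simp: lookup_add PConst_def single_add distrib_right sum.distrib)
qed

lemma psubst_scale: "psubst f (PConst c * p) = PConst c * psubst f p"
proof -
  have "psubst f (PConst c * p) = (\<Sum>m\<in>keys p. PConst (lookup (PConst c * p) m) * eval_mon f m)"
    by (rule psubst_superset [OF _ keys_PConst_mult]) simp
  also have "\<dots> = PConst c * psubst f p"
    unfolding psubst_eq sum_distrib_left
    by (intro sum.cong refl) (simp only: lookup_PConst_mult PConst_mult mult.assoc)
  finally show ?thesis .
qed

lemma psubst_zero [simp]: "psubst f 0 = 0"
  by (simp add: psubst_def)

lemma psubst_xmon [simp]: "psubst f (mon m) = eval_mon f m"
  by (simp add: psubst_eq PConst_def)

lemma psubst_sum: "psubst f (\<Sum>i\<in>A. g i) = (\<Sum>i\<in>A. psubst f (g i))"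
  by (induction A rule: infinite_finite_induct) (simp_all add: psubst_add)

lemma psubst_xmon_mult: "psubst f (mon x * p) = eval_mon f x * psubst f p"
proof -
  have "mon x * p = mon x * (\<Sum>m\<in>keys p. PConst (lookup p m) * mon m)"
    by (rule arg_cong [OF mono_expand]) auto
  also have "\<dots> = (\<Sum>m\<in>keys p. PConst (lookup p m) * mon (x + m))"
    unfolding sum_distrib_left by (intro sum.cong refl) (simp add: mult.left_commute [of "mon x"] mult_single)
  finally have "psubst f (mon x * p) = (\<Sum>m\<in>keys p. PConst (lookup p m) * (eval_mon f x * eval_mon f m))"
    by (simp only: psubst_sum psubst_scale psubst_xmon eval_mon_add)
  also have "\<dots> = eval_mon f x * psubst f p"
    unfolding psubst_eq sum_distrib_left by (intro sum.cong refl) (rule mult.left_commute)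
  finally show ?thesis .
qed

lemma subspace_psubst_kernel: "mpoly.subspace {p. (\<forall>m\<in>keys p. keys m \<subseteq> V) \<and> psubst f p = 0}"
proof (rule mpoly.subspaceI)
  fix p q assume "p \<in> {p. (\<forall>m\<in>keys p. keys m \<subseteq> V) \<and> psubst f p = 0}"
    and "q \<in> {p. (\<forall>m\<in>keys p. keys m \<subseteq> V) \<and> psubst f p = 0}"
  moreover have "m \<in> keys p \<or> m \<in> keys q" if "m \<in> keys (p + q)" for m
    using subsetD [OF keys_add that] by simp
  ultimately show "p + q \<in> {p. (\<forall>m\<in>keys p. keys m \<subseteq> V) \<and> psubst f p = 0}"
    by (auto simp: psubst_add)
next
  fix c p assume "p \<in> {p. (\<forall>m\<in>keys p. keys m \<subseteq> V) \<and> psubst f p = 0}"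
  moreover have "m \<in> keys p" if "m \<in> keys (PConst c * p)" for m
    using subsetD [OF keys_PConst_mult that] .
  ultimately show "PConst c * p \<in> {p. (\<forall>m\<in>keys p. keys m \<subseteq> V) \<and> psubst f p = 0}"
    by (auto simp: psubst_scale)
qed simp

lemma keys_xmon_mult: "keys (mon x * p) \<subseteq> (\<lambda>m. x + m) ` keys p"
  using keys_mult [of "mon x" p] by auto

text \<open>A family of gradings is treated at once, so that one argument covers row degrees and
  column degrees.\<close>

definition homog :: "('i \<Rightarrow> 'v \<Rightarrow> nat) \<Rightarrow> ('i \<Rightarrow> nat) \<Rightarrow> 'v mpoly \<Rightarrow> bool" where
  "homog \<kappa> g p \<longleftrightarrow> (\<forall>\<mu>\<in>keys p. \<forall>i. mlin (\<kappa> i) \<mu> = g i)"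

lemma homog_one: "homog \<kappa> (\<lambda>i. 0) 1"
  by (simp add: homog_def)

lemma homog_mult: "homog \<kappa> g p \<Longrightarrow> homog \<kappa> h q \<Longrightarrow> homog \<kappa> (\<lambda>i. g i + h i) (p * q)"
  unfolding homog_def
proof (intro ballI allI)
  fix \<mu> i assume *: "\<forall>\<mu>\<in>keys p. \<forall>i. mlin (\<kappa> i) \<mu> = g i" "\<forall>\<mu>\<in>keys q. \<forall>i. mlin (\<kappa> i) \<mu> = h i"
    and "\<mu> \<in> keys (p * q)"
  then obtain \<mu>1 \<mu>2 where "\<mu>1 \<in> keys p" "\<mu>2 \<in> keys q" "\<mu> = \<mu>1 + \<mu>2"
    using keys_mult [of p q] by blast
  with * show "mlin (\<kappa> i) \<mu> = g i + h i" by (simp add: mlin_add)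
qed

lemma homog_prod:
  "finite A \<Longrightarrow> (\<And>x. x \<in> A \<Longrightarrow> homog \<kappa> (g x) (f x)) \<Longrightarrow> homog \<kappa> (\<lambda>i. \<Sum>x\<in>A. g x i) (\<Prod>x\<in>A. f x)"
proof (induction A rule: finite_induct)
  case (insert x A)
  then have "homog \<kappa> (\<lambda>i. g x i + (\<Sum>x\<in>A. g x i)) (f x * (\<Prod>x\<in>A. f x))" by (intro homog_mult) simp_all
  with insert show ?case by simp
qed (simp add: homog_one)

lemma homog_power: "homog \<kappa> g p \<Longrightarrow> homog \<kappa> (\<lambda>i. k * g i) (p ^ k)"
proof (induction k)
  case (Suc k)
  then have "homog \<kappa> (\<lambda>i. g i + k * g i) (p * p ^ k)" by (intro homog_mult)
  then show ?case by simp
qed (simp add: homog_one)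

lemma homog_sum: "(\<And>x. x \<in> A \<Longrightarrow> homog \<kappa> g (f x)) \<Longrightarrow> homog \<kappa> g (\<Sum>x\<in>A. f x)"
  unfolding homog_def using keys_sum [of f A] by blast

lemma homog_eval_mon:
  assumes "\<And>v. v \<in> keys m \<Longrightarrow> homog \<kappa> (\<lambda>i. \<delta> i v) (f v)"
  shows "homog \<kappa> (\<lambda>i. mlin (\<delta> i) m) (eval_mon f m)"
  unfolding eval_mon_def mlin_def of_nat_id
  by (intro homog_prod homog_power assms) auto

text \<open>Only source monomials of the right degree contribute to the coefficient of a given
  target monomial. In the component this coefficient is therefore either the full sum, which is 0,
  or a sum of zeros.\<close>

lemma psubst_part_zero:
  assumes zero: "psubst f p = 0" and hom: "\<And>m. m \<in> keys p \<Longrightarrow> homog \<kappa> (D m) (eval_mon f m)"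
  shows "psubst f (part (\<lambda>m. D m = d) p) = 0"
proof (rule poly_mapping_eqI)
  fix \<mu>
  have D: "D m = (\<lambda>i. mlin (\<kappa> i) \<mu>)" if "m \<in> keys p" "lookup (eval_mon f m) \<mu> \<noteq> 0" for m
    using hom [OF that(1)] that(2) by (auto simp: homog_def in_keys_iff)
  have "lookup (psubst f (part (\<lambda>m. D m = d) p)) \<mu> =
      (\<Sum>m\<in>{m \<in> keys p. D m = d}. lookup p m * lookup (eval_mon f m) \<mu>)"
    by (simp add: lookup_psubst keys_part lookup_part)
  also have "\<dots> = 0"
  proof (cases "d = (\<lambda>i. mlin (\<kappa> i) \<mu>)")
    case True
    have "(\<Sum>m\<in>{m \<in> keys p. D m = d}. lookup p m * lookup (eval_mon f m) \<mu>) =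
        (\<Sum>m\<in>keys p. lookup p m * lookup (eval_mon f m) \<mu>)"
    proof (rule sum.mono_neutral_left)
      show "\<forall>m\<in>keys p - {m \<in> keys p. D m = d}. lookup p m * lookup (eval_mon f m) \<mu> = 0"
        using D unfolding True by auto
    qed auto
    also have "\<dots> = 0" using zero by (simp flip: lookup_psubst)
    finally show ?thesis .
  next
    case False
    have "lookup (eval_mon f m) \<mu> = 0" if "m \<in> keys p" "D m = d" for m using D [OF that(1)] False that(2) by metis
    then show ?thesis by (intro sum.neutral) auto
  qed
  finally show "lookup (psubst f (part (\<lambda>m. D m = d) p)) \<mu> = lookup 0 \<mu>" by simp
qed

section \<open>Multidegrees of Pluecker monomials\<close>

definition monomials :: "nat \<Rightarrow> (nat list \<Rightarrow>\<^sub>0 nat) set" where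
  "monomials n = {m. keys m \<subseteq> plucker_vars n}"

definition vcmp :: "nat \<Rightarrow> nat list \<Rightarrow> nat list \<Rightarrow> bool" where
  "vcmp n u v \<longleftrightarrow> Jv n u \<subseteq> Jv n v \<or> Jv n v \<subseteq> Jv n u"

definition standard_monomials :: "nat \<Rightarrow> (nat list \<Rightarrow>\<^sub>0 nat) set" where
  "standard_monomials n = {m \<in> monomials n. \<forall>u\<in>keys m. \<forall>v\<in>keys m. vcmp n u v}"

lemma plucker_ring_eq: "plucker_ring n = {p. keys p \<subseteq> monomials n}"
  by (auto simp: plucker_ring_def monomials_def)

lemma PVar_eq: "PVar v = mon (Poly_Mapping.single v 1)"
  by (simp add: PVar_def)

lemma of_int_sign_eq: "(of_int (list_sign \<alpha>) :: 'v mpoly) = PConst (of_int (list_sign \<alpha>))"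
  unfolding PConst_def by simp

lemma of_int_list_sign_nonzero: "(of_int (list_sign \<alpha>) :: complex) \<noteq> 0"
  by (simp add: list_sign_def sign_def)

text \<open>\<open>Inl r\<close> counts the columns with at least \<open>r\<close> rows, \<open>Inr s\<close> the entries equal to \<open>s\<close>.\<close>

definition vdeg :: "nat + nat \<Rightarrow> nat list \<Rightarrow> nat" where
  "vdeg i v = (case i of Inl r \<Rightarrow> of_bool (1 \<le> r \<and> r \<le> length v) | Inr s \<Rightarrow> of_bool (s \<in> set v))"

definition mdeg :: "(nat list \<Rightarrow>\<^sub>0 nat) \<Rightarrow> nat + nat \<Rightarrow> nat" where
  "mdeg m = (\<lambda>i. mlin (vdeg i) m)"

text \<open>The matching gradings of the matrix entries: each term of the minor on \<open>v\<close>
  takes one factor from each row up to \<open>length v\<close> and one from each column in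
  \<open>v\<close>.\<close>

definition zdeg :: "nat + nat \<Rightarrow> nat \<times> nat \<Rightarrow> nat" where
  "zdeg i x = (case i of Inl r \<Rightarrow> of_bool (fst x = r) | Inr s \<Rightarrow> of_bool (snd x = s))"

lemma homog_PVar: "homog \<kappa> (\<lambda>i. \<kappa> i x) (PVar x)"
  by (simp add: homog_def PVar_def)

lemma homog_plucker_minor:
  assumes "distinct v"
  shows "homog zdeg (\<lambda>i. vdeg i v) (plucker_minor v)"
proof -
  define k where "k = length v"
  have "plucker_minor v = (\<Sum>\<sigma> | \<sigma> permutes {0..<k}. signof \<sigma> * (\<Prod>i = 0..<k. PVar (i + 1, v ! \<sigma> i)))"
    unfolding plucker_minor_def k_def
    by (subst det_def' [of _ "length v"]) (auto intro!: sum.cong prod.cong dest: permutes_in_image [of _ "{0..<length v}"])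
  also have "homog zdeg (\<lambda>i. vdeg i v) \<dots>"
  proof (rule homog_sum)
    fix \<sigma> assume "\<sigma> \<in> {\<sigma>. \<sigma> permutes {0..<k}}"
    then have \<sigma>: "\<sigma> permutes {0..<k}" by simp
    have "homog zdeg (\<lambda>j. \<Sum>i = 0..<k. zdeg j (i + 1, v ! \<sigma> i)) (\<Prod>i = 0..<k. PVar (i + 1, v ! \<sigma> i))"
      by (intro homog_prod homog_PVar) simp
    moreover have "(\<Sum>i = 0..<k. zdeg j (i + 1, v ! \<sigma> i)) = vdeg j v" for j
    proof (cases j)
      case (Inl r)
      \<comment> \<open>Rows are numbered from 0 in the minor; the factor
        \<open>of_bool (1 \<le> r)\<close> takes care of \<open>r = 0\<close>, where
        \<open>r - 1\<close> is truncated.\<close>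
      have "(\<Sum>i = 0..<k. of_bool (i + 1 = r) :: nat) = (\<Sum>i = 0..<k. if i = r - 1 then of_bool (1 \<le> r) else 0)"
        by (intro sum.cong) auto
      then show ?thesis by (auto simp: Inl zdeg_def vdeg_def k_def)
    next
      case (Inr s)
      have "(\<Sum>i = 0..<k. of_bool (v ! \<sigma> i = s) :: nat) = (\<Sum>i = 0..<k. of_bool (v ! i = s))"
        using sum.permute [OF \<sigma>, of "\<lambda>i. of_bool (v ! i = s) :: nat"] by (simp add: o_def)
      also have "\<dots> = of_bool (s \<in> set v)"
      proof (cases "s \<in> set v")
        case True
        then obtain i0 where i0: "i0 < k" "v ! i0 = s" by (auto simp: in_set_conv_nth k_def)
        have "(\<Sum>i = 0..<k. of_bool (v ! i = s) :: nat) = (\<Sum>i = 0..<k. if i = i0 then 1 else 0)"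
          using assms i0 by (intro sum.cong) (auto simp: nth_eq_iff_index_eq k_def)
        then show ?thesis using True i0 by simp
      next
        case False
        then show ?thesis by (auto simp: k_def)
      qed
      finally show ?thesis by (simp add: Inr zdeg_def vdeg_def)
    qed
    ultimately have "homog zdeg (\<lambda>i. vdeg i v) (\<Prod>i = 0..<k. PVar (i + 1, v ! \<sigma> i))" by simp
    then show "homog zdeg (\<lambda>i. vdeg i v) (signof \<sigma> * (\<Prod>i = 0..<k. PVar (i + 1, v ! \<sigma> i)))"
      by (cases "evenperm \<sigma>") (simp_all add: sign_def homog_def)
  qed
  finally show ?thesis .
qed

text \<open>No column is empty, so \<open>Inl 1\<close> measures the total degree and bounds every
  exponent.\<close>

lemma finite_mdeg: "finite {m \<in> monomials n. mdeg m = d}"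
proof -
  have "finite (lookup ` {m \<in> monomials n. mdeg m = d})"
  proof (rule finite_subset)
    show "finite {f. \<forall>v. (v \<in> plucker_vars n \<longrightarrow> f v \<in> {..d (Inl 1)}) \<and> (v \<notin> plucker_vars n \<longrightarrow> f v = 0)}"
      by (rule finite_set_of_finite_funs) (simp_all add: finite_plucker_vars)
    have le: "lookup m v \<le> d (Inl 1)" if m: "m \<in> monomials n" "mdeg m = d" and v: "v \<in> plucker_vars n" for m v
    proof -
      have "lookup m v * vdeg (Inl 1) v \<le> (\<Sum>v\<in>plucker_vars n. lookup m v * vdeg (Inl 1) v)"
        by (rule member_le_sum [OF v]) (simp_all add: finite_plucker_vars)
      also have "\<dots> = mdeg m (Inl 1)"
        unfolding mdeg_def using m(1)
        by (subst mlin_superset [OF finite_plucker_vars [of n]]) (simp_all add: monomials_def)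
      finally show ?thesis using v m(2) by (simp add: vdeg_def plucker_vars_def)
    qed
    have zero: "lookup m v = 0" if "m \<in> monomials n" "v \<notin> plucker_vars n" for m v
    proof -
      have "v \<notin> keys m" using that unfolding monomials_def by blast
      then show ?thesis by (simp add: in_keys_iff)
    qed
    show "lookup ` {m \<in> monomials n. mdeg m = d} \<subseteq>
      {f. \<forall>v. (v \<in> plucker_vars n \<longrightarrow> f v \<in> {..d (Inl 1)}) \<and> (v \<notin> plucker_vars n \<longrightarrow> f v = 0)}"
    proof (rule image_subsetI)
      fix m assume m: "m \<in> {m \<in> monomials n. mdeg m = d}"
      then have "\<forall>v. (v \<in> plucker_vars n \<longrightarrow> lookup m v \<in> {..d (Inl 1)}) \<and> (v \<notin> plucker_vars n \<longrightarrow> lookup m v = 0)"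
        using le [of m] zero [of m] by blast
      then show "lookup m \<in> {f. \<forall>v. (v \<in> plucker_vars n \<longrightarrow> f v \<in> {..d (Inl 1)}) \<and> (v \<notin> plucker_vars n \<longrightarrow> f v = 0)}"
        by (simp only: mem_Collect_eq)
    qed
  qed
  then show ?thesis by (rule finite_imageD) (rule inj_onI, simp add: lookup_inject)
qed

lemma plucker_ideal_eq: "plucker_ideal n = {p. (\<forall>m\<in>keys p. keys m \<subseteq> plucker_vars n) \<and> psubst plucker_minor p = 0}"
  by (auto simp: plucker_ideal_def plucker_ring_def)

lemma graded_plucker_ideal:
  assumes "p \<in> plucker_ideal n"
  shows "part (\<lambda>m. mdeg m = d) p \<in> plucker_ideal n"
proof -
  have "psubst plucker_minor (part (\<lambda>m. mdeg m = d) p) = 0"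
  proof (rule psubst_part_zero [where \<kappa> = zdeg])
    show "psubst plucker_minor p = 0" using assms by (simp add: plucker_ideal_eq)
    fix m assume "m \<in> keys p"
    then have "keys m \<subseteq> plucker_vars n" using assms by (auto simp: plucker_ideal_eq)
    then show "homog zdeg (mdeg m) (eval_mon plucker_minor m)"
      unfolding mdeg_def by (intro homog_eval_mon homog_plucker_minor) (use plucker_vars_distinct in blast)
  qed
  then show ?thesis using assms by (auto simp: plucker_ideal_eq keys_part)
qed

lemma mult_plucker_ideal:
  assumes "x \<in> monomials n" "p \<in> plucker_ideal n"
  shows "mon x * p \<in> plucker_ideal n"
proof -
  have "keys m \<subseteq> plucker_vars n" if "m \<in> keys (mon x * p)" for m
  proof -
    from that keys_xmon_mult obtain m' where "m' \<in> keys p" "m = x + m'" by blast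
    with assms show ?thesis by (simp add: plucker_ideal_eq monomials_def keys_add_nat)
  qed
  with assms show ?thesis by (simp add: plucker_ideal_eq psubst_xmon_mult)
qed

text \<open>Signs make the toric images nonzero multiples of monomials. The exponent is kept as a
  plain function because it is computed coordinate by coordinate.\<close>

definition is_term :: "('u \<Rightarrow> nat) \<Rightarrow> 'u mpoly \<Rightarrow> bool" where
  "is_term t q \<longleftrightarrow> (\<exists>c \<tau>. c \<noteq> 0 \<and> q = PConst c * mon \<tau> \<and> lookup \<tau> = t)"

lemma is_term_one: "is_term (\<lambda>_. 0) 1"
  unfolding is_term_def by (intro exI [of _ 1] exI [of _ 0]) (simp add: PConst_def fun_eq_iff)

lemma is_term_PConst: "c \<noteq> 0 \<Longrightarrow> is_term t q \<Longrightarrow> is_term t (PConst c * q)"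
proof -
  assume c: "c \<noteq> 0" and "is_term t q"
  then obtain d \<tau> where *: "d \<noteq> 0" "q = PConst d * mon \<tau>" "lookup \<tau> = t" unfolding is_term_def by blast
  have "PConst c * q = PConst (c * d) * mon \<tau>" unfolding *(2) PConst_mult mult.assoc ..
  moreover have "c * d \<noteq> 0" using c *(1) by simp
  ultimately show ?thesis unfolding is_term_def using *(3) by (intro exI conjI)
qed

lemma is_term_PVar: "is_term (\<lambda>u. of_bool (u = x)) (PVar x)"
  unfolding is_term_def
  by (intro exI [of _ 1] exI [of _ "Poly_Mapping.single x 1"])
    (auto simp: PConst_def PVar_def lookup_single when_def fun_eq_iff)

lemma is_term_mult:
  assumes "is_term t p" "is_term u q"
  shows "is_term (\<lambda>i. t i + u i) (p * q)"
proof -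
  from assms obtain c \<tau> d \<upsilon> where *: "c \<noteq> 0" "p = PConst c * mon \<tau>" "lookup \<tau> = t" "d \<noteq> 0" "q = PConst d * mon \<upsilon>" "lookup \<upsilon> = u"
    unfolding is_term_def by blast
  have "p * q = PConst (c * d) * mon (\<tau> + \<upsilon>)" by (simp add: * PConst_def mult_single)
  moreover have "lookup (\<tau> + \<upsilon>) = (\<lambda>i. t i + u i)" using * by (auto simp: lookup_add)
  ultimately show ?thesis using * unfolding is_term_def by (intro exI [of _ "c * d"] exI [of _ "\<tau> + \<upsilon>"]) simp
qed

lemma is_term_prod:
  "finite A \<Longrightarrow> (\<And>x. x \<in> A \<Longrightarrow> is_term (g x) (f x)) \<Longrightarrow> is_term (\<lambda>i. \<Sum>x\<in>A. g x i) (\<Prod>x\<in>A. f x)"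
proof (induction A rule: finite_induct)
  case (insert x A)
  then have "is_term (\<lambda>i. g x i + (\<Sum>x\<in>A. g x i)) (f x * (\<Prod>x\<in>A. f x))" by (intro is_term_mult) simp_all
  with insert show ?case by simp
qed (simp add: is_term_one)

lemma is_term_power: "is_term g p \<Longrightarrow> is_term (\<lambda>i. k * g i) (p ^ k)"
proof (induction k)
  case (Suc k)
  then have "is_term (\<lambda>i. g i + k * g i) (p * p ^ k)" by (intro is_term_mult)
  then show ?case by simp
qed (simp add: is_term_one)

lemma is_term_eval_mon:
  assumes "\<And>v. v \<in> keys m \<Longrightarrow> is_term (\<lambda>i. \<delta> i v) (f v)"
  shows "is_term (\<lambda>i. mlin (\<delta> i) m) (eval_mon f m)"
  unfolding eval_mon_def mlin_def of_nat_id
  by (intro is_term_prod is_term_power assms) auto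

lemma is_term_lookup:
  assumes "is_term t q"
  obtains c where "c \<noteq> 0" "\<And>\<mu>. lookup q \<mu> = (if lookup \<mu> = t then c else 0)"
proof -
  from assms obtain c \<tau> where *: "c \<noteq> 0" "q = PConst c * mon \<tau>" "lookup \<tau> = t" unfolding is_term_def by blast
  have "lookup q \<mu> = (if lookup \<mu> = t then c else 0)" for \<mu>
    unfolding *(2) *(3) [symmetric] lookup_PConst_mult lookup_single
    by (simp add: when_def lookup_inject eq_commute)
  with *(1) show thesis by (rule that)
qed

lemma is_term_unique:
  assumes "is_term t q" "is_term t q'"
  shows "\<exists>d. d \<noteq> 0 \<and> q = PConst d * q'"
proof -
  from assms obtain c \<tau> c' \<tau>' where *: "c \<noteq> 0" "q = PConst c * mon \<tau>" "lookup \<tau> = t"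
    "c' \<noteq> 0" "q' = PConst c' * mon \<tau>'" "lookup \<tau>' = t" unfolding is_term_def by blast
  have "\<tau>' = \<tau>" unfolding poly_mapping_eq_iff *(3,6) ..
  then have "q = PConst (c / c') * q'" unfolding *(2,5) using *(4) by (simp add: PConst_def mult_single)
  moreover have "c / c' \<noteq> 0" using *(1,4) by simp
  ultimately show ?thesis by (intro exI conjI)
qed

section \<open>The toric map and its kernel\<close>

definition kexp :: "nat \<Rightarrow> (nat \<times> nat) option \<Rightarrow> nat list \<Rightarrow> nat" where
  "kexp n q v = (case q of None \<Rightarrow> 1 | Some p \<Rightarrow> of_bool (p \<in> K_set n (Jv n v)))"

text \<open>Exponents of the toric image; the coordinate \<open>None\<close>, the exponent of
  \<open>t\<close>, is the total degree.\<close>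

definition tdeg :: "nat \<Rightarrow> (nat list \<Rightarrow>\<^sub>0 nat) \<Rightarrow> (nat \<times> nat) option \<Rightarrow> nat" where
  "tdeg n m = (\<lambda>q. mlin (kexp n q) m)"

lemma finite_K_set: "finite (K_set n J)"
  by (rule finite_subset [of _ "{1..n} \<times> {1..n}"]) (auto simp: K_set_def V_o_def V_c_def pbw_poset_def)

lemma is_term_toric_image: "is_term (\<lambda>q. kexp n q v) (toric_image n v)"
proof -
  have "is_term (\<lambda>q. of_bool (q = None) + (\<Sum>p\<in>K_set n (Jv n v). of_bool (q = Some p))) (toric_monomial n (col_of n v))"
    unfolding toric_monomial_def Jv_def by (intro is_term_mult is_term_prod is_term_PVar finite_K_set)
  moreover have "of_bool (q = None) + (\<Sum>p\<in>K_set n (Jv n v). of_bool (q = Some p)) = kexp n q v" for q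
    using finite_K_set [of n "Jv n v"] by (cases q) (auto simp: kexp_def of_bool_def)
  ultimately have "is_term (\<lambda>q. kexp n q v) (toric_monomial n (col_of n v))" by simp
  then show ?thesis
    unfolding toric_image_def of_int_sign_eq by (intro is_term_PConst of_int_list_sign_nonzero)
qed

lemma is_term_toric: "is_term (tdeg n m) (eval_mon (toric_image n) m)"
  unfolding tdeg_def by (intro is_term_eval_mon is_term_toric_image)

lemma toric_ideal_eq: "toric_ideal n = {p. (\<forall>m\<in>keys p. keys m \<subseteq> plucker_vars n) \<and> psubst (toric_image n) p = 0}"
  by (auto simp: toric_ideal_def plucker_ring_def)

text \<open>Monomials map to single terms, so the image of a term of \<open>p\<close> can cancel
  only against one with the same exponents. In particular the ideal contains no monomial.\<close>

lemma toric_ideal_partner: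
  assumes "p \<in> toric_ideal n" "m \<in> keys p"
  obtains m' where "m' \<in> keys p" "m' \<noteq> m" "tdeg n m' = tdeg n m"
proof -
  obtain c where c: "c \<noteq> 0" "\<And>\<mu>. lookup (eval_mon (toric_image n) m) \<mu> = (if lookup \<mu> = tdeg n m then c else 0)"
    using is_term_lookup [OF is_term_toric] by metis
  obtain \<tau> where \<tau>: "lookup \<tau> = tdeg n m" using is_term_toric [of n m] unfolding is_term_def by metis
  have "(\<Sum>m'\<in>keys p. lookup p m' * lookup (eval_mon (toric_image n) m') \<tau>) = 0"
    using assms(1) by (simp add: toric_ideal_eq flip: lookup_psubst)
  moreover have "(\<Sum>m'\<in>keys p. lookup p m' * lookup (eval_mon (toric_image n) m') \<tau>) =
      lookup p m * c + (\<Sum>m'\<in>keys p - {m}. lookup p m' * lookup (eval_mon (toric_image n) m') \<tau>)"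
    using assms(2) by (simp add: sum.remove c \<tau>)
  moreover have "lookup p m * c \<noteq> 0" using assms(2) c(1) by (simp add: in_keys_iff)
  ultimately have "(\<Sum>m'\<in>keys p - {m}. lookup p m' * lookup (eval_mon (toric_image n) m') \<tau>) \<noteq> 0" by auto
  then obtain m' where m': "m' \<in> keys p - {m}" "lookup (eval_mon (toric_image n) m') \<tau> \<noteq> 0"
    by (metis (no_types, lifting) mult_zero_right sum.neutral)
  obtain c' where "\<And>\<mu>. lookup (eval_mon (toric_image n) m') \<mu> = (if lookup \<mu> = tdeg n m' then c' else 0)"
    using is_term_lookup [OF is_term_toric] by metis
  with m'(2) \<tau> have "tdeg n m' = tdeg n m" by (metis)
  with m' that show thesis by blast
qed

text \<open>The scalar \<open>d\<close> absorbs the signs in \<open>toric_image\<close>.\<close>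

lemma toric_binomial:
  assumes "m \<in> monomials n" "m' \<in> monomials n" "tdeg n m = tdeg n m'"
  obtains d where "d \<noteq> 0" "mon m - PConst d * mon m' \<in> toric_ideal n"
proof -
  have "is_term (tdeg n m) (eval_mon (toric_image n) m')" using is_term_toric [of n m'] assms(3) by simp
  then obtain d where d: "d \<noteq> 0" "eval_mon (toric_image n) m = PConst d * eval_mon (toric_image n) m'"
    using is_term_unique [OF is_term_toric] by metis
  have "psubst (toric_image n) (mon m - PConst d * mon m') = 0"
    using psubst_add [of "toric_image n" "mon m - PConst d * mon m'" "PConst d * mon m'"] d
    by (simp add: psubst_scale)
  moreover have "keys \<mu> \<subseteq> plucker_vars n" if "\<mu> \<in> keys (mon m - PConst d * mon m')" for \<mu>
  proof -
    have "\<mu> = m \<or> \<mu> = m'" using that by (auto simp: in_keys_iff lookup_minus lookup_single when_def split: if_splits)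
    then show ?thesis using assms by (auto simp: monomials_def)
  qed
  ultimately have "mon m - PConst d * mon m' \<in> toric_ideal n" by (simp add: toric_ideal_eq)
  with d that show thesis by blast
qed

section \<open>The monomial ideal\<close>

lemma ideal_gen_sum:
  assumes A: "finite A" and f: "\<And>i. i \<in> A \<Longrightarrow> f i \<in> plucker_ring n" and h: "\<And>i. i \<in> A \<Longrightarrow> h i \<in> G"
  shows "(\<Sum>i\<in>A. f i * h i) \<in> ideal_gen n G"
proof -
  \<comment> \<open>\<open>ideal_gen\<close> allows one coefficient per generator, so the summands
    belonging to the same generator are collected.\<close>
  define c where "c g = (\<Sum>i\<in>{i \<in> A. h i = g}. f i)" for g
  have "(\<Sum>i\<in>A. f i * h i) = (\<Sum>g\<in>h ` A. \<Sum>i\<in>{i \<in> A. h i = g}. f i * h i)"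
    by (rule sum.image_gen [OF A])
  also have "\<dots> = (\<Sum>g\<in>h ` A. c g * g)"
    unfolding c_def sum_distrib_right by (intro sum.cong refl) simp
  finally have eq: "(\<Sum>i\<in>A. f i * h i) = (\<Sum>g\<in>h ` A. c g * g)" .
  have "c g \<in> plucker_ring n" for g
  proof -
    have "keys (c g) \<subseteq> (\<Union>i\<in>{i \<in> A. h i = g}. keys (f i))" unfolding c_def by (rule keys_sum)
    also have "\<dots> \<subseteq> monomials n" using f by (auto simp: plucker_ring_eq)
    finally show ?thesis by (simp add: plucker_ring_eq)
  qed
  then show ?thesis unfolding eq ideal_gen_def using A h by blast
qed

lemma plucker_X_eq: "plucker_X \<alpha> = PConst (of_int (list_sign \<alpha>)) * mon (Poly_Mapping.single (sort \<alpha>) 1)"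
  by (simp add: plucker_X_def of_int_sign_eq PVar_eq)

lemma term_mult: "PConst a * mon x * (PConst b * mon y) = PConst (a * b) * mon (x + y)"
  by (simp add: PConst_def mult_single)

lemma list_sign_nonzero [simp]: "list_sign \<alpha> \<noteq> 0"
  by (simp add: list_sign_def sign_def)

lemma plucker_X_mult:
  "plucker_X \<alpha> * plucker_X \<beta> =
     PConst (of_int (list_sign \<alpha>) * of_int (list_sign \<beta>)) * mon (vpair (sort \<alpha>) (sort \<beta>))"
  unfolding plucker_X_eq vpair_def by (rule term_mult)

context
  fixes n :: nat assumes n: "n \<ge> 2"
begin

lemma vcmp_sort:
  assumes "a \<in> pbw_cols n" "b \<in> pbw_cols n"
  shows "vcmp n (sort a) (sort b) \<longleftrightarrow> pbw_le a b \<or> pbw_le b a"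
  using pbw_le_col_of_iff [OF n sort_in_plucker_vars [OF assms(1)] sort_in_plucker_vars [OF assms(2)]]
    pbw_le_col_of_iff [OF n sort_in_plucker_vars [OF assms(2)] sort_in_plucker_vars [OF assms(1)]]
  by (simp add: vcmp_def col_of_sort assms)

definition gens :: "nat list mpoly set" where
  "gens = {plucker_X a * plucker_X b | a b. a \<in> pbw_cols n \<and> b \<in> pbw_cols n \<and> \<not> pbw_le a b \<and> \<not> pbw_le b a}"

lemma monomial_ideal_gens: "monomial_ideal n = ideal_gen n gens"
  by (simp add: monomial_ideal_def gens_def)

lemma keys_monomial_ideal:
  assumes "p \<in> monomial_ideal n"
  shows "keys p \<subseteq> monomials n - standard_monomials n"
proof
  fix m assume that: "m \<in> keys p"
  from assms obtain T c where p: "p = (\<Sum>g\<in>T. c g * g)" and T: "T \<subseteq> gens" "\<forall>g\<in>T. c g \<in> plucker_ring n"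
    unfolding monomial_ideal_gens ideal_gen_def by blast
  from that keys_sum [of "\<lambda>g. c g * g" T] obtain g where g: "g \<in> T" "m \<in> keys (c g * g)" unfolding p by blast
  from T g obtain a b where ab: "g = plucker_X a * plucker_X b" "a \<in> pbw_cols n" "b \<in> pbw_cols n"
    "\<not> pbw_le a b" "\<not> pbw_le b a" unfolding gens_def by blast
  have "keys g \<subseteq> {vpair (sort a) (sort b)}"
    unfolding ab(1) plucker_X_mult using keys_PConst_mult [of _ "mon (vpair (sort a) (sort b))"] by simp
  then obtain x where x: "x \<in> keys (c g)" "m = x + vpair (sort a) (sort b)"
    using g(2) keys_mult [of "c g" g] by blast
  have "x \<in> monomials n" using x(1) T(2) g(1) by (auto simp: plucker_ring_eq)
  moreover have "\<not> vcmp n (sort a) (sort b)" using ab by (simp add: vcmp_sort)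
  ultimately show "m \<in> monomials n - standard_monomials n"
    using sort_in_plucker_vars [OF ab(2)] sort_in_plucker_vars [OF ab(3)]
    by (simp add: x(2) monomials_def standard_monomials_def keys_add_nat)
qed

lemma sort_col_of: "w \<in> plucker_vars n \<Longrightarrow> sort (col_of n w) = w"
  by (rule plucker_vars_eqI [OF sort_in_plucker_vars [OF col_of_in]]) (simp_all add: set_col_of)

lemma nonstandard_multiple:
  assumes mM: "m \<in> monomials n" "m \<notin> standard_monomials n"
  shows "\<exists>f g. f \<in> plucker_ring n \<and> g \<in> gens \<and> PConst r * mon m = f * g"
proof -
    from mM obtain u v where uv: "u \<in> keys m" "v \<in> keys m" "\<not> vcmp n u v" by (auto simp: standard_monomials_def)
    have V: "u \<in> plucker_vars n" "v \<in> plucker_vars n" using uv mM by (auto simp: monomials_def)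
    have "u \<noteq> v" using uv(3) by (auto simp: vcmp_def)
    define x where "x = m - vpair u v"
    have mx: "m = x + vpair u v"
    proof (rule poly_mapping_eqI)
      fix w show "lookup m w = lookup (x + vpair u v) w"
        using uv(1,2) \<open>u \<noteq> v\<close> unfolding x_def lookup_add lookup_minus lookup_vpair in_keys_iff
        by (cases "w = u"; cases "w = v") auto
    qed
    define a b where "a = col_of n u" and "b = col_of n v"
    have sort: "sort a = u" "sort b = v" using V by (simp_all add: a_def b_def sort_col_of)
    have ab: "a \<in> pbw_cols n" "b \<in> pbw_cols n" using V by (simp_all add: a_def b_def col_of_in)
    have "plucker_X a * plucker_X b \<in> gens"
      using ab uv(3) vcmp_sort [OF ab] unfolding gens_def sort by blast
    \<comment> \<open>The product of the two signs is a unit and is divided out of the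
      cofactor.\<close>
    moreover define \<epsilon> where "\<epsilon> = (of_int (list_sign a) * of_int (list_sign b) :: complex)"
    moreover have "\<epsilon> \<noteq> 0" by (simp add: \<epsilon>_def)
    moreover have "plucker_X a * plucker_X b = PConst \<epsilon> * mon (vpair u v)" by (simp add: plucker_X_mult sort \<epsilon>_def)
    moreover have "keys (PConst (r / \<epsilon>) * mon x) \<subseteq> monomials n"
    proof -
      have "x \<in> monomials n" using mM(1) unfolding mx by (simp add: monomials_def keys_add_nat)
      then show ?thesis using keys_PConst_mult [of "r / \<epsilon>" "mon x"] by auto
    qed
    moreover have "PConst r * mon m = (PConst (r / \<epsilon>) * mon x) * (PConst \<epsilon> * mon (vpair u v))"
      unfolding term_mult mx [symmetric] using \<open>\<epsilon> \<noteq> 0\<close> by simp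
    ultimately show ?thesis
      by (intro exI [of _ "PConst (r / \<epsilon>) * mon x"] exI [of _ "plucker_X a * plucker_X b"]) (simp add: plucker_ring_eq)
  qed

lemma monomial_idealI:
  assumes "keys p \<subseteq> monomials n - standard_monomials n"
  shows "p \<in> monomial_ideal n"
proof -
  have "\<forall>m\<in>keys p. \<exists>f g. f \<in> plucker_ring n \<and> g \<in> gens \<and> PConst (lookup p m) * mon m = f * g"
    using nonstandard_multiple assms by blast
  then obtain f g where fg: "\<forall>m\<in>keys p. f m \<in> plucker_ring n \<and> g m \<in> gens \<and> PConst (lookup p m) * mon m = f m * g m"
    by metis
  have "p = (\<Sum>m\<in>keys p. PConst (lookup p m) * mon m)" by (rule mono_expand) auto
  also have "\<dots> = (\<Sum>m\<in>keys p. f m * g m)"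
    by (intro sum.cong refl) (use fg in simp)
  also have "\<dots> \<in> ideal_gen n gens" by (intro ideal_gen_sum) (use fg in auto)
  finally show ?thesis unfolding monomial_ideal_gens .
qed

lemma monomial_ideal_eq: "monomial_ideal n = {p. keys p \<subseteq> monomials n - standard_monomials n}"
  using keys_monomial_ideal monomial_idealI by blast

section \<open>Recovering a chain from its toric monomial\<close>

lemma tdeg_add: "tdeg n (m + m') = (\<lambda>q. tdeg n m q + tdeg n m' q)"
  by (simp add: tdeg_def mlin_add)

lemma ex_top:
  assumes "m \<in> standard_monomials n" "m \<noteq> 0"
  obtains v where "v \<in> keys m" "\<And>u. u \<in> keys m \<Longrightarrow> Jv n u \<subseteq> Jv n v"
proof -
  have ne: "Jv n ` keys m \<noteq> {}" "finite (Jv n ` keys m)" using assms(2) by auto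
  then obtain J where J: "J \<in> Jv n ` keys m" "\<forall>J'\<in>Jv n ` keys m. J \<subseteq> J' \<longrightarrow> J' = J"
    using finite_has_maximal [OF ne(2,1)] by metis
  then obtain v where v: "v \<in> keys m" "J = Jv n v" by blast
  have "Jv n u \<subseteq> Jv n v" if "u \<in> keys m" for u
  proof -
    have "vcmp n u v" using assms(1) that v by (simp add: standard_monomials_def)
    then show ?thesis using J(2) that v(2) unfolding vcmp_def by blast
  qed
  with v that show thesis by blast
qed

text \<open>Every maximal cell, diagonal or not, belongs to \<open>K_set\<close>, so the support of
  the toric exponents generates the union of the ideals.\<close>

lemma union_tdeg:
  assumes "m \<in> monomials n"
  shows "(\<Union>u\<in>keys m. Jv n u) = {p \<in> pbw_poset n. \<exists>q. tdeg n m (Some q) \<noteq> 0 \<and> P_le p q}"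
proof -
  have pos: "tdeg n m (Some q) \<noteq> 0 \<longleftrightarrow> (\<exists>u\<in>keys m. q \<in> K_set n (Jv n u))" for q
    by (auto simp: tdeg_def mlin_def kexp_def in_keys_iff)
  have oi: "Jv n u \<in> order_ideals n" if "u \<in> keys m" for u
    using Jv_ideal [OF n] that assms by (auto simp: monomials_def)
  show ?thesis
  proof (intro equalityI subsetI)
    fix p assume "p \<in> (\<Union>u\<in>keys m. Jv n u)"
    then obtain u where u: "u \<in> keys m" "p \<in> Jv n u" by blast
    then obtain q where q: "q \<in> max_elems (Jv n u)" "P_le p q" using ideal_max_above [OF oi] by metis
    then have "q \<in> pbw_poset n" using order_ideal_subset [OF oi [OF u(1)]] by (auto simp: max_elems_def)
    then have "q \<in> K_set n (Jv n u)" using q(1)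
      by (cases q) (auto simp: K_set_def V_o_def V_c_def in_pbw_poset max_elems_def)
    then show "p \<in> {p \<in> pbw_poset n. \<exists>q. tdeg n m (Some q) \<noteq> 0 \<and> P_le p q}"
      using u q(2) pos order_ideal_subset [OF oi [OF u(1)]] by blast
  next
    fix p assume "p \<in> {p \<in> pbw_poset n. \<exists>q. tdeg n m (Some q) \<noteq> 0 \<and> P_le p q}"
    then obtain q u where q: "p \<in> pbw_poset n" "P_le p q" "u \<in> keys m" "q \<in> K_set n (Jv n u)" unfolding pos by blast
    have "q \<in> Jv n u" using q(4) by (auto simp: K_set_def max_elems_def)
    then have "p \<in> Jv n u" by (rule order_idealD [OF oi [OF q(3)] _ q(1,2)])
    with q(3) show "p \<in> (\<Union>u\<in>keys m. Jv n u)" by blast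
  qed
qed

text \<open>The largest ideal of a chain is the union of all of them, which
  \<open>union_tdeg\<close> reads off the toric exponents. Removing its variable lowers the exponent
  of \<open>t\<close> by one, and the induction goes on.\<close>

lemma tdeg_inj:
  assumes "m \<in> standard_monomials n" "m' \<in> standard_monomials n" "tdeg n m = tdeg n m'"
  shows "m = m'"
  using assms
proof (induction "tdeg n m None" arbitrary: m m')
  case 0
  have zero: "x = 0" if "tdeg n x None = 0" for x :: "nat list \<Rightarrow>\<^sub>0 nat"
  proof -
    have "\<forall>v\<in>keys x. lookup x v = 0" using that by (simp add: tdeg_def mlin_def kexp_def)
    then show ?thesis by (intro poly_mapping_eqI) (metis in_keys_iff lookup_zero)
  qed
  have t: "tdeg n m None = 0" "tdeg n m' None = 0"
    using "0.hyps" fun_cong [OF "0.prems"(3), of None] by simp_all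
  show ?case using zero [OF t(1)] zero [OF t(2)] by simp
next
  case (Suc k)
  have ne: "m \<noteq> 0" "m' \<noteq> 0" using Suc.hyps(2) fun_cong [OF Suc.prems(3), of None] by (auto simp: tdeg_def)
  obtain v where v: "v \<in> keys m" "\<And>u. u \<in> keys m \<Longrightarrow> Jv n u \<subseteq> Jv n v" using ex_top [OF Suc.prems(1) ne(1)] by metis
  obtain v' where v': "v' \<in> keys m'" "\<And>u. u \<in> keys m' \<Longrightarrow> Jv n u \<subseteq> Jv n v'" using ex_top [OF Suc.prems(2) ne(2)] by metis
  have M: "m \<in> monomials n" "m' \<in> monomials n" using Suc.prems by (simp_all add: standard_monomials_def)
  have "Jv n v = (\<Union>u\<in>keys m. Jv n u)" using v by blast
  also have "\<dots> = (\<Union>u\<in>keys m'. Jv n u)" unfolding union_tdeg [OF M(1)] union_tdeg [OF M(2)] Suc.prems(3) ..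
  also have "\<dots> = Jv n v'" using v' by blast
  finally have "Jv n v = Jv n v'" .
  moreover have "v \<in> plucker_vars n" "v' \<in> plucker_vars n" using v(1) v'(1) M by (auto simp: monomials_def)
  ultimately have "v = v'" using Jv_inj [OF n] by blast
  define s where "s = Poly_Mapping.single v (1::nat)"
  have split: "x = s + (x - s)" if "v \<in> keys x" for x :: "nat list \<Rightarrow>\<^sub>0 nat"
    using that by (intro poly_mapping_eqI) (auto simp: s_def lookup_add lookup_minus lookup_single when_def in_keys_iff)
  have std: "x - s \<in> standard_monomials n" if "x \<in> standard_monomials n" for x
  proof -
    have "keys (x - s) \<subseteq> keys x" by (auto simp: in_keys_iff lookup_minus)
    with that show ?thesis unfolding standard_monomials_def monomials_def by blast
  qed
  have m: "s + (m - s) = m" using split [OF v(1)] by (rule sym)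
  have m': "s + (m' - s) = m'" using split [of m'] v'(1) unfolding \<open>v = v'\<close> by (metis (lifting))
  have eq: "tdeg n s q + tdeg n (m - s) q = tdeg n s q + tdeg n (m' - s) q" for q
    using fun_cong [OF tdeg_add, of s "m - s" q] fun_cong [OF tdeg_add, of s "m' - s" q] Suc.prems(3)
    unfolding m m' by metis
  have "tdeg n s None = 1" by (simp add: s_def tdeg_def kexp_def)
  moreover have "tdeg n m None = tdeg n s None + tdeg n (m - s) None" using fun_cong [OF tdeg_add, of s "m - s" None] unfolding m .
  ultimately have "k = tdeg n (m - s) None" using Suc.hyps(2) by simp
  then have "m - s = m' - s" by (rule Suc.hyps(1)) (use std Suc.prems eq in \<open>auto simp: fun_eq_iff\<close>)
  then have "s + (m - s) = s + (m' - s)" by (rule arg_cong)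
  then show ?case unfolding m m' .
qed

end

section \<open>Facets of polyhedral cones\<close>

text \<open>A subfamily of least cardinality is irredundant, and positivity at \<open>w0\<close>
  makes \<open>A\<close> full-dimensional. For the last claim a point in the relative interior of
  the facet is taken: an inequality from all of \<open>G\<close> that is tight there is tight on the
  whole hyperplane spanned by the facet.\<close>

lemma facet_halfspaces:
  fixes G :: "'a::euclidean_space set"
  assumes fin: "finite G" and w0: "\<And>g. g \<in> G \<Longrightarrow> 0 < inner g w0" and A: "A = {x. \<forall>g\<in>G. 0 \<le> inner g x}"
  obtains G' where "G' \<subseteq> G" "A = {x. \<forall>g\<in>G'. 0 \<le> inner g x}"
    "\<And>F. F facet_of A \<longleftrightarrow> (\<exists>g\<in>G'. F = A \<inter> {x. inner g x = 0})"
    "\<And>g. g \<in> G' \<Longrightarrow> \<exists>w\<in>A. inner g w = 0 \<and> (\<forall>h\<in>G. inner h w = 0 \<longrightarrow> (\<exists>l>0. h = l *\<^sub>R g))"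
proof -
  define P where "P G' \<longleftrightarrow> G' \<subseteq> G \<and> A = {x. \<forall>g\<in>G'. 0 \<le> inner g x}" for G'
  have "P G" by (simp add: P_def A)
  then have "\<exists>G'. P G' \<and> (\<forall>G''. P G'' \<longrightarrow> card G' \<le> card G'')" by (rule ex_has_least_nat)
  then obtain G' where G': "P G'" and min: "\<And>G''. P G'' \<Longrightarrow> card G' \<le> card G''" by blast
  have sub: "G' \<subseteq> G" and A': "A = {x. \<forall>g\<in>G'. 0 \<le> inner g x}" using G' by (auto simp: P_def)
  have fin': "finite G'" using sub fin finite_subset by blast
  have drop: "A \<noteq> {x. \<forall>g\<in>G''. 0 \<le> inner g x}" if "G'' \<subset> G'" for G''
  proof
    assume "A = {x. \<forall>g\<in>G''. 0 \<le> inner g x}"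
    then have "P G''" using that sub by (auto simp: P_def)
    from min [OF this] psubset_card_mono [OF fin' that] show False by simp
  qed
  \<comment> \<open>\<open>facet_of_polyhedron_explicit\<close> is indexed by halfspaces and not by
    normals; irredundancy excludes that two normals give the same halfspace.\<close>
  define hs where "hs g = {x. inner (- g) x \<le> (0::real)}" for g :: 'a
  have inj: "inj_on hs G'"
  proof (rule inj_onI, rule ccontr)
    fix g h assume gh: "g \<in> G'" "h \<in> G'" "hs g = hs h" "g \<noteq> h"
    have "x \<in> hs g \<longleftrightarrow> x \<in> hs h" for x by (simp add: gh(3))
    then have "0 \<le> inner g x \<longleftrightarrow> 0 \<le> inner h x" for x by (simp add: hs_def)
    then have "A = {x. \<forall>g\<in>G' - {g}. 0 \<le> inner g x}" unfolding A' using gh by (intro Collect_cong) auto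
    with drop [of "G' - {g}"] gh(1) show False by blast
  qed
  define a where "a h = - inv_into G' hs h" for h
  have a: "a (hs g) = - g" if "g \<in> G'" for g using inv_into_f_f [OF inj that] by (simp add: a_def)
  have A_hs: "{x. \<forall>g\<in>G''. 0 \<le> inner g x} = \<Inter> (hs ` G'')" for G'' by (auto simp: hs_def)
  have hull: "affine hull A = UNIV"
  proof (rule affine_hull_nonempty_interior)
    have "open (\<Inter>g\<in>G. {x. 0 < inner g x})" using fin by (intro open_INT) (auto intro: open_halfspace_gt)
    moreover have "(\<Inter>g\<in>G. {x. 0 < inner g x}) \<subseteq> A" unfolding A by (auto intro: less_imp_le)
    moreover have "w0 \<in> (\<Inter>g\<in>G. {x. 0 < inner g x})" using w0 by blast
    ultimately show "interior A \<noteq> {}" using interior_maximal by blast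
  qed
  have facets: "F facet_of A \<longleftrightarrow> (\<exists>g\<in>G'. F = A \<inter> {x. inner g x = 0})" for F
  proof -
    have "F facet_of A \<longleftrightarrow> (\<exists>h. h \<in> hs ` G' \<and> F = A \<inter> {x. inner (a h) x = 0})"
    proof (rule facet_of_polyhedron_explicit)
      show "finite (hs ` G')" using fin' by simp
      show "A = affine hull A \<inter> \<Inter> (hs ` G')" unfolding hull using A' A_hs [of G'] by simp
      show "a h \<noteq> 0 \<and> h = {x. inner (a h) x \<le> 0}" if h: "h \<in> hs ` G'" for h
      proof -
        from h obtain g where g: "g \<in> G'" "h = hs g" by blast
        then have "g \<noteq> 0" using w0 [of g] sub by auto
        with g show ?thesis by (simp add: a) (simp add: hs_def)
      qed
      show "A \<subset> affine hull A \<inter> \<Inter> F'" if F': "F' \<subset> hs ` G'" for F'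
      proof -
        define G'' where "G'' = {g \<in> G'. hs g \<in> F'}"
        have "F' = hs ` G''" using F' by (auto simp: G''_def)
        then have "G'' \<subset> G'" using F' by (auto simp: G''_def)
        have "\<Inter> F' = {x. \<forall>g\<in>G''. 0 \<le> inner g x}" using A_hs [of G''] \<open>F' = hs ` G''\<close> by simp
        moreover have "A \<subseteq> {x. \<forall>g\<in>G''. 0 \<le> inner g x}" unfolding A' using \<open>G'' \<subset> G'\<close> by blast
        ultimately show ?thesis unfolding hull using drop [OF \<open>G'' \<subset> G'\<close>] by auto
      qed
    qed
    also have "\<dots> \<longleftrightarrow> (\<exists>g\<in>G'. F = A \<inter> {x. inner (a (hs g)) x = 0})" by blast
    also have "\<dots> \<longleftrightarrow> (\<exists>g\<in>G'. F = A \<inter> {x. inner g x = 0})"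
      by (intro bex_cong refl) (simp add: a)
    finally show ?thesis .
  qed
  have "\<exists>w\<in>A. inner g w = 0 \<and> (\<forall>h\<in>G. inner h w = 0 \<longrightarrow> (\<exists>l>0. h = l *\<^sub>R g))" if g: "g \<in> G'" for g
  proof -
    define F where "F = A \<inter> {x. inner g x = 0}"
    have F: "F facet_of A" using facets g F_def by blast
    then have "convex F" "F \<noteq> {}" "F face_of A" using face_of_imp_convex by (auto simp: facet_of_def)
    then obtain w where w: "w \<in> rel_interior F" using rel_interior_eq_empty by blast
    then have wF: "w \<in> F" using rel_interior_subset by blast
    have g0: "0 < inner g w0" using w0 g sub by blast
    then have "g \<noteq> 0" by auto
    have hullF: "affine hull F = {x. inner g x = 0}"
    proof (rule affine_dim_equal)
      show "affine hull F \<noteq> {}" using \<open>F \<noteq> {}\<close> by simp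
      show "affine hull F \<subseteq> {x. inner g x = 0}"
        by (rule hull_minimal) (auto simp: F_def affine_hyperplane)
      have "aff_dim A = int DIM('a)" by (metis hull aff_dim_affine_hull aff_dim_UNIV)
      then show "aff_dim (affine hull F) = aff_dim {x. inner g x = 0}"
        using F \<open>g \<noteq> 0\<close> by (simp add: facet_of_def)
    qed (simp_all add: affine_hyperplane)
    have "\<exists>l>0. h = l *\<^sub>R g" if h: "h \<in> G" "inner h w = 0" for h
    proof -
      have "(F \<inter> {x. inner h x = 0}) face_of F"
        by (rule face_of_Int_supporting_hyperplane_ge [OF \<open>convex F\<close>]) (use h in \<open>auto simp: F_def A\<close>)
      moreover have "(F \<inter> {x. inner h x = 0}) \<inter> rel_interior F \<noteq> {}" using w wF h by blast
      ultimately have "F \<subseteq> F \<inter> {x. inner h x = 0}" by (rule subset_of_face_of [OF _ subset_refl])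
      then have "affine hull F \<subseteq> {x. inner h x = 0}"
        by (intro hull_minimal) (auto simp: affine_hyperplane)
      then have *: "inner h x = 0" if "inner g x = 0" for x using that unfolding hullF by blast
      \<comment> \<open>\<open>h\<close> vanishes on the hyperplane of \<open>g\<close>; the values
        at \<open>w0\<close>, both positive, determine the factor.\<close>
      define l where "l = inner h w0 / inner g w0"
      have "inner (h - l *\<^sub>R g) y = 0" for y
      proof -
        have "inner g (y - (inner g y / inner g w0) *\<^sub>R w0) = 0" using g0 by (simp add: inner_diff_right)
        from * [OF this] show ?thesis by (simp add: inner_diff_right inner_diff_left l_def)
      qed
      then have "h - l *\<^sub>R g = 0" by (metis inner_eq_zero_iff)
      moreover have "0 < l" using g0 w0 [OF h(1)] by (simp add: l_def)
      ultimately show ?thesis by (intro exI [of _ l]) simp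
    qed
    moreover have "w \<in> A" "inner g w = 0" using wF by (auto simp: F_def)
    ultimately show ?thesis by blast
  qed
  with sub A' facets that show thesis by blast
qed

text \<open>Subtracting \<open>inner g x *\<^sub>R v\<close> projects \<open>S\<close> into the
  face, so \<open>S\<close> lies in the span of the face and \<open>v\<close>, and the dimension
  drops by at most one; \<open>w1\<close> shows that it does drop.\<close>

lemma facet_by_projection:
  fixes S :: "'a::euclidean_space set"
  assumes "convex S" "0 \<in> S" and pos: "\<And>x. x \<in> S \<Longrightarrow> 0 \<le> inner g x"
    and w1: "w1 \<in> S" "0 < inner g w1"
    and v: "\<And>x. x \<in> S \<Longrightarrow> x - inner g x *\<^sub>R v \<in> S" "inner g v = 1"
  shows "(S \<inter> {x. inner g x = 0}) facet_of S"
proof -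
  define F where "F = S \<inter> {x. inner g x = 0}"
  have face: "F face_of S"
    unfolding F_def by (rule face_of_Int_supporting_hyperplane_ge [OF assms(1) pos])
  have F0: "0 \<in> F" using assms(2) by (simp add: F_def)
  have "w1 \<notin> F" using w1 by (simp add: F_def)
  then have "F \<noteq> S" using w1 by blast
  then have lt: "aff_dim F < aff_dim S" by (rule face_of_aff_dim_lt [OF assms(1) face])
  have "S \<subseteq> span (insert v F)"
  proof
    fix x assume x: "x \<in> S"
    have "x - inner g x *\<^sub>R v \<in> F" using v x by (simp add: F_def inner_diff_right)
    then have "(x - inner g x *\<^sub>R v) + inner g x *\<^sub>R v \<in> span (insert v F)"
      by (intro span_add span_scale) (auto intro: span_base)
    then show "x \<in> span (insert v F)" by simp
  qed
  then have "dim S \<le> dim (insert v F)" by (metis dim_span dim_subset)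
  also have "\<dots> \<le> dim F + 1" by (simp add: dim_insert)
  finally have "aff_dim S \<le> aff_dim F + 1"
    using F0 assms(2) by (simp add: aff_dim_zero hull_inc)
  with lt have "aff_dim F = aff_dim S - 1" by simp
  with face F0 show ?thesis unfolding facet_of_def F_def [symmetric] by blast
qed

lemma closure_ray:
  fixes w u :: "'a::real_normed_vector"
  assumes "\<And>\<epsilon>. 0 < \<epsilon> \<Longrightarrow> w + \<epsilon> *\<^sub>R u \<in> S"
  shows "w \<in> closure S"
  unfolding closure_approachable
proof (intro allI impI)
  fix d :: real assume "0 < d"
  define \<epsilon> where "\<epsilon> = d / (norm u + 1) / 2"
  have n: "0 < norm u + 1" by (simp add: add_nonneg_pos)
  then have "0 < \<epsilon>" using \<open>0 < d\<close> by (simp add: \<epsilon>_def)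
  have "\<epsilon> * norm u < \<epsilon> * ((norm u + 1) * 2)"
    by (rule mult_strict_left_mono [OF _ \<open>0 < \<epsilon>\<close>]) (simp add: algebra_simps add_nonneg_pos)
  also have "\<dots> = d" unfolding \<epsilon>_def using n by (simp only: divide_divide_eq_left times_divide_eq_left, simp)
  finally have "dist (w + \<epsilon> *\<^sub>R u) w < d" using \<open>0 < \<epsilon>\<close> by (simp add: dist_norm)
  with assms [OF \<open>0 < \<epsilon>\<close>] show "\<exists>y\<in>S. dist y w < d" by blast
qed

section \<open>The two cones\<close>

locale plucker_cones =
  fixes n :: nat and e :: "'b::finite \<Rightarrow> nat list" and w0 :: "real ^ 'b"
  assumes n: "n \<ge> 2" and bij: "bij_betw e UNIV (pbw_cols n)"
    and w0: "w0 \<in> cone_C n e (plucker_ideal n) (monomial_ideal n)"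
begin

definition idx :: "nat list \<Rightarrow> 'b" where
  "idx v = inv_into UNIV e (col_of n v)"

definition wt :: "real ^ 'b \<Rightarrow> (nat list \<Rightarrow>\<^sub>0 nat) \<Rightarrow> real" where
  "wt W m = mlin (\<lambda>v. vec_nth W (idx v)) m"

definition exp_vec :: "(nat list \<Rightarrow>\<^sub>0 nat) \<Rightarrow> real ^ 'b" where
  "exp_vec m = (\<Sum>v\<in>keys m. real (lookup m v) *\<^sub>R axis (idx v) 1)"

lemma e_idx: "v \<in> plucker_vars n \<Longrightarrow> e (idx v) = col_of n v"
  unfolding idx_def using bij col_of_in by (auto simp: bij_betw_def intro: f_inv_into_f)

lemma idx_inj: "u \<in> plucker_vars n \<Longrightarrow> v \<in> plucker_vars n \<Longrightarrow> idx u = idx v \<Longrightarrow> u = v"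
  using e_idx col_of_inj unfolding inj_on_def by metis

lemma weight_eq: "weight n (\<lambda>\<alpha>. vec_nth W (inv_into UNIV e \<alpha>)) = wt W"
  by (rule ext) (simp add: weight_def wt_def mlin_def idx_def)

lemma in_cone_iff: "W \<in> cone_C n e I J \<longleftrightarrow> mpoly.span (init_form (wt W) ` I) = J"
  by (simp add: cone_C_def initial_ideal_def initial_part_eq weight_eq)

lemma wt_add: "wt W (m + m') = wt W m + wt W m'"
  by (simp add: wt_def mlin_add)

lemma wt_inner: "wt W m = inner (exp_vec m) W"
  unfolding wt_def mlin_def exp_vec_def inner_sum_left by (intro sum.cong refl) (simp add: inner_axis' )

lemma exp_vec_nth:
  assumes "m \<in> monomials n" "v \<in> plucker_vars n"
  shows "vec_nth (exp_vec m) (idx v) = real (lookup m v)"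
proof -
  have "vec_nth (exp_vec m) (idx v) = (\<Sum>u\<in>keys m. if u = v then real (lookup m u) else 0)"
    unfolding exp_vec_def sum_component
  proof (intro sum.cong refl)
    fix u assume "u \<in> keys m"
    then have "u \<in> plucker_vars n" using assms(1) by (auto simp: monomials_def)
    then have "idx u = idx v \<longleftrightarrow> u = v" using idx_inj assms(2) by blast
    then show "vec_nth (real (lookup m u) *\<^sub>R axis (idx u) 1) (idx v) = (if u = v then real (lookup m u) else 0)"
      by (auto simp: axis_def)
  qed
  also have "\<dots> = real (lookup m v)" by (simp add: in_keys_iff)
  finally show ?thesis .
qed

lemma wt_linear: "wt (W + c *\<^sub>R W') m = wt W m + c * wt W' m"
  by (simp add: wt_inner inner_add_right)

sublocale chain_degeneration "monomials n" "standard_monomials n" "plucker_ideal n" mdeg "wt w0" "plucker_vars n" "vcmp n"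
proof unfold_locales
  show "standard_monomials n \<subseteq> monomials n" by (auto simp: standard_monomials_def)
  show "mpoly.subspace (plucker_ideal n)" unfolding plucker_ideal_eq by (rule subspace_psubst_kernel)
  show "keys p \<subseteq> monomials n" if "p \<in> plucker_ideal n" for p
    using that by (auto simp: plucker_ideal_eq monomials_def)
  show "finite {m \<in> monomials n. mdeg m = d}" for d by (rule finite_mdeg)
  show "part (\<lambda>m. mdeg m = d) p \<in> plucker_ideal n" if "p \<in> plucker_ideal n" for p d
    using that by (rule graded_plucker_ideal)
  show "mpoly.span (init_form (wt w0) ` plucker_ideal n) = {p. keys p \<subseteq> monomials n - standard_monomials n}"
    using w0 by (simp add: in_cone_iff monomial_ideal_eq [OF n])
  show "monomials n = {m. keys m \<subseteq> plucker_vars n}" by (rule monomials_def)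
  show "standard_monomials n = {m \<in> monomials n. \<forall>u\<in>keys m. \<forall>v\<in>keys m. vcmp n u v}" by (rule standard_monomials_def)
  show "vcmp n v v" for v by (simp add: vcmp_def)
  show "mon x * p \<in> plucker_ideal n" if "x \<in> monomials n" "p \<in> plucker_ideal n" for x p
    using that by (rule mult_plucker_ideal)
  show "mdeg (x + m) = mdeg (x + m')" if "mdeg m = mdeg m'" for x m m'
    using fun_cong [OF that] by (intro ext) (simp add: mdeg_def mlin_add)
  show "wt w0 (m + m') = wt w0 m + wt w0 m'" for m m' by (rule wt_add)
qed

section \<open>The closures of the two cones\<close>

definition A :: "(real ^ 'b) set" where
  "A = {W. monotone_weight (wt W)}"

text \<open>The weights that factor through the toric exponents.\<close>

definition L :: "(real ^ 'b) set" where
  "L = {W. \<forall>m\<in>monomials n. \<forall>m'\<in>monomials n. tdeg n m = tdeg n m' \<longrightarrow> wt W m = wt W m'}"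

lemma A_D: "W \<in> A \<Longrightarrow> m \<in> monomials n \<Longrightarrow> m' \<in> keys (NF m) \<Longrightarrow> wt W m \<le> wt W m'"
  by (simp add: A_def monotone_weight_def)

lemma L_D: "W \<in> L \<Longrightarrow> m \<in> monomials n \<Longrightarrow> m' \<in> monomials n \<Longrightarrow> tdeg n m = tdeg n m' \<Longrightarrow> wt W m = wt W m'"
  unfolding L_def by blast

lemma NF_in_M: "m \<in> monomials n \<Longrightarrow> m' \<in> keys (NF m) \<Longrightarrow> m' \<in> monomials n"
  using keys_NF S_sub by blast

lemma closed_A: "closed A"
proof -
  have "A = (\<Inter>m\<in>monomials n. \<Inter>m'\<in>keys (NF m). {W. inner (exp_vec m) W \<le> inner (exp_vec m') W})"
    by (auto simp: A_def monotone_weight_def wt_inner)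
  then show ?thesis by (auto intro!: closed_INT closed_Collect_le continuous_intros)
qed

lemma closed_L: "closed L"
proof -
  have "L = (\<Inter>m\<in>monomials n. \<Inter>m'\<in>{m' \<in> monomials n. tdeg n m = tdeg n m'}. {W. inner (exp_vec m) W = inner (exp_vec m') W})"
    by (auto simp: L_def wt_inner)
  then show ?thesis by (auto intro!: closed_INT closed_Collect_eq continuous_intros)
qed

lemma A_cone: "W \<in> A \<Longrightarrow> W' \<in> A \<Longrightarrow> 0 \<le> c \<Longrightarrow> W + c *\<^sub>R W' \<in> A"
  by (auto simp: A_def monotone_weight_def wt_linear intro!: add_mono mult_left_mono)

lemma monomial_cone_subset_A: "cone_C n e (plucker_ideal n) (monomial_ideal n) \<subseteq> A"
proof
  fix W assume "W \<in> cone_C n e (plucker_ideal n) (monomial_ideal n)"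
  then have span: "mpoly.span (init_form (wt W) ` plucker_ideal n) = {p. keys p \<subseteq> monomials n - standard_monomials n}"
    by (simp add: in_cone_iff monomial_ideal_eq [OF n])
  have "monotone_weight (wt W)"
  proof (rule monotone_weight_if_standard_free)
    fix q assume "q \<in> mpoly.span (init_form (wt W) ` plucker_ideal n)" "keys q \<subseteq> standard_monomials n"
    then have "keys q = {}" unfolding span by blast
    then show "q = 0" by simp
  qed
  then show "W \<in> A" by (simp add: A_def)
qed

lemma w0_A: "w0 \<in> A"
  using w0 monomial_cone_subset_A by blast

text \<open>The ties of \<open>W + \<epsilon> *\<^sub>R U\<close> are exactly those of
  \<open>U\<close>: both defects are nonnegative, and ties of \<open>U\<close> are ties of
  \<open>W\<close> by hypothesis. By \<open>span_ini_eq\<close> the open ray from \<open>W\<close>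
  in direction \<open>U\<close> lies in the cone.\<close>

lemma ray_cone:
  assumes W: "W \<in> A" and U: "U \<in> A" "U \<in> cone_C n e (plucker_ideal n) J"
    and tie: "\<And>m m'. m \<in> monomials n \<Longrightarrow> m' \<in> keys (NF m) \<Longrightarrow> wt U m' = wt U m \<Longrightarrow> wt W m' = wt W m"
  shows "W \<in> closure (cone_C n e (plucker_ideal n) J)"
proof (rule closure_ray)
  fix \<epsilon> :: real assume "0 < \<epsilon>"
  have "mpoly.span (init_form (wt (W + \<epsilon> *\<^sub>R U)) ` plucker_ideal n) = mpoly.span (init_form (wt U) ` plucker_ideal n)"
  proof (rule span_ini_eq)
    show "monotone_weight (wt (W + \<epsilon> *\<^sub>R U))" "monotone_weight (wt U)"
      using A_cone [OF W U(1), of \<epsilon>] U(1) \<open>0 < \<epsilon>\<close> by (simp_all add: A_def)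
    fix m m' assume m: "m \<in> monomials n" "m' \<in> keys (NF m)"
    have le: "wt W m \<le> wt W m'" "wt U m \<le> wt U m'" using A_D W U(1) m by blast+
    show "wt (W + \<epsilon> *\<^sub>R U) m' = wt (W + \<epsilon> *\<^sub>R U) m \<longleftrightarrow> wt U m' = wt U m"
    proof
      assume "wt U m' = wt U m"
      then show "wt (W + \<epsilon> *\<^sub>R U) m' = wt (W + \<epsilon> *\<^sub>R U) m" using tie [OF m] by (simp add: wt_linear)
    next
      assume "wt (W + \<epsilon> *\<^sub>R U) m' = wt (W + \<epsilon> *\<^sub>R U) m"
      then have "(wt W m' - wt W m) + \<epsilon> * (wt U m' - wt U m) = 0" by (simp add: wt_linear algebra_simps)
      moreover have "0 \<le> wt W m' - wt W m" "0 \<le> \<epsilon> * (wt U m' - wt U m)" using le \<open>0 < \<epsilon>\<close> by simp_all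
      ultimately have "\<epsilon> * (wt U m' - wt U m) = 0" by linarith
      then show "wt U m' = wt U m" using \<open>0 < \<epsilon>\<close> by simp
    qed
  qed
  then show "W + \<epsilon> *\<^sub>R U \<in> cone_C n e (plucker_ideal n) J" using U(2) by (simp add: in_cone_iff)
qed

lemma closure_monomial_cone: "closure (cone_C n e (plucker_ideal n) (monomial_ideal n)) = A"
proof (intro equalityI subsetI)
  fix W assume "W \<in> closure (cone_C n e (plucker_ideal n) (monomial_ideal n))"
  then show "W \<in> A" using closure_minimal [OF monomial_cone_subset_A closed_A] by blast
next
  fix W assume W: "W \<in> A"
  show "W \<in> closure (cone_C n e (plucker_ideal n) (monomial_ideal n))"
  proof (rule ray_cone [OF W w0_A w0])
    \<comment> \<open>\<open>w0\<close> has a tie only if \<open>m\<close> is standard, and then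
      \<open>NF m\<close> is \<open>m\<close> itself.\<close>
    fix m m' assume m: "m \<in> monomials n" "m' \<in> keys (NF m)" "wt w0 m' = wt w0 m"
    then have "m \<in> standard_monomials n" using NF_weight by force
    then show "wt W m' = wt W m" using NF_standard [OF m(1)] m(2) by simp
  qed
qed

lemma toric_standard_free:
  assumes "q \<in> toric_ideal n" "keys q \<subseteq> standard_monomials n"
  shows "q = 0"
proof (rule ccontr)
  assume "q \<noteq> 0"
  then obtain m where m: "m \<in> keys q" by (metis all_not_in_conv keys_eq_empty)
  then obtain m' where "m' \<in> keys q" "m' \<noteq> m" "tdeg n m' = tdeg n m" using toric_ideal_partner [OF assms(1)] by metis
  with m assms(2) tdeg_inj [OF n] show False by blast
qed

lemma toric_cone_subset: "cone_C n e (plucker_ideal n) (toric_ideal n) \<subseteq> A \<inter> L"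
proof
  fix W assume "W \<in> cone_C n e (plucker_ideal n) (toric_ideal n)"
  then have span: "mpoly.span (init_form (wt W) ` plucker_ideal n) = toric_ideal n" by (simp add: in_cone_iff)
  have "monotone_weight (wt W)"
    by (rule monotone_weight_if_standard_free) (use toric_standard_free in \<open>simp add: span\<close>)
  then have "W \<in> A" by (simp add: A_def)
  have tie: "wt W m = wt W m'" if m: "m \<in> monomials n" "m' \<in> monomials n" "tdeg n m = tdeg n m'" for m m'
  proof (rule ccontr)
    assume ne: "wt W m \<noteq> wt W m'"
    \<comment> \<open>If the weights differed, a weight component of this binomial would be a
      monomial in the toric ideal.\<close>
    obtain d where "mon m - PConst d * mon m' \<in> toric_ideal n" using toric_binomial [OF m] by metis
    then have "part (\<lambda>\<mu>. wt W \<mu> = wt W m) (mon m - PConst d * mon m') \<in> toric_ideal n"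
      using part_in_span_ini [OF subspace_I, of _ "wt W" "wt W m"] by (simp add: span)
    moreover have "part (\<lambda>\<mu>. wt W \<mu> = wt W m) (mon m - PConst d * mon m') = mon m"
      by (rule poly_mapping_eqI) (use ne in \<open>auto simp: lookup_part lookup_minus lookup_single when_def\<close>)
    ultimately have "mon m \<in> toric_ideal n" by simp
    from toric_ideal_partner [OF this, of m] show False by auto
  qed
  have "W \<in> L" unfolding L_def mem_Collect_eq by (intro ballI impI) (rule tie)
  with \<open>W \<in> A\<close> show "W \<in> A \<inter> L" by simp
qed

text \<open>The part of \<open>mon m - NF m\<close> of the weight of \<open>m\<close> lies in the
  toric ideal, so \<open>m'\<close> has a partner in it with equal toric exponents. If this is not
  \<open>m\<close>, it is a second standard monomial, against \<open>tdeg_inj\<close>.\<close>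

lemma toric_cone_tie:
  assumes W: "W \<in> cone_C n e (plucker_ideal n) (toric_ideal n)"
    and m: "m \<in> monomials n" "m' \<in> keys (NF m)" "wt W m' = wt W m"
  shows "tdeg n m' = tdeg n m"
proof (rule ccontr)
  assume ne: "tdeg n m' \<noteq> tdeg n m"
  then have "m' \<noteq> m" by auto
  have mono: "monotone_weight (wt W)" using W toric_cone_subset by (auto simp: A_def)
  have span: "mpoly.span (init_form (wt W) ` plucker_ideal n) = toric_ideal n" using W by (simp add: in_cone_iff)
  have "part (\<lambda>\<mu>. wt W \<mu> = wt W m) (mon m - NF m) \<in> toric_ideal n" (is "?q \<in> _")
    using part_NF [OF mono m(1)] unfolding span .
  moreover have "m' \<in> keys ?q" using m \<open>m' \<noteq> m\<close> by (simp add: in_keys_iff lookup_part lookup_minus lookup_single)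
  ultimately obtain m'' where m'': "m'' \<in> keys ?q" "m'' \<noteq> m'" "tdeg n m'' = tdeg n m'"
    using toric_ideal_partner by metis
  have "m'' \<noteq> m" using m''(3) ne by auto
  then have "m'' \<in> keys (NF m)" using m''(1) by (auto simp: in_keys_iff lookup_part lookup_minus lookup_single split: if_splits)
  then have "m'' = m'" using tdeg_inj [OF n _ _ m''(3)] keys_NF [OF m(1)] m(2) by blast
  with m''(2) show False ..
qed

lemma closure_toric_cone:
  assumes "U \<in> cone_C n e (plucker_ideal n) (toric_ideal n)"
  shows "closure (cone_C n e (plucker_ideal n) (toric_ideal n)) = A \<inter> L"
proof (intro equalityI subsetI)
  fix W assume "W \<in> closure (cone_C n e (plucker_ideal n) (toric_ideal n))"
  then show "W \<in> A \<inter> L"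
    using closure_minimal [OF toric_cone_subset closed_Int [OF closed_A closed_L]] by blast
next
  fix W assume W: "W \<in> A \<inter> L"
  show "W \<in> closure (cone_C n e (plucker_ideal n) (toric_ideal n))"
  proof (rule ray_cone [OF _ _ assms])
    fix m m' assume m: "m \<in> monomials n" "m' \<in> keys (NF m)" "wt U m' = wt U m"
    show "wt W m' = wt W m"
      using L_D [OF _ NF_in_M [OF m(1,2)] m(1) toric_cone_tie [OF assms m]] W by blast
  qed (use W assms toric_cone_subset in blast)+
qed

end

section \<open>Quadratic relations and their toric differences\<close>

lemma quadratic_monomial:
  assumes m: "m \<in> monomials n" and deg: "mdeg m (Inl 1) = 2"
  obtains c d where "c \<in> plucker_vars n" "d \<in> plucker_vars n" "m = vpair c d"
proof -
  have one: "mdeg x (Inl 1) = (\<Sum>v\<in>keys x. lookup x v)" if "x \<in> monomials n" for x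
    unfolding mdeg_def mlin_def of_nat_id
    by (intro sum.cong refl) (use that in \<open>auto simp: vdeg_def monomials_def plucker_vars_def\<close>)
  have split: "\<exists>c x'. c \<in> plucker_vars n \<and> x' \<in> monomials n \<and> x = Poly_Mapping.single c 1 + x' \<and> mdeg x' (Inl 1) + 1 = mdeg x (Inl 1)"
    if x: "x \<in> monomials n" and pos: "mdeg x (Inl 1) \<noteq> 0" for x
  proof -
    have "keys x \<noteq> {}" using pos one [OF x] by auto
    then obtain c where c: "c \<in> keys x" by blast
    then have cV: "c \<in> plucker_vars n" using x by (auto simp: monomials_def)
    define x' where "x' = x - Poly_Mapping.single c 1"
    have xx: "x = Poly_Mapping.single c 1 + x'"
      using c by (intro poly_mapping_eqI) (auto simp: x'_def lookup_add lookup_minus lookup_single when_def in_keys_iff)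
    have "keys x' \<subseteq> keys x" by (auto simp: x'_def in_keys_iff lookup_minus)
    then have "x' \<in> monomials n" using x by (auto simp: monomials_def)
    moreover have "mdeg x (Inl 1) = 1 + mdeg x' (Inl 1)"
      unfolding mdeg_def using cV arg_cong [OF xx, of "mlin (vdeg (Inl 1))"]
      by (simp add: mlin_add vdeg_def plucker_vars_def)
    ultimately show ?thesis using cV xx by (intro exI [of _ c] exI [of _ x']) simp
  qed
  obtain c x1 where c: "c \<in> plucker_vars n" "x1 \<in> monomials n" "m = Poly_Mapping.single c 1 + x1" "mdeg x1 (Inl 1) + 1 = 2"
    using split [OF m] deg by auto
  obtain d x2 where d: "d \<in> plucker_vars n" "x2 \<in> monomials n" "x1 = Poly_Mapping.single d 1 + x2" "mdeg x2 (Inl 1) + 1 = 1"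
    using split [OF c(2)] c(4) by auto
  have "\<forall>v\<in>keys x2. lookup x2 v = 0" using one [OF d(2)] d(4) by simp
  then have "x2 = 0" by (intro poly_mapping_eqI) (metis in_keys_iff lookup_zero)
  then have "m = vpair c d" unfolding c(3) d(3) vpair_def by simp
  with c d that show thesis by blast
qed

text \<open>The length degrees give the vanishing on the diagonal; subtracting them from the content
  degrees leaves the balance of row and column sums, by \<open>content_K\<close>.\<close>

lemma content_balanced_kdiff:
  assumes n: "n \<ge> 2" and V: "a \<in> plucker_vars n" "b \<in> plucker_vars n" "c \<in> plucker_vars n" "d \<in> plucker_vars n"
    and deg: "mdeg (vpair c d) = mdeg (vpair a b)"
  shows "content_balanced n (kdiff n (Jv n a) (Jv n b) (Jv n c) (Jv n d))"
proof -
  let ?k = "kdiff n (Jv n a) (Jv n b) (Jv n c) (Jv n d)"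
  have deg': "vdeg i c + vdeg i d = vdeg i a + vdeg i b" for i
    using fun_cong [OF deg, of i] by (simp add: mdeg_def)
  have diag: "?k (r, r) = 0" for r
  proof (cases "2 \<le> r")
    case True
    have "of_bool ((r, r) \<in> K_set n (Jv n v)) = int (vdeg (Inl r) v)" if "v \<in> plucker_vars n" for v
      using length_iff_K [OF n that, of r] True by (simp add: vdeg_def)
    then show ?thesis using V arg_cong [OF deg' [of "Inl r"], of int] by (simp add: kdiff_def)
  next
    case False
    have "(r, r) \<notin> K_set n J" for J
      using False by (auto simp: K_set_def V_o_def V_c_def)
    then show ?thesis by (simp add: kdiff_def)
  qed
  have "(\<Sum>r\<in>{1..<s}. ?k (r, s)) = (\<Sum>t\<in>{s<..n}. ?k (s, t))" if s: "s \<in> {1..n}" for s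
  proof -
    define R where "R v = (\<Sum>r\<in>{1..<s}. of_bool ((r, s) \<in> K_set n (Jv n v)) :: int)" for v
    define T where "T v = (\<Sum>t\<in>{s<..n}. of_bool ((s, t) \<in> K_set n (Jv n v)) :: int)" for v
    have "int (vdeg (Inr s) v) = int (vdeg (Inl s) v) + R v - T v" if "v \<in> plucker_vars n" for v
      using content_K [OF n that, of s] s by (simp add: vdeg_def R_def T_def)
    then have "R c + R d - R a - R b = T c + T d - T a - T b"
      using V arg_cong [OF deg' [of "Inl s"], of int] arg_cong [OF deg' [of "Inr s"], of int] by simp
    then show ?thesis by (simp add: kdiff_def R_def T_def sum.distrib sum_subtractf)
  qed
  with diag show ?thesis by (simp add: content_balanced_def)
qed

context plucker_cones
begin

text \<open>Every unordered pair occurs in both orders with the same \<open>tvec\<close>, so the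
  S-pair obstruction can be used for \<open>a\<close> and for \<open>b\<close>.\<close>

definition rels :: "(nat list \<times> nat list \<times> (nat list \<Rightarrow>\<^sub>0 nat)) set" where
  "rels = {(a, b, m'). a \<in> plucker_vars n \<and> b \<in> plucker_vars n \<and> \<not> vcmp n a b \<and> m' \<in> keys (NF (vpair a b))}"

definition tvec :: "(nat list \<times> nat list \<times> (nat list \<Rightarrow>\<^sub>0 nat)) \<Rightarrow> real ^ 'b" where
  "tvec = (\<lambda>(a, b, m'). exp_vec m' - exp_vec (vpair a b))"

text \<open>This determines \<open>tvec\<close> on \<open>L\<close>, see \<open>tvec_on_L\<close>.
  The coordinate \<open>None\<close> is left out since relations preserve the degree.\<close>

definition tdiff :: "(nat list \<times> nat list \<times> (nat list \<Rightarrow>\<^sub>0 nat)) \<Rightarrow> (nat \<times> nat) \<Rightarrow> int" where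
  "tdiff = (\<lambda>(a, b, m') p. int (tdeg n m' (Some p)) - int (tdeg n (vpair a b) (Some p)))"

lemma finite_rels: "finite rels"
proof -
  have "rels \<subseteq> (\<Union>a\<in>plucker_vars n. \<Union>b\<in>plucker_vars n. (\<lambda>m'. (a, b, m')) ` keys (NF (vpair a b)))"
    by (auto simp: rels_def)
  then show ?thesis by (rule finite_subset) (simp add: finite_plucker_vars)
qed

lemma inner_tvec: "inner (tvec (a, b, m')) W = wt W m' - wt W (vpair a b)"
  by (simp add: tvec_def wt_inner inner_diff_left)

lemma relsD:
  assumes "(a, b, m') \<in> rels"
  shows "a \<in> plucker_vars n" "b \<in> plucker_vars n" "\<not> vcmp n a b" "m' \<in> keys (NF (vpair a b))"
    and "vpair a b \<in> monomials n" "vpair a b \<notin> standard_monomials n" "m' \<in> standard_monomials n" "m' \<in> monomials n"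
    and "mdeg m' = mdeg (vpair a b)" "a \<noteq> b"
proof -
  show *: "a \<in> plucker_vars n" "b \<in> plucker_vars n" "\<not> vcmp n a b" "m' \<in> keys (NF (vpair a b))"
    using assms by (simp_all add: rels_def)
  then show M: "vpair a b \<in> monomials n" "vpair a b \<notin> standard_monomials n"
    by (auto simp: monomials_def standard_monomials_def)
  show "m' \<in> standard_monomials n" "m' \<in> monomials n" using keys_NF [OF M(1)] NF_in_M [OF M(1)] *(4) by auto
  show "mdeg m' = mdeg (vpair a b)" by (rule NF_D [OF M(1) *(4)])
  show "a \<noteq> b" using *(3) by (auto simp: vcmp_def)
qed

lemma rels_w0: "r \<in> rels \<Longrightarrow> 0 < inner (tvec r) w0"
  using NF_weight relsD by (cases r) (auto simp: inner_tvec)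

lemma A_rels: "A = {W. \<forall>g\<in>tvec ` rels. 0 \<le> inner g W}"
proof (intro equalityI subsetI)
  fix W assume "W \<in> A"
  then show "W \<in> {W. \<forall>g\<in>tvec ` rels. 0 \<le> inner g W}"
    using A_D relsD(4,5) by (auto simp: inner_tvec)
next
  fix W assume W: "W \<in> {W. \<forall>g\<in>tvec ` rels. 0 \<le> inner g W}"
  have "monotone_weight (wt W)"
  proof (rule monotone_weightI [OF wt_add])
    fix a b m' assume "a \<in> plucker_vars n" "b \<in> plucker_vars n" "\<not> vcmp n a b" "m' \<in> keys (NF (vpair a b))"
    then have "(a, b, m') \<in> rels" by (simp add: rels_def)
    with W have "0 \<le> inner (tvec (a, b, m')) W" by blast
    then show "wt W (vpair a b) \<le> wt W m'" by (simp add: inner_tvec)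
  qed
  then show "W \<in> A" by (simp add: A_def)
qed

text \<open>Variables are determined by their degrees. If source and target shared a variable, the
  other two factors would therefore agree as well, and the standard target would be the nonstandard
  source.\<close>

lemma rel_target:
  assumes r: "(a, b, m') \<in> rels"
  obtains c d where "c \<in> plucker_vars n" "d \<in> plucker_vars n" "m' = vpair c d" "Jv n c \<subseteq> Jv n d"
    "a \<noteq> c" "a \<noteq> d" "b \<noteq> c" "b \<noteq> d"
proof -
  note r' = relsD [OF r]
  have "mdeg m' (Inl 1) = 2" unfolding r'(9) using r'(1,2) by (simp add: mdeg_def vdeg_def plucker_vars_def)
  then obtain c d where cd: "c \<in> plucker_vars n" "d \<in> plucker_vars n" "m' = vpair c d"
    using quadratic_monomial [OF r'(8)] by metis
  have deg: "vdeg i c + vdeg i d = vdeg i a + vdeg i b" for i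
    using fun_cong [OF r'(9), of i] by (simp add: mdeg_def cd)
  have eq: "u = v" if "\<And>i. vdeg i u = vdeg i v" "u \<in> plucker_vars n" "v \<in> plucker_vars n" for u v
  proof (rule plucker_vars_eqI [OF that(2,3)])
    have "s \<in> set u \<longleftrightarrow> s \<in> set v" for s 
      using that(1) [of "Inr s"] by (cases "s \<in> set u"; cases "s \<in> set v") (simp_all add: vdeg_def)
    then show "set u = set v" by blast
  qed
  have ne: "vpair a b \<noteq> vpair c d" using r'(6,7) cd(3) by metis
  have "a \<noteq> c"
  proof
    assume "a = c"
    then have "b = d" using deg by (intro eq r'(2) cd(2)) simp
    with \<open>a = c\<close> ne show False by simp
  qed
  moreover have "a \<noteq> d"
  proof
    assume "a = d"
    then have "b = c" using deg by (intro eq r'(2) cd(1)) (simp add: add.commute)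
    with \<open>a = d\<close> ne show False by (simp add: vpair_commute)
  qed
  moreover have "b \<noteq> c"
  proof
    assume "b = c"
    then have "a = d" using deg by (intro eq r'(1) cd(2)) (simp add: add.commute)
    with \<open>b = c\<close> ne show False by (simp add: vpair_commute)
  qed
  moreover have "b \<noteq> d"
  proof
    assume "b = d"
    then have "a = c" using deg by (intro eq r'(1) cd(1)) simp
    with \<open>b = d\<close> ne show False by simp
  qed
  moreover have "vcmp n c d" using r'(7) cd by (simp add: standard_monomials_def)
  ultimately show thesis
    using that [of c d] that [of d c] cd unfolding vcmp_def by (metis vpair_commute)
qed

text \<open>Source and target share no variable, so the negative coordinates of a
  \<open>tvec\<close> are exactly -1 at the two variables of the source. This forces
  \<open>l = 1\<close>, and the targets can then be compared.\<close>

lemma tvec_proportional: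
  assumes r: "(a, b, m') \<in> rels" and r2: "(a2, b2, m2) \<in> rels" and l: "0 < l"
    and eq: "tvec (a, b, m') = l *\<^sub>R tvec (a2, b2, m2)"
  shows "vpair a b = vpair a2 b2 \<and> m' = m2"
proof -
  note r' = relsD [OF r] and r2' = relsD [OF r2]
  have comp: "real (lookup m' v) - real (lookup (vpair a b) v) = l * (real (lookup m2 v) - real (lookup (vpair a2 b2) v))"
    if "v \<in> plucker_vars n" for v
    using arg_cong [OF eq, of "\<lambda>x. vec_nth x (idx v)"] that r'(5,8) r2'(5,8)
    by (simp add: tvec_def exp_vec_nth)
  obtain c d where cd: "m' = vpair c d" "a \<noteq> c" "a \<noteq> d" "b \<noteq> c" "b \<noteq> d" using rel_target [OF r] by metis
  obtain c2 d2 where cd2: "m2 = vpair c2 d2" "a2 \<noteq> c2" "a2 \<noteq> d2" "b2 \<noteq> c2" "b2 \<noteq> d2" using rel_target [OF r2] by metis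
  have mem: "v \<in> {a2, b2} \<and> l = 1" if v: "v \<in> {a, b}" for v
  proof -
    have "lookup m' v = 0" "lookup (vpair a b) v = 1" using v cd r'(10) by (auto simp: lookup_vpair)
    then have "l * (real (lookup m2 v) - real (lookup (vpair a2 b2) v)) = -1" using comp [of v] v r'(1,2) by auto
    moreover from this have v2: "v \<in> {a2, b2}"
      using l by (cases "v \<in> {a2, b2}") (auto simp: lookup_vpair zero_less_mult_iff mult_less_0_iff dest: arg_cong [of _ "-1" "\<lambda>x. x < 0"])
    moreover have "lookup m2 v = 0" "lookup (vpair a2 b2) v = 1" using v2 cd2 r2'(10) by (auto simp: lookup_vpair)
    ultimately show ?thesis by simp
  qed
  have ab: "vpair a b = vpair a2 b2"
    using mem [of a] mem [of b] r'(10) by (auto simp: vpair_commute)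
  have "m' = m2"
  proof (rule poly_mapping_eqI)
    fix v
    show "lookup m' v = lookup m2 v"
    proof (cases "v \<in> plucker_vars n")
      case True
      then show ?thesis using comp [OF True] mem [of a] ab by simp
    next
      case False
      then have "v \<notin> keys m'" "v \<notin> keys m2" using r'(8) r2'(8) by (auto simp: monomials_def)
      then show ?thesis by (simp add: in_keys_iff)
    qed
  qed
  with ab show ?thesis by simp
qed

text \<open>At a general point of a facet the tied relations are known only to be proportional;
  \<open>tvec_proportional\<close> turns this into the single tie that
  \<open>s_pair_obstruction\<close> requires.\<close>

lemma facet_obstruction:
  assumes r: "(a, b, m') \<in> rels" and W: "W \<in> A" and tie: "inner (tvec (a, b, m')) W = 0"
    and only: "\<And>h. h \<in> tvec ` rels \<Longrightarrow> inner h W = 0 \<Longrightarrow> \<exists>l>0. h = l *\<^sub>R tvec (a, b, m')"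
    and x: "x \<in> plucker_vars n" "\<not> vcmp n x a" "x \<noteq> b"
  shows "Poly_Mapping.single x 1 + m' \<notin> standard_monomials n"
proof (rule s_pair_obstruction [OF _ wt_add relsD(1-4) [OF r] _ _ x])
  show "monotone_weight (wt W)" using W by (simp add: A_def)
  show "wt W m' = wt W (vpair a b)" using tie by (simp add: inner_tvec)
  fix a' b' m'' assume r': "a' \<in> plucker_vars n" "b' \<in> plucker_vars n" "\<not> vcmp n a' b'" "m'' \<in> keys (NF (vpair a' b'))"
    and ne: "(vpair a' b', m'') \<noteq> (vpair a b, m')"
  have r2: "(a', b', m'') \<in> rels" using r' by (simp add: rels_def)
  have "wt W (vpair a' b') \<le> wt W m''" using A_D [OF W relsD(5,4) [OF r2]] .
  moreover have "wt W (vpair a' b') \<noteq> wt W m''"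
  proof
    assume "wt W (vpair a' b') = wt W m''"
    then have "inner (tvec (a', b', m'')) W = 0" by (simp add: inner_tvec)
    then obtain l where "0 < l" "tvec (a', b', m'') = l *\<^sub>R tvec (a, b, m')" using only r2 by blast
    from tvec_proportional [OF r2 r this] ne show False by simp
  qed
  ultimately show "wt W (vpair a' b') < wt W m''" by simp
qed

lemma facet_classification:
  assumes r: "(a, b, m') \<in> rels" and W: "W \<in> A" and tie: "inner (tvec (a, b, m')) W = 0"
    and only: "\<And>h. h \<in> tvec ` rels \<Longrightarrow> inner h W = 0 \<Longrightarrow> \<exists>l>0. h = l *\<^sub>R tvec (a, b, m')"
  shows "(\<forall>p. tdiff (a, b, m') p = 0) \<or>
    (\<exists>i j. 1 \<le> i \<and> i < j \<and> j < n \<and> (\<forall>p. tdiff (a, b, m') p = elem_pattern i j p))"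
proof -
  note r' = relsD [OF r]
  obtain c d where cd: "c \<in> plucker_vars n" "d \<in> plucker_vars n" "m' = vpair c d" "Jv n c \<subseteq> Jv n d"
    and ne: "a \<noteq> c" "a \<noteq> d" "b \<noteq> c" "b \<noteq> d" using rel_target [OF r] by metis
  have tdiff: "tdiff (a, b, m') = kdiff n (Jv n a) (Jv n b) (Jv n c) (Jv n d)"
    by (rule ext) (simp add: tdiff_def kdiff_def cd(3) tdeg_def kexp_def)
  have r2: "(b, a, m') \<in> rels" using r by (auto simp: rels_def vcmp_def vpair_commute)
  have tvec2: "tvec (b, a, m') = tvec (a, b, m')" by (simp add: tvec_def vpair_commute)
  \<comment> \<open>\<open>x\<close>, \<open>c\<close>, \<open>d\<close> form a chain, so their
    product is standard and the obstruction applies contrapositively. As every order ideal is some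
    \<open>Jv n x\<close>, this supplies the hypothesis \<open>H\<close> of
    \<open>kdiff_classification\<close>.\<close>
  have obstr: "vcmp n x a \<or> x = b" "vcmp n x b \<or> x = a"
    if x: "x \<in> plucker_vars n" "vcmp n x c" "vcmp n x d" for x
  proof -
    have "vcmp n c d" using cd(4) by (simp add: vcmp_def)
    then have "Poly_Mapping.single x 1 + m' \<in> standard_monomials n"
      using x cd by (auto simp: standard_monomials_def monomials_def keys_add_nat vcmp_def)
    then show "vcmp n x a \<or> x = b" "vcmp n x b \<or> x = a"
      using facet_obstruction [OF r W tie only x(1)]
        facet_obstruction [OF r2 W tie [folded tvec2] only [folded tvec2] x(1)] by blast+
  qed
  show ?thesis unfolding tdiff
  proof (rule kdiff_classification)
    show "Jv n a \<in> order_ideals n" "Jv n b \<in> order_ideals n" "Jv n c \<in> order_ideals n" "Jv n d \<in> order_ideals n"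
      using Jv_ideal [OF n] r' cd by blast+
    show "\<not> Jv n a \<subseteq> Jv n b" "\<not> Jv n b \<subseteq> Jv n a" using r'(3) by (simp_all add: vcmp_def)
    show "Jv n c \<subseteq> Jv n d" by (rule cd(4))
    show "Jv n c \<noteq> Jv n a" "Jv n c \<noteq> Jv n b" "Jv n d \<noteq> Jv n a" "Jv n d \<noteq> Jv n b"
      using ne Jv_inj [OF n] r'(1,2) cd(1,2) by metis+
    show "content_balanced n (kdiff n (Jv n a) (Jv n b) (Jv n c) (Jv n d))"
      by (rule content_balanced_kdiff [OF n r'(1,2) cd(1,2)]) (use r'(9) cd(3) in simp)
    fix J assume J: "J \<in> order_ideals n" and cmpJ: "(J \<subseteq> Jv n c \<or> Jv n c \<subseteq> J) \<and> (J \<subseteq> Jv n d \<or> Jv n d \<subseteq> J)"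
    obtain x where x: "x \<in> plucker_vars n" "Jv n x = J" using Jv_surj [OF n J] by metis
    have "vcmp n x c" "vcmp n x d" using cmpJ x(2) by (simp_all add: vcmp_def)
    from obstr [OF x(1) this] show "(J \<subseteq> Jv n a \<or> Jv n a \<subseteq> J \<or> J = Jv n b) \<and> (J \<subseteq> Jv n b \<or> Jv n b \<subseteq> J \<or> J = Jv n a)"
      using x(2) unfolding vcmp_def by blast
  qed
qed

text \<open>Weights dual to the functionals that the facets induce on \<open>L\<close>.\<close>

definition dual_coeff :: "nat \<Rightarrow> nat \<Rightarrow> nat \<times> nat \<Rightarrow> real" where
  "dual_coeff i j p = of_bool (i < fst p \<and> fst p \<le> j \<and> j < snd p)"

definition dual :: "nat \<Rightarrow> nat \<Rightarrow> real ^ 'b" where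
  "dual i j = (\<chi> k. \<Sum>p\<in>pbw_poset n. dual_coeff i j p * of_bool (p \<in> K_set n (Jv n (sort (e k)))))"

lemma wt_dual:
  assumes "m \<in> monomials n"
  shows "wt (dual i j) m = (\<Sum>p\<in>pbw_poset n. dual_coeff i j p * real (tdeg n m (Some p)))"
proof -
  have "wt (dual i j) m = (\<Sum>v\<in>keys m. real (lookup m v) * (\<Sum>p\<in>pbw_poset n. dual_coeff i j p * of_bool (p \<in> K_set n (Jv n v))))"
    unfolding wt_def mlin_def
  proof (intro sum.cong refl)
    fix v assume "v \<in> keys m"
    then have v: "v \<in> plucker_vars n" using assms by (auto simp: monomials_def)
    show "real (lookup m v) * vec_nth (dual i j) (idx v) =
        real (lookup m v) * (\<Sum>p\<in>pbw_poset n. dual_coeff i j p * of_bool (p \<in> K_set n (Jv n v)))"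
      by (simp add: dual_def e_idx [OF v] sort_col_of [OF n v])
  qed
  also have "\<dots> = (\<Sum>p\<in>pbw_poset n. \<Sum>v\<in>keys m. real (lookup m v) * (dual_coeff i j p * of_bool (p \<in> K_set n (Jv n v))))"
    unfolding sum_distrib_left by (rule sum.swap)
  also have "\<dots> = (\<Sum>p\<in>pbw_poset n. dual_coeff i j p * real (tdeg n m (Some p)))"
  proof (intro sum.cong refl)
    fix p
    have "real (tdeg n m (Some p)) = (\<Sum>v\<in>keys m. real (lookup m v) * of_bool (p \<in> K_set n (Jv n v)))"
      by (simp add: tdeg_def mlin_def kexp_def)
    then show "(\<Sum>v\<in>keys m. real (lookup m v) * (dual_coeff i j p * of_bool (p \<in> K_set n (Jv n v)))) =
        dual_coeff i j p * real (tdeg n m (Some p))"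
      by (simp only: sum_distrib_left) (intro sum.cong refl, simp add: mult.left_commute)
  qed
  finally show ?thesis .
qed

lemma dual_L: "dual i j \<in> L"
  unfolding L_def mem_Collect_eq
proof (intro ballI impI)
  fix m m' assume "m \<in> monomials n" "m' \<in> monomials n" "tdeg n m = tdeg n m'"
  then show "wt (dual i j) m = wt (dual i j) m'" by (simp only: wt_dual)
qed

lemma tvec_dual:
  assumes r: "(a, b, m') \<in> rels"
  shows "inner (tvec (a, b, m')) (dual i j) = (\<Sum>p\<in>pbw_poset n. dual_coeff i j p * real_of_int (tdiff (a, b, m') p))"
  unfolding inner_tvec wt_dual [OF relsD(5) [OF r]] wt_dual [OF relsD(8) [OF r]] sum_subtractf [symmetric]
  by (intro sum.cong refl) (simp add: tdiff_def right_diff_distrib)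

text \<open>\<open>dual_coeff i j\<close> is the product of the indicator of the rows from
  \<open>i + 1\<close> to \<open>j\<close> and the indicator of the columns beyond \<open>j\<close>,
  so its mixed difference at \<open>(i', j')\<close> is a product of two single differences. The
  second one requires \<open>j' = j\<close>; the first is then 1 for \<open>i' = i\<close> and -1
  only for \<open>i' = j\<close>, which \<open>i' < j'\<close> excludes. The diagonal cell omitted
  from the pattern does not matter, since the coefficient vanishes on the diagonal.\<close>

lemma dual_pattern:
  assumes ij: "1 \<le> i'" "i' < j'" "j' < n"
  shows "(\<Sum>p\<in>pbw_poset n. dual_coeff i j p * real_of_int (elem_pattern i' j' p)) = of_bool (i = i' \<and> j = j')"
proof -
  have pt: "(\<Sum>p\<in>pbw_poset n. dual_coeff i j p * of_bool (p = q \<and> Q)) = dual_coeff i j q * of_bool Q"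
    if "Q \<Longrightarrow> q \<in> pbw_poset n" for q Q
  proof (cases Q)
    case True
    then have "(\<Sum>p\<in>pbw_poset n. dual_coeff i j p * of_bool (p = q \<and> Q)) = (\<Sum>p\<in>pbw_poset n. if p = q then dual_coeff i j p else 0)"
      by (intro sum.cong refl) simp
    with True that show ?thesis by (simp add: finite_pbw_poset)
  qed simp
  have mem: "(i', j') \<in> pbw_poset n" "(Suc i', Suc j') \<in> pbw_poset n" "(i', Suc j') \<in> pbw_poset n"
    "Suc i' < j' \<Longrightarrow> (Suc i', j') \<in> pbw_poset n" using ij by (auto simp: in_pbw_poset)
  have "(\<Sum>p\<in>pbw_poset n. dual_coeff i j p * real_of_int (elem_pattern i' j' p)) =
      (\<Sum>p\<in>pbw_poset n. dual_coeff i j p * of_bool (p = (i', j') \<and> True)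
        + dual_coeff i j p * of_bool (p = (Suc i', Suc j') \<and> True) - dual_coeff i j p * of_bool (p = (i', Suc j') \<and> True)
        - dual_coeff i j p * of_bool (p = (Suc i', j') \<and> Suc i' < j'))"
    by (intro sum.cong refl) (simp add: elem_pattern_def algebra_simps)
  also have "\<dots> = dual_coeff i j (i', j') + dual_coeff i j (Suc i', Suc j') - dual_coeff i j (i', Suc j')
      - dual_coeff i j (Suc i', j') * of_bool (Suc i' < j')"
    unfolding sum_subtractf sum.distrib 
    using pt [of True "(i', j')"] pt [of True "(Suc i', Suc j')"] pt [of True "(i', Suc j')"]
      pt [of "Suc i' < j'" "(Suc i', j')"] mem by simp
  also have "\<dots> = of_bool (i = i' \<and> j = j')"
    using ij by (auto simp: dual_coeff_def of_bool_def)
  finally show ?thesis .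
qed

lemma tdeg_None_rel:
  assumes "(a, b, m') \<in> rels"
  shows "tdeg n m' None = tdeg n (vpair a b) None"
proof -
  obtain c d where "m' = vpair c d" using rel_target [OF assms] by metis
  then show ?thesis by (simp add: tdeg_def kexp_def)
qed

text \<open>Elements of \<open>L\<close> are governed by equalities between monomials, so the two
  differences are compared after adding the opposite sources.\<close>

lemma tvec_on_L:
  assumes r: "(a, b, m') \<in> rels" "(a2, b2, m2) \<in> rels" and eq: "\<And>p. tdiff (a, b, m') p = tdiff (a2, b2, m2) p" and W: "W \<in> L"
  shows "inner (tvec (a, b, m')) W = inner (tvec (a2, b2, m2)) W"
proof -
  note r' = relsD [OF r(1)] and r2' = relsD [OF r(2)]
  have "tdeg n (m' + vpair a2 b2) q = tdeg n (m2 + vpair a b) q" for q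
  proof (cases q)
    case None
    then show ?thesis using tdeg_None_rel [OF r(1)] tdeg_None_rel [OF r(2)] by (simp add: tdeg_add [OF n])
  next
    case (Some p)
    have "int (tdeg n m' (Some p) + tdeg n (vpair a2 b2) (Some p)) = int (tdeg n m2 (Some p) + tdeg n (vpair a b) (Some p))"
      using eq [of p] by (simp add: tdiff_def)
    then show ?thesis unfolding Some tdeg_add [OF n] of_nat_eq_iff .
  qed
  then have "wt W (m' + vpair a2 b2) = wt W (m2 + vpair a b)"
    by (intro L_D [OF W] M_add r' r2' ext)
  then show ?thesis by (simp add: inner_tvec wt_add)
qed

lemma tvec_on_L_zero:
  assumes r: "(a, b, m') \<in> rels" and eq: "\<And>p. tdiff (a, b, m') p = 0" and W: "W \<in> L"
  shows "inner (tvec (a, b, m')) W = 0"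
proof -
  have "tdeg n m' q = tdeg n (vpair a b) q" for q
    using tdeg_None_rel [OF r] eq by (cases q) (simp_all add: tdiff_def)
  then have "wt W m' = wt W (vpair a b)" by (intro L_D [OF W] relsD [OF r] ext)
  then show ?thesis by (simp add: inner_tvec)
qed

lemma L_linear: "W \<in> L \<Longrightarrow> W' \<in> L \<Longrightarrow> W + c *\<^sub>R W' \<in> L"
  unfolding L_def mem_Collect_eq wt_linear by metis

lemma convex_AL: "convex (A \<inter> L)"
proof (rule convexI)
  fix W W' and u v :: real assume W: "W \<in> A \<inter> L" "W' \<in> A \<inter> L" "0 \<le> u" "0 \<le> v" "u + v = 1"
  have wt: "wt (u *\<^sub>R W + v *\<^sub>R W') m = u * wt W m + v * wt W' m" for m
    by (simp add: wt_inner inner_add_right)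
  have "u *\<^sub>R W + v *\<^sub>R W' \<in> A"
    using W by (auto simp: A_def monotone_weight_def wt intro!: add_mono mult_left_mono)
  moreover have "u *\<^sub>R W + v *\<^sub>R W' \<in> L"
    using W unfolding L_def Int_iff mem_Collect_eq wt by metis
  ultimately show "u *\<^sub>R W + v *\<^sub>R W' \<in> A \<inter> L" ..
qed

lemma zero_AL: "0 \<in> A \<inter> L"
  by (simp add: A_def L_def monotone_weight_def wt_inner)

theorem facet_dichotomy:
  assumes U: "U \<in> cone_C n e (plucker_ideal n) (toric_ideal n)" and F: "F facet_of A"
  shows "A \<inter> L \<subseteq> F \<or> (F \<inter> (A \<inter> L)) facet_of (A \<inter> L)"
proof -
  obtain G' where G': "G' \<subseteq> tvec ` rels" "A = {x. \<forall>g\<in>G'. 0 \<le> inner g x}"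
    and facets: "\<And>F. F facet_of A \<longleftrightarrow> (\<exists>g\<in>G'. F = A \<inter> {x. inner g x = 0})"
    and wit: "\<And>g. g \<in> G' \<Longrightarrow> \<exists>w\<in>A. inner g w = 0 \<and> (\<forall>h\<in>tvec ` rels. inner h w = 0 \<longrightarrow> (\<exists>l>0. h = l *\<^sub>R g))"
  proof (rule facet_halfspaces [OF _ _ A_rels])
    show "finite (tvec ` rels)" using finite_rels by simp
    show "0 < inner g w0" if "g \<in> tvec ` rels" for g using that rels_w0 by blast
  qed (rule that)
  have kind: "\<exists>r\<in>rels. h = tvec r \<and> ((\<forall>p. tdiff r p = 0) \<or>
      (\<exists>i j. 1 \<le> i \<and> i < j \<and> j < n \<and> (\<forall>p. tdiff r p = elem_pattern i j p)))" if h: "h \<in> G'" for h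
  proof -
    obtain a b m' where r: "(a, b, m') \<in> rels" "h = tvec (a, b, m')" using G'(1) h by force
    obtain w where w: "w \<in> A" "inner h w = 0" "\<forall>g\<in>tvec ` rels. inner g w = 0 \<longrightarrow> (\<exists>l>0. g = l *\<^sub>R h)"
      using wit [OF h] by blast
    have "(\<forall>p. tdiff (a, b, m') p = 0) \<or>
      (\<exists>i j. 1 \<le> i \<and> i < j \<and> j < n \<and> (\<forall>p. tdiff (a, b, m') p = elem_pattern i j p))"
      by (rule facet_classification [OF r(1) w(1)]) (use w r(2) in auto)
    with r show ?thesis by (intro bexI [of _ "(a, b, m')"] conjI)
  qed
  obtain g where g: "g \<in> G'" "F = A \<inter> {x. inner g x = 0}" using facets F by blast
  obtain a b m' where r: "(a, b, m') \<in> rels" "g = tvec (a, b, m')"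
    and cases: "(\<forall>p. tdiff (a, b, m') p = 0) \<or>
      (\<exists>i j. 1 \<le> i \<and> i < j \<and> j < n \<and> (\<forall>p. tdiff (a, b, m') p = elem_pattern i j p))"
    using kind [OF g(1)] by force
  from cases show ?thesis
  proof (elim disjE exE conjE)
    assume zero: "\<forall>p. tdiff (a, b, m') p = 0"
    have "inner g W = 0" if "W \<in> L" for W
      unfolding r(2) by (rule tvec_on_L_zero [OF r(1) _ that]) (rule zero [THEN spec])
    then have "A \<inter> L \<subseteq> F" unfolding g(2) by blast
    then show ?thesis ..
  next
    fix i j assume ij: "1 \<le> i" "i < j" "j < n" and pat: "\<forall>p. tdiff (a, b, m') p = elem_pattern i j p"
    have g_dual: "inner g (dual i j) = 1"
      unfolding r(2) tvec_dual [OF r(1)] using dual_pattern [OF ij, of i j] by (simp add: pat [THEN spec])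
    have "((A \<inter> L) \<inter> {x. inner g x = 0}) facet_of (A \<inter> L)"
    proof (rule facet_by_projection [OF convex_AL zero_AL])
      show "0 \<le> inner g W" if "W \<in> A \<inter> L" for W using that G'(2) g(1) by blast
      show UAL: "U \<in> A \<inter> L" using U toric_cone_subset by blast
      \<comment> \<open>The toric weight is off this hyperplane: a tie at \<open>U\<close> would
        equate the toric exponents, whereas the pattern has the value 1 at
        \<open>(i, j)\<close>.\<close>
      have "inner g U \<noteq> 0"
      proof
        assume "inner g U = 0"
        then have "wt U m' = wt U (vpair a b)" by (simp add: r(2) inner_tvec)
        then have "tdeg n m' = tdeg n (vpair a b)" by (rule toric_cone_tie [OF U relsD(5,4) [OF r(1)]])
        then have "tdiff (a, b, m') (i, j) = 0" by (simp add: tdiff_def)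
        then show False using pat ij by (simp add: elem_pattern_def)
      qed
      moreover have "0 \<le> inner g U" using UAL G'(2) g(1) by blast
      ultimately show "0 < inner g U" by simp
      show "inner g (dual i j) = 1" by (rule g_dual)
      fix W assume W: "W \<in> A \<inter> L"
      \<comment> \<open>Moving along the dual vector makes this functional vanish and changes no
        functional of another pattern, so the projected point still satisfies all
        inequalities.\<close>
      define X where "X = W - inner g W *\<^sub>R dual i j"
      have "X \<in> L" using L_linear [OF _ dual_L, of W "- inner g W" i j] W by (simp add: X_def)
      moreover have "0 \<le> inner h X" if h: "h \<in> G'" for h
      proof -
        obtain a2 b2 m2 where r2: "(a2, b2, m2) \<in> rels" "h = tvec (a2, b2, m2)"
          and cases2: "(\<forall>p. tdiff (a2, b2, m2) p = 0) \<or>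
            (\<exists>i j. 1 \<le> i \<and> i < j \<and> j < n \<and> (\<forall>p. tdiff (a2, b2, m2) p = elem_pattern i j p))"
          using kind [OF h] by force
        from cases2 show ?thesis
        proof (elim disjE exE conjE)
          assume zero: "\<forall>p. tdiff (a2, b2, m2) p = 0"
          show ?thesis using tvec_on_L_zero [OF r2(1) zero [THEN spec] \<open>X \<in> L\<close>] r2(2) by simp
        next
          fix i' j' assume ij': "1 \<le> i'" "i' < j'" "j' < n" and pat': "\<forall>p. tdiff (a2, b2, m2) p = elem_pattern i' j' p"
          show ?thesis
          proof (cases "i = i' \<and> j = j'")
            case True
            have "inner h X = inner g X"
              unfolding r(2) r2(2) by (rule tvec_on_L [OF r2(1) r(1) _ \<open>X \<in> L\<close>]) (simp add: pat [THEN spec] pat' [THEN spec] True)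
            also have "\<dots> = 0" using g_dual by (simp add: X_def inner_diff_right)
            finally show ?thesis by simp
          next
            case False
            have "inner h (dual i j) = 0"
              unfolding r2(2) tvec_dual [OF r2(1)] using dual_pattern [OF ij', of i j] False by (simp add: pat' [THEN spec])
            moreover have "0 \<le> inner h W" using W G'(2) h by blast
            ultimately show ?thesis by (simp add: X_def inner_diff_right)
          qed
        qed
      qed
      ultimately show "W - inner g W *\<^sub>R dual i j \<in> A \<inter> L" using G'(2) by (simp add: X_def)
    qed
    moreover have "F \<inter> (A \<inter> L) = (A \<inter> L) \<inter> {x. inner g x = 0}" unfolding g(2) by blast
    ultimately show ?thesis by simp
  qed
qed

end

theorem theorem9p4:
  fixes n :: nat
    and e :: "'b::finite \<Rightarrow> nat list"
    and F :: "(real ^ 'b) set"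
  assumes "n \<ge> 2"
    and "bij_betw e UNIV (pbw_cols n)"
    and "F facet_of closure (cone_C n e (plucker_ideal n) (monomial_ideal n))"
  shows "closure (cone_C n e (plucker_ideal n) (toric_ideal n)) \<subseteq> F \<or>
    (F \<inter> closure (cone_C n e (plucker_ideal n) (toric_ideal n)))
      facet_of closure (cone_C n e (plucker_ideal n) (toric_ideal n))"
proof (cases "cone_C n e (plucker_ideal n) (toric_ideal n) = {}")
  case True
  then show ?thesis by simp
next
  case False
  then obtain U where U: "U \<in> cone_C n e (plucker_ideal n) (toric_ideal n)" by blast
  have "cone_C n e (plucker_ideal n) (monomial_ideal n) \<noteq> {}"
    using assms(3) by (auto simp: facet_of_def)
  then obtain w0 where w0: "w0 \<in> cone_C n e (plucker_ideal n) (monomial_ideal n)" by blast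
  interpret plucker_cones n e w0 by unfold_locales (fact assms(1,2) w0)+
  show ?thesis
    unfolding closure_toric_cone [OF U]
    by (rule facet_dichotomy [OF U]) (use assms(3) in \<open>simp add: closure_monomial_cone\<close>)
qed

end
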